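(* Let $(\xi_n)_{n\in\mathbb{Z}}$ be a stationary reversible Markov chain as in the context, let $f\in\mathbb{L}_0^2(\pi)$, $X_i=f(\xi_i)$, $S_n=\sum_{i=1}^n X_i$, $\sigma_n=(\mathbb{E}S_n^2)^{1/2}$, and assume $\sigma_n\to\infty$. Assume that $\sigma_n^2=n h(n)$ for a function $h$ slowly varying at infinity (i.e. $\lim_{n\to\infty}h(nt)/h(n)=1$ for all $t>0$), and that $S_n/\sigma_n$ converges conditionally in distribution to a random variable $L$, i.e. for every bounded continuous $g:\mathbb{R}\to\mathbb{R}$, $\mathbb{E}(g(S_n/\sigma_n)\mid\mathcal{F}_0)\to\mathbb{E}g(L)$ in probability. Then, with $W_n(t)=S_{[nt]}/\sigma_n$, $t\in[0,1]$, $$W_n(\cdot)\Rightarrow cW(\cdot)$$ weakly in $D[0,1]$, where $W$ is a standard Brownian motion and $c$ is the standard deviation of $L$ (in particular $L$ is centered normal).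
   Context: $(\xi_n)_{n\in\mathbb{Z}}$ is a stationary Markov chain on a probability space $(\Omega,\mathcal{F},\mathbb{P})$ with values in a general measurable state space $(S,\mathcal{A})$, with marginal law $\pi(A)=\mathbb{P}(\xi_0\in A)$ and transition kernel $Q(x,A)=\mathbb{P}(\xi_1\in A\mid \xi_0=x)$; $Q$ also denotes the operator $(Qf)(x)=\int f(s)Q(x,ds)$. $\mathbb{L}_0^2(\pi)$ is the set of measurable $f$ with $\int f^2d\pi<\infty$ and $\int f d\pi=0$. The chain is reversible if $Q=Q^*$ on $\mathbb{L}^2(\pi)$, equivalently $(\xi_0,\xi_1)$ and $(\xi_1,\xi_0)$ have the same law. $\mathcal{F}_k=\sigma(\xi_i,i\le k)$. $[x]$ is the integer part of $x$; $\Rightarrow$ denotes weak convergence. *)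

theory Defs
  imports "HOL-Probability.Probability"
begin

definition past_sigma :: "'w measure \<Rightarrow> 's measure \<Rightarrow> (int \<Rightarrow> 'w \<Rightarrow> 's) \<Rightarrow> int \<Rightarrow> 'w measure" where
  "past_sigma M S \<xi> k =
     sigma (space M) {\<xi> i -` A \<inter> space M | i A. i \<le> k \<and> A \<in> sets S}"

definition stationary_markov_chain ::
  "'w measure \<Rightarrow> 's measure \<Rightarrow> (int \<Rightarrow> 'w \<Rightarrow> 's) \<Rightarrow> 's measure \<Rightarrow> ('s \<Rightarrow> 's measure) \<Rightarrow> bool" where
  "stationary_markov_chain M S \<xi> \<pi> Q \<longleftrightarrow>
     prob_space M \<and>
     (\<forall>n. \<xi> n \<in> M \<rightarrow>\<^sub>M S) \<and>
     (\<forall>n. distr M S (\<xi> n) = \<pi>) \<and>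
     Q \<in> S \<rightarrow>\<^sub>M prob_algebra S \<and>
     (\<forall>n. \<forall>A\<in>sets S.
        AE \<omega> in M. real_cond_exp M (past_sigma M S \<xi> n) (\<lambda>\<omega>. indicator A (\<xi> (n + 1) \<omega>)) \<omega>
                   = measure (Q (\<xi> n \<omega>)) A)"

definition reversible_chain :: "'w measure \<Rightarrow> 's measure \<Rightarrow> (int \<Rightarrow> 'w \<Rightarrow> 's) \<Rightarrow> bool" where
  "reversible_chain M S \<xi> \<longleftrightarrow>
     distr M (S \<Otimes>\<^sub>M S) (\<lambda>\<omega>. (\<xi> 0 \<omega>, \<xi> 1 \<omega>)) = distr M (S \<Otimes>\<^sub>M S) (\<lambda>\<omega>. (\<xi> 1 \<omega>, \<xi> 0 \<omega>))"

definition L2_0 :: "'s measure \<Rightarrow> ('s \<Rightarrow> real) \<Rightarrow> bool" where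
  "L2_0 \<pi> f \<longleftrightarrow> f \<in> borel_measurable \<pi> \<and> integrable \<pi> (\<lambda>x. (f x)\<^sup>2) \<and> (\<integral>x. f x \<partial>\<pi>) = 0"

definition slowly_varying :: "(real \<Rightarrow> real) \<Rightarrow> bool" where
  "slowly_varying h \<longleftrightarrow> h \<in> borel_measurable borel \<and> (\<exists>a. \<forall>x\<ge>a. h x > 0) \<and>
     (\<forall>t>0. ((\<lambda>x. h (x * t) / h x) \<longlongrightarrow> 1) at_top)"

definition D01 :: "(real \<Rightarrow> real) set" where
  "D01 = {x. (\<forall>t\<in>{0..<1}. (x \<longlongrightarrow> x t) (at_right t)) \<and>
             (\<forall>t\<in>{0<..1}. \<exists>l. (x \<longlongrightarrow> l) (at_left t))}"

definition time_changes :: "(real \<Rightarrow> real) set" where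
  "time_changes = {r. strict_mono_on {0..1} r \<and> continuous_on {0..1} r \<and> r 0 = 0 \<and> r 1 = 1}"

definition skorokhod_dist :: "(real \<Rightarrow> real) \<Rightarrow> (real \<Rightarrow> real) \<Rightarrow> real" where
  "skorokhod_dist x y = Inf {\<epsilon>. \<epsilon> > 0 \<and> (\<exists>r\<in>time_changes.
      \<forall>t\<in>{0..1}. \<bar>r t - t\<bar> \<le> \<epsilon> \<and> \<bar>x t - y (r t)\<bar> \<le> \<epsilon>)}"

definition bounded_cont_D :: "((real \<Rightarrow> real) \<Rightarrow> real) \<Rightarrow> bool" where
  "bounded_cont_D F \<longleftrightarrow> (\<exists>B. \<forall>x\<in>D01. \<bar>F x\<bar> \<le> B) \<and>
     (\<forall>x\<in>D01. \<forall>e>0. \<exists>d>0. \<forall>y\<in>D01. skorokhod_dist x y < d \<longrightarrow> \<bar>F y - F x\<bar> < e)"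

definition weak_conv_D ::
  "'w measure \<Rightarrow> (nat \<Rightarrow> 'w \<Rightarrow> real \<Rightarrow> real) \<Rightarrow> 'b measure \<Rightarrow> ('b \<Rightarrow> real \<Rightarrow> real) \<Rightarrow> bool" where
  "weak_conv_D M X N Y \<longleftrightarrow>
     (\<forall>F. bounded_cont_D F \<longrightarrow>
        (\<lambda>n. \<integral>\<omega>. F (X n \<omega>) \<partial>M) \<longlonglongrightarrow> (\<integral>\<omega>. F (Y \<omega>) \<partial>N))"

definition std_brownian_motion :: "'b measure \<Rightarrow> (real \<Rightarrow> 'b \<Rightarrow> real) \<Rightarrow> bool" where
  "std_brownian_motion N B \<longleftrightarrow>
     prob_space N \<and>
     (\<forall>t. B t \<in> borel_measurable N) \<and>
     (\<forall>\<omega>\<in>space N. B 0 \<omega> = 0 \<and> continuous_on {0..1} (\<lambda>t. B t \<omega>)) \<and>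
     (\<forall>s t. 0 \<le> s \<longrightarrow> s < t \<longrightarrow> t \<le> 1 \<longrightarrow>
        distributed N lborel (\<lambda>\<omega>. B t \<omega> - B s \<omega>) (\<lambda>x. ennreal (normal_density 0 (sqrt (t - s)) x))) \<and>
     (\<forall>ts :: nat \<Rightarrow> real. \<forall>k. 0 \<le> ts 0 \<and> ts k \<le> 1 \<and> (\<forall>i<k. ts i \<le> ts (Suc i)) \<longrightarrow>
        prob_space.indep_vars N (\<lambda>_. borel) (\<lambda>i \<omega>. B (ts (Suc i)) \<omega> - B (ts i) \<omega>) {..<k})"

end

theory Submission
  imports Defs
begin

text \<open>
  Write $V_n = Q + \dots + Q^n$ and $\sigma_n^2 = \mathbb{E} S_n^2$. Reversibility turns the covariance of the two
  halves of $S_{2n}$ into $\|V_n f\|^2$ up to bounded factors, so $\sigma_{2n}^2/\sigma_n^2 \to 2$ forces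
  $\|V_n f\| = o(\sigma_n)$. Hence the averaged solution of Poisson's equation gives
  $2 S_k = M_k + M'_k + {}$ error, with $M$ a martingale, $M'$ a martingale in reversed time and an error whose maximum
  over $k \le n$ is $o(\sigma_n)$ (this needs $\sigma_n^2 \ge cn - C$ to control $\max_k |f(\xi_k)|$). Moreover
  $M_n = S_n + o(\sigma_n)$ in $L^2$. Doob's inequality bounds the maximum by the truncated first moment of
  $|S_n|/\sigma_n$, which converges because the second moments are bounded; so
  $\lambda^2 \limsup_n P(\max_{k \le n} |S_k| > 2\lambda\sigma_n) \to 0$ as $\lambda \to \infty$ merely from $\mathbb{E} L^2 < \infty$,
  without uniform integrability of $S_n^2/\sigma_n^2$. This is tightness. Conditioning successively on the past makes disjoint
  blocks asymptotically independent copies of $L$, so $L$ is distributed like $m^{-1/2}$ times a sum of $m$ independent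
  copies of itself and is normal by the central limit theorem.
\<close>

section \<open>Square-integrable random variables\<close>

text \<open>Nothing prevents the second moments of S_n/\<sigma>_n from losing mass in the limit:
  only E L^2 \<le> 1 is available, and c = 0 has to be carried along. What must survive the limit is
  therefore phrased through first moments. Boundedness in L2 makes |S_n|/\<sigma>_n uniformly
  integrable, and the first moment of |L| beyond b is o(1/b). This little-o is exactly what blocking
  consumes: with m blocks, a level e for the whole path becomes a level b of order e sqrt m inside
  one block, and the union over the blocks costs a factor m, of order b^2. A one-sided martingale
  approximation would leave a term Qg(\<xi>_k), with g the approximate solution of Poisson's
  equation, whose maximum over k is not controlled by its L2 norm. Adding the approximation of the
  reversed path cancels it and leaves single values of f and averages of V_n f; this is the reason
  for working with the law of the two-sided trajectory and its invariance under reflection.\<close>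

definition L2 :: "'a measure \<Rightarrow> ('a \<Rightarrow> real) \<Rightarrow> bool" where
  "L2 M X \<longleftrightarrow> X \<in> borel_measurable M \<and> integrable M (\<lambda>x. (X x)\<^sup>2)"

definition L2norm :: "'a measure \<Rightarrow> ('a \<Rightarrow> real) \<Rightarrow> real" where
  "L2norm M X = sqrt (\<integral>x. (X x)\<^sup>2 \<partial>M)"

lemma L2_measurable [measurable_dest]: "L2 M X \<Longrightarrow> X \<in> borel_measurable M"
  by (simp add: L2_def)

lemma L2_sq: "L2 M X \<Longrightarrow> integrable M (\<lambda>x. (X x)\<^sup>2)"
  by (simp add: L2_def)

lemma L2_mult_integrable:
  assumes "L2 M X" "L2 M Y"
  shows "integrable M (\<lambda>x. X x * Y x)"
proof (rule Bochner_Integration.integrable_bound)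
  show "integrable M (\<lambda>x. (X x)\<^sup>2 + (Y x)\<^sup>2)"
    using assms by (auto simp: L2_def)
  show "(\<lambda>x. X x * Y x) \<in> borel_measurable M"
    using assms by (auto simp: L2_def)
  have "\<bar>a\<bar> * \<bar>b\<bar> \<le> a\<^sup>2 + b\<^sup>2" for a b :: real
    using sum_squares_bound[of "\<bar>a\<bar>" "\<bar>b\<bar>"] mult_nonneg_nonneg[of "\<bar>a\<bar>" "\<bar>b\<bar>"] by (simp, linarith)
  then show "AE x in M. norm (X x * Y x) \<le> norm ((X x)\<^sup>2 + (Y x)\<^sup>2)"
    by (auto simp: abs_mult)
qed

lemma L2_add: "L2 M X \<Longrightarrow> L2 M Y \<Longrightarrow> L2 M (\<lambda>x. X x + Y x)"
  using L2_mult_integrable[of M X Y] by (auto simp: L2_def power2_sum mult.assoc)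

lemma L2_scale: "L2 M X \<Longrightarrow> L2 M (\<lambda>x. c * X x)"
  by (auto simp: L2_def power_mult_distrib)

lemma L2_divide: "L2 M X \<Longrightarrow> L2 M (\<lambda>x. X x / c)"
  using L2_scale[of M X "1 / c"] by simp

lemma L2_minus: "L2 M X \<Longrightarrow> L2 M (\<lambda>x. - X x)"
  using L2_scale[of M X "-1"] by simp

lemma L2_diff: "L2 M X \<Longrightarrow> L2 M Y \<Longrightarrow> L2 M (\<lambda>x. X x - Y x)"
  using L2_add[of M X "\<lambda>x. - Y x"] L2_minus[of M Y] by simp

lemma L2_abs: "L2 M X \<Longrightarrow> L2 M (\<lambda>x. \<bar>X x\<bar>)"
  by (auto simp: L2_def)

lemma L2_sum: "(\<And>i. i \<in> I \<Longrightarrow> L2 M (X i)) \<Longrightarrow> L2 M (\<lambda>x. \<Sum>i\<in>I. X i x)"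
proof (induction I rule: infinite_finite_induct)
  case (insert i I)
  then show ?case using L2_add[of M "X i" "\<lambda>x. \<Sum>i\<in>I. X i x"] by simp
qed (auto simp: L2_def)

lemmas L2_intros = L2_add L2_scale L2_divide L2_minus L2_diff L2_abs L2_sum

lemma (in prob_space) L2_integrable: "L2 M X \<Longrightarrow> integrable M X"
  using square_integrable_imp_integrable by (auto simp: L2_def)

lemma (in finite_measure) L2_bounded:
  assumes "X \<in> borel_measurable M" "\<And>x. \<bar>X x\<bar> \<le> B"
  shows "L2 M X"
proof -
  have "(X x)\<^sup>2 \<le> B\<^sup>2" for x
    using assms(2)[of x] abs_le_square_iff[of "X x" B] by auto
  then show ?thesis
    using assms(1) by (auto simp: L2_def intro!: integrable_const_bound[where B = "B\<^sup>2"])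
qed

lemma L2norm_nonneg [simp]: "0 \<le> L2norm M X"
  by (simp add: L2norm_def)

lemma L2norm_sq: "(L2norm M X)\<^sup>2 = (\<integral>x. (X x)\<^sup>2 \<partial>M)"
  by (simp add: L2norm_def)

lemma L2_cauchy_schwarz:
  assumes X: "L2 M X" and Y: "L2 M Y"
  shows "\<bar>\<integral>x. X x * Y x \<partial>M\<bar> \<le> L2norm M X * L2norm M Y"
proof -
  define a b c where "a = (\<integral>x. (X x)\<^sup>2 \<partial>M)" and "b = (\<integral>x. (Y x)\<^sup>2 \<partial>M)"
    and "c = (\<integral>x. X x * Y x \<partial>M)"
  note i = L2_sq[OF X] L2_sq[OF Y] L2_mult_integrable[OF X Y]
  have *: "0 \<le> s\<^sup>2 * a + 2 * s * t * c + t\<^sup>2 * b" for s t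
  proof -
    have "0 \<le> (\<integral>x. (s * X x + t * Y x)\<^sup>2 \<partial>M)" by simp
    also have "\<dots> = (\<integral>x. s\<^sup>2 * (X x)\<^sup>2 + 2 * s * t * (X x * Y x) + t\<^sup>2 * (Y x)\<^sup>2 \<partial>M)"
      by (simp add: power2_eq_square algebra_simps)
    finally show ?thesis using i by (simp add: a_def b_def c_def)
  qed
  have "c\<^sup>2 \<le> a * b"
  proof (cases "a = 0")
    case True
    have "c = 0"
    proof (rule ccontr)
      assume "c \<noteq> 0"
      \<comment> \<open>For a = 0 the form at t = 1 is 2 s c + b; this s makes it -1.\<close>
      with *[of "- (b + 1) / (2 * c)" 1] True show False by (simp add: field_simps)
    qed
    then show ?thesis using True by simp
  next
    case False
    then have "a > 0" unfolding a_def by (simp add: less_le)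
    \<comment> \<open>At s = -c, t = a the form factors as a (a b - c^2).\<close>
    from *[of "-c" a] have "0 \<le> a * (a * b - c\<^sup>2)"
      by (simp add: power2_eq_square algebra_simps)
    then show ?thesis using \<open>a > 0\<close> by (simp add: zero_le_mult_iff)
  qed
  then have "sqrt (c\<^sup>2) \<le> sqrt (a * b)" by (rule real_sqrt_le_mono)
  then show ?thesis by (simp add: L2norm_def a_def b_def c_def real_sqrt_mult)
qed

lemma L2norm_triangle:
  assumes X: "L2 M X" and Y: "L2 M Y"
  shows "L2norm M (\<lambda>x. X x + Y x) \<le> L2norm M X + L2norm M Y"
proof (rule power2_le_imp_le)
  note i = L2_sq[OF X] L2_sq[OF Y] L2_mult_integrable[OF X Y]
  have "(L2norm M (\<lambda>x. X x + Y x))\<^sup>2 = (\<integral>x. (X x)\<^sup>2 + (Y x)\<^sup>2 + 2 * (X x * Y x) \<partial>M)"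
    by (simp add: L2norm_sq power2_sum mult.assoc)
  also have "\<dots> = (L2norm M X)\<^sup>2 + (L2norm M Y)\<^sup>2 + 2 * (\<integral>x. X x * Y x \<partial>M)"
    using i by (simp add: L2norm_sq)
  also have "\<dots> \<le> (L2norm M X + L2norm M Y)\<^sup>2"
    using L2_cauchy_schwarz[OF X Y] by (simp add: power2_sum)
  finally show "(L2norm M (\<lambda>x. X x + Y x))\<^sup>2 \<le> (L2norm M X + L2norm M Y)\<^sup>2" .
qed simp

lemma L2norm_minus [simp]: "L2norm M (\<lambda>x. - X x) = L2norm M X"
  by (simp add: L2norm_def)

lemma L2norm_triangle_diff:
  assumes X: "L2 M X" and Y: "L2 M Y"
  shows "L2norm M (\<lambda>x. X x - Y x) \<le> L2norm M X + L2norm M Y"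
  using L2norm_triangle[OF X L2_minus[OF Y]] by simp

lemma (in prob_space) L1_le_L2norm:
  assumes X: "L2 M X"
  shows "(\<integral>x. \<bar>X x\<bar> \<partial>M) \<le> L2norm M X"
proof -
  have "L2 M (\<lambda>_. 1 :: real)" by (rule L2_bounded) auto
  from L2_cauchy_schwarz[OF L2_abs[OF X] this] show ?thesis
    by (simp add: L2norm_def prob_space)
qed

lemma (in prob_space) L2norm_markov:
  assumes X: "L2 M X" and a: "a > 0"
  shows "measure M {w\<in>space M. \<bar>X w\<bar> > a} \<le> (L2norm M X)\<^sup>2 / a\<^sup>2"
proof -
  have [measurable]: "X \<in> borel_measurable M" using X by (rule L2_measurable)
  have "a\<^sup>2 * measure M {w\<in>space M. \<bar>X w\<bar> > a} = (\<integral>w. a\<^sup>2 * indicator {w\<in>space M. \<bar>X w\<bar> > a} w \<partial>M)"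
    by simp
  also have "\<dots> \<le> (\<integral>w. (X w)\<^sup>2 \<partial>M)"
  proof (rule integral_mono)
    fix w assume "w \<in> space M"
    show "a\<^sup>2 * indicator {w\<in>space M. \<bar>X w\<bar> > a} w \<le> (X w)\<^sup>2"
      using a abs_le_square_iff[of a "X w"] by (auto simp: indicator_def)
  qed (use L2_sq[OF X] in \<open>auto simp: emeasure_eq_measure\<close>)
  finally show ?thesis using a by (simp add: L2norm_sq field_simps)
qed

lemma integral_add_sq:
  assumes "L2 M X" "L2 M Y"
  shows "(\<integral>w. (X w + Y w)\<^sup>2 \<partial>M) = (\<integral>w. (X w)\<^sup>2 \<partial>M) + 2 * (\<integral>w. X w * Y w \<partial>M) + (\<integral>w. (Y w)\<^sup>2 \<partial>M)"
proof -
  have "(\<integral>w. (X w + Y w)\<^sup>2 \<partial>M) = (\<integral>w. (X w)\<^sup>2 + 2 * (X w * Y w) + (Y w)\<^sup>2 \<partial>M)"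
    by (simp add: power2_eq_square algebra_simps)
  also have "\<dots> = (\<integral>w. (X w)\<^sup>2 \<partial>M) + 2 * (\<integral>w. X w * Y w \<partial>M) + (\<integral>w. (Y w)\<^sup>2 \<partial>M)"
    using L2_sq[OF assms(1)] L2_sq[OF assms(2)] L2_mult_integrable[OF assms] by simp
  finally show ?thesis .
qed

lemma integral_diff_sq_le:
  assumes "L2 M X" "L2 M Y"
  shows "(\<integral>w. (X w - Y w)\<^sup>2 \<partial>M) \<le> 2 * (\<integral>w. (X w)\<^sup>2 \<partial>M) + 2 * (\<integral>w. (Y w)\<^sup>2 \<partial>M)"
proof -
  have "(\<integral>w. (X w - Y w)\<^sup>2 \<partial>M) \<le> (\<integral>w. 2 * (X w)\<^sup>2 + 2 * (Y w)\<^sup>2 \<partial>M)"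
  proof (rule integral_mono)
    show "integrable M (\<lambda>w. (X w - Y w)\<^sup>2)" by (rule L2_sq[OF L2_diff[OF assms]])
    show "integrable M (\<lambda>w. 2 * (X w)\<^sup>2 + 2 * (Y w)\<^sup>2)" using L2_sq[OF assms(1)] L2_sq[OF assms(2)] by simp
    fix w show "(X w - Y w)\<^sup>2 \<le> 2 * (X w)\<^sup>2 + 2 * (Y w)\<^sup>2"
      using zero_le_power2[of "X w + Y w"] by (simp add: power2_eq_square algebra_simps)
  qed
  also have "\<dots> = 2 * (\<integral>w. (X w)\<^sup>2 \<partial>M) + 2 * (\<integral>w. (Y w)\<^sup>2 \<partial>M)"
    using L2_sq[OF assms(1)] L2_sq[OF assms(2)] by simp
  finally show ?thesis .
qed

lemma L2norm_sum_le:
  "finite I \<Longrightarrow> (\<And>i. i \<in> I \<Longrightarrow> L2 M (X i)) \<Longrightarrow> L2norm M (\<lambda>x. \<Sum>i\<in>I. X i x) \<le> (\<Sum>i\<in>I. L2norm M (X i))"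
proof (induction I rule: finite_induct)
  case (insert i I)
  have "L2norm M (\<lambda>x. X i x + (\<Sum>i\<in>I. X i x)) \<le> L2norm M (X i) + L2norm M (\<lambda>x. \<Sum>i\<in>I. X i x)"
    using insert by (intro L2norm_triangle L2_sum) auto
  then show ?case using insert by simp
qed (simp add: L2norm_def)

lemma L2norm_scale: "L2norm M (\<lambda>x. c * X x) = \<bar>c\<bar> * L2norm M X"
  by (simp add: L2norm_def power_mult_distrib real_sqrt_mult)

lemma L2norm_abs: "L2norm M (\<lambda>x. \<bar>X x\<bar>) = L2norm M X"
  by (simp add: L2norm_def)

section \<open>Truncated second moments and first passage times\<close>

lemma abs_le_square_tail:
  fixes x a :: real
  assumes "a > 0"
  shows "a\<^sup>2 * of_bool (\<bar>x\<bar> > a) \<le> x\<^sup>2 * of_bool (\<bar>x\<bar> > a)"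
  using assms abs_le_square_iff[of a x] by auto

text \<open>Chebyshev's inequality with the indicator kept on the right. The truncated moment tends
  to 0 as the level grows, which beats the plain bound when a union over about a^2 variables is
  taken.\<close>

lemma (in prob_space) tail_truncated_second_moment:
  assumes X: "L2 M X" and a: "a > 0"
  shows "a\<^sup>2 * prob {w\<in>space M. \<bar>X w\<bar> > a} \<le> (\<integral>w. (X w)\<^sup>2 * of_bool (\<bar>X w\<bar> > a) \<partial>M)"
proof -
  have [measurable]: "X \<in> borel_measurable M" using X by (rule L2_measurable)
  have "a\<^sup>2 * prob {w\<in>space M. \<bar>X w\<bar> > a} = (\<integral>w. a\<^sup>2 * indicator {w\<in>space M. \<bar>X w\<bar> > a} w \<partial>M)"
    by simp
  also have "\<dots> \<le> (\<integral>w. (X w)\<^sup>2 * of_bool (\<bar>X w\<bar> > a) \<partial>M)"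
  proof (rule integral_mono)
    show "integrable M (\<lambda>w. (X w)\<^sup>2 * of_bool (\<bar>X w\<bar> > a))"
      by (rule Bochner_Integration.integrable_bound[OF L2_sq[OF X]]) auto
    fix w assume "w \<in> space M"
    then show "a\<^sup>2 * indicator {w\<in>space M. \<bar>X w\<bar> > a} w \<le> (X w)\<^sup>2 * of_bool (\<bar>X w\<bar> > a)"
      using abs_le_square_tail[OF a, of "X w"] by (auto simp: indicator_def)
  qed (auto simp: emeasure_eq_measure)
  finally show ?thesis .
qed

lemma (in prob_space) truncated_second_moment_LIMSEQ_0:
  assumes X: "L2 M X" and b: "filterlim b at_top sequentially"
  shows "(\<lambda>n. \<integral>w. (X w)\<^sup>2 * of_bool (\<bar>X w\<bar> > b n) \<partial>M) \<longlonglongrightarrow> 0"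
proof -
  have [measurable]: "X \<in> borel_measurable M" using X by (rule L2_measurable)
  have "(\<lambda>n. \<integral>w. (X w)\<^sup>2 * of_bool (\<bar>X w\<bar> > b n) \<partial>M) \<longlonglongrightarrow> (\<integral>w. 0 \<partial>M)"
  proof (rule integral_dominated_convergence[where w = "\<lambda>w. (X w)\<^sup>2"])
    show "AE w in M. (\<lambda>n. (X w)\<^sup>2 * of_bool (\<bar>X w\<bar> > b n)) \<longlonglongrightarrow> 0"
    proof (intro AE_I2)
      fix w
      have "eventually (\<lambda>n. b n \<ge> \<bar>X w\<bar>) sequentially" using b by (simp add: filterlim_at_top)
      then show "(\<lambda>n. (X w)\<^sup>2 * of_bool (\<bar>X w\<bar> > b n)) \<longlonglongrightarrow> 0"
        by (intro tendsto_eventually) (auto elim!: eventually_mono simp: not_less)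
    qed
  qed (use L2_sq[OF X] in auto)
  then show ?thesis by simp
qed

lemma (in prob_space) prob_eq_integral_of_bool:
  "prob {w\<in>space M. P w} = (\<integral>w. of_bool (P w) \<partial>M)"
proof -
  have "(\<integral>w. of_bool (P w) \<partial>M) = (\<integral>w. indicator {w\<in>space M. P w} w \<partial>M)"
    by (intro Bochner_Integration.integral_cong) (auto simp: indicator_def)
  also have "\<dots> = prob ({w\<in>space M. P w} \<inter> space M)" by (rule Bochner_Integration.integral_indicator)
  also have "{w\<in>space M. P w} \<inter> space M = {w\<in>space M. P w}" by auto
  finally show ?thesis ..
qed

text \<open>At most one index is the first passage, and one exists as soon as the passage has
  occurred.\<close>

lemma sum_first_passage:
  fixes P :: "nat \<Rightarrow> bool"
  shows "(\<Sum>k\<le>n. of_bool (P k \<and> (\<forall>i<k. \<not> P i))) = (of_bool (\<exists>k\<le>n. P k) :: real)"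
proof (induction n)
  case (Suc n)
  have "(\<exists>k\<le>Suc n. P k) \<longleftrightarrow> (\<exists>k\<le>n. P k) \<or> P (Suc n)" by (auto simp: le_Suc_eq)
  moreover have "(\<forall>i<Suc n. \<not> P i) \<longleftrightarrow> \<not> (\<exists>k\<le>n. P k)" by (auto simp: less_Suc_eq_le)
  ultimately show ?case using Suc by simp
qed simp

section \<open>Markov property and time reversal\<close>

locale reversible_markov =
  fixes M :: "'w measure" and S :: "'s measure" and \<xi> :: "int \<Rightarrow> 'w \<Rightarrow> 's"
    and \<pi> :: "'s measure" and Q :: "'s \<Rightarrow> 's measure"
  assumes chain: "stationary_markov_chain M S \<xi> \<pi> Q"
    and rev: "reversible_chain M S \<xi>"

sublocale reversible_markov \<subseteq> prob_space M
  using chain by (simp add: stationary_markov_chain_def)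

context reversible_markov
begin

abbreviation "past \<equiv> past_sigma M S \<xi>"

lemma measurable_xi [measurable]: "\<xi> n \<in> M \<rightarrow>\<^sub>M S"
  using chain by (simp add: stationary_markov_chain_def)

lemma distr_xi: "distr M S (\<xi> n) = \<pi>"
  using chain by (simp add: stationary_markov_chain_def)

lemma sets_pi [measurable_cong]: "sets \<pi> = sets S"
  using distr_xi[of 0] sets_distr[of M S "\<xi> 0"] by simp

lemma measurable_Q [measurable]: "Q \<in> S \<rightarrow>\<^sub>M prob_algebra S"
  using chain by (simp add: stationary_markov_chain_def)

lemma measurable_Q' [measurable]: "Q \<in> S \<rightarrow>\<^sub>M subprob_algebra S"
  by (rule measurable_prob_algebraD) measurable

lemma prob_space_Q: "x \<in> space S \<Longrightarrow> prob_space (Q x)"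
  and sets_Q: "x \<in> space S \<Longrightarrow> sets (Q x) = sets S"
  using measurable_space[OF measurable_Q, of x] by (auto simp: space_prob_algebra)

lemma xi_space: "w \<in> space M \<Longrightarrow> \<xi> n w \<in> space S"
  using measurable_space[OF measurable_xi] .

lemma past_gen: "{\<xi> i -` A \<inter> space M | i A. i \<le> k \<and> A \<in> sets S} \<subseteq> Pow (space M)"
  by auto

lemma space_past [simp]: "space (past k) = space M"
  unfolding past_sigma_def by (rule space_measure_of[OF past_gen])

lemma subalgebra_past: "subalgebra M (past k)"
proof -
  have "sigma_sets (space M) {\<xi> i -` A \<inter> space M | i A. i \<le> k \<and> A \<in> sets S} \<subseteq> sets M"
    by (rule sets.sigma_sets_subset) (auto intro: measurable_sets)
  then show ?thesis
    by (auto simp: subalgebra_def past_sigma_def sets_measure_of[OF past_gen] space_measure_of[OF past_gen])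
qed

lemma measurable_past_xi [measurable]: "i \<le> k \<Longrightarrow> \<xi> i \<in> past k \<rightarrow>\<^sub>M S"
proof (rule measurableI)
  fix A assume "i \<le> k" "A \<in> sets S"
  then show "\<xi> i -` A \<inter> space (past k) \<in> sets (past k)"
    unfolding space_past
    unfolding past_sigma_def sets_measure_of[OF past_gen] by (auto intro!: sigma_sets.Basic)
qed (auto simp: xi_space)

lemma measurable_from_past: "X \<in> past k \<rightarrow>\<^sub>M N \<Longrightarrow> X \<in> M \<rightarrow>\<^sub>M N"
  by (rule measurable_from_subalg[OF subalgebra_past])

lemma sigma_finite_past: "sigma_finite_subalgebra M (past k)"
  by (rule finite_measure_subalgebra_is_sigma_finite)
     (simp add: finite_measure_subalgebra_def finite_measure_subalgebra_axioms_def
        subalgebra_past finite_measure_axioms)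

section \<open>The Markov property for nonnegative integrands\<close>

abbreviation Q_nn :: "('s \<Rightarrow> ennreal) \<Rightarrow> 's \<Rightarrow> ennreal" where
  "Q_nn g x \<equiv> \<integral>\<^sup>+y. g y \<partial>Q x"

lemma measurable_Q_nn [measurable]: "g \<in> borel_measurable S \<Longrightarrow> Q_nn g \<in> borel_measurable S"
  by (rule measurable_compose[OF measurable_Q' nn_integral_measurable_subprob_algebra])

text \<open>The almost sure identity for conditional expectations is turned into an equality of
  nonnegative integrals, a form that extends by monotone limits with no integrability to check:
  \<open>markov_indicator_fun\<close> extends it in the future factor, \<open>markov_nn\<close> in
  the past one.\<close>

lemma markov_indicator:
  assumes A: "A \<in> sets (past k)" and B: "B \<in> sets S"
  shows "(\<integral>\<^sup>+w. indicator A w * indicator B (\<xi> (k + 1) w) \<partial>M) = (\<integral>\<^sup>+w. indicator A w * emeasure (Q (\<xi> k w)) B \<partial>M)"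
proof -
  interpret sigma_finite_subalgebra M "past k" by (rule sigma_finite_past)
  have [measurable]: "A \<in> sets M" using A subalgebra_past by (auto simp: subalgebra_def)
  note [measurable] = B
  have AE_Q: "AE w in M. real_cond_exp M (past k) (\<lambda>w. indicator B (\<xi> (k + 1) w)) w = measure (Q (\<xi> k w)) B"
    using chain B unfolding stationary_markov_chain_def by blast
  have int: "integrable M (\<lambda>w. indicator A w * indicator B (\<xi> (k + 1) w) :: real)"
    by (rule integrable_const_bound[where B = 1]) (auto simp: indicator_def)
  have Am: "(indicator A :: _ \<Rightarrow> real) \<in> borel_measurable (past k)" using A by simp
  have mQ: "(\<lambda>x. measure (Q x) B) \<in> borel_measurable S"
    using B by (intro measurable_compose[OF measurable_Q' measurable_measure_subprob_algebra]) auto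
  have le1: "measure (Q (\<xi> k w)) B \<le> 1" if "w \<in> space M" for w
    using prob_space_Q[OF xi_space[OF that]] by (simp add: prob_space.prob_le_1)
  have int2: "integrable M (\<lambda>w. indicator A w * measure (Q (\<xi> k w)) B)"
    using le1 by (intro integrable_const_bound[where B = 1])
      (auto simp: indicator_def intro!: measurable_compose[OF _ mQ])
  have "(\<integral>w. indicator A w * indicator B (\<xi> (k + 1) w) \<partial>M)
      = (\<integral>w. indicator A w * real_cond_exp M (past k) (\<lambda>w. indicator B (\<xi> (k + 1) w)) w \<partial>M)"
    by (rule real_cond_exp_intg(2)[symmetric]) (use int Am in auto)
  also have "\<dots> = (\<integral>w. indicator A w * measure (Q (\<xi> k w)) B \<partial>M)"
  proof (rule integral_cong_AE)
    show "AE w in M. indicator A w * real_cond_exp M (past k) (\<lambda>w. indicator B (\<xi> (k + 1) w)) w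
        = indicator A w * measure (Q (\<xi> k w)) B"
      using AE_Q by (rule AE_mp) auto
  qed (auto intro!: measurable_compose[OF _ mQ])
  finally have eq: "(\<integral>w. indicator A w * indicator B (\<xi> (k + 1) w) \<partial>M) = (\<integral>w. indicator A w * measure (Q (\<xi> k w)) B \<partial>M)" .
  have "(\<integral>\<^sup>+w. indicator A w * indicator B (\<xi> (k + 1) w) \<partial>M) = (\<integral>\<^sup>+w. ennreal (indicator A w * indicator B (\<xi> (k + 1) w)) \<partial>M)"
    by (intro nn_integral_cong) (auto simp: indicator_def)
  also have "\<dots> = ennreal (\<integral>w. indicator A w * indicator B (\<xi> (k + 1) w) \<partial>M)"
    by (rule nn_integral_eq_integral[OF int]) auto
  also have "\<dots> = (\<integral>\<^sup>+w. ennreal (indicator A w * measure (Q (\<xi> k w)) B) \<partial>M)"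
    unfolding eq by (rule nn_integral_eq_integral[OF int2, symmetric]) auto
  also have "\<dots> = (\<integral>\<^sup>+w. indicator A w * emeasure (Q (\<xi> k w)) B \<partial>M)"
  proof (intro nn_integral_cong)
    fix w assume "w \<in> space M"
    then interpret Q: prob_space "Q (\<xi> k w)" by (intro prob_space_Q xi_space)
    show "ennreal (indicator A w * measure (Q (\<xi> k w)) B) = indicator A w * emeasure (Q (\<xi> k w)) B"
      by (auto simp: indicator_def Q.emeasure_eq_measure)
  qed
  finally show ?thesis .
qed

lemma markov_indicator_fun:
  assumes A: "A \<in> sets (past k)" and g: "g \<in> borel_measurable S"
  shows "(\<integral>\<^sup>+w. indicator A w * g (\<xi> (k + 1) w) \<partial>M) = (\<integral>\<^sup>+w. indicator A w * Q_nn g (\<xi> k w) \<partial>M)"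
proof -
  have Am [measurable]: "A \<in> sets M" using A subalgebra_past by (auto simp: subalgebra_def)
  show ?thesis using g
  proof (induction g rule: borel_measurable_induct)
    case (cong f g)
    have "Q_nn f (\<xi> k w) = Q_nn g (\<xi> k w)" if "w \<in> space M" for w
      using cong(3) sets_eq_imp_space_eq[OF sets_Q[OF xi_space[OF that]]]
      by (intro nn_integral_cong) auto
    with cong show ?case by (simp add: xi_space cong: nn_integral_cong)
  next
    case (set B)
    have "(\<integral>\<^sup>+w. indicator A w * Q_nn (indicator B) (\<xi> k w) \<partial>M) = (\<integral>\<^sup>+w. indicator A w * emeasure (Q (\<xi> k w)) B \<partial>M)"
      using set by (intro nn_integral_cong) (simp add: sets_Q xi_space)
    then show ?case using markov_indicator[OF A set] by simp
  next
    case (mult u c)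
    note [measurable] = mult(2)
    have "(\<integral>\<^sup>+w. indicator A w * (c * u (\<xi> (k + 1) w)) \<partial>M) = c * (\<integral>\<^sup>+w. indicator A w * u (\<xi> (k + 1) w) \<partial>M)"
      by (subst nn_integral_cmult[symmetric]) (auto simp: ac_simps)
    also have "\<dots> = (\<integral>\<^sup>+w. indicator A w * (c * Q_nn u (\<xi> k w)) \<partial>M)"
      unfolding mult(4) by (subst nn_integral_cmult[symmetric]) (auto simp: ac_simps)
    also have "\<dots> = (\<integral>\<^sup>+w. indicator A w * (Q_nn (\<lambda>x. c * u x) (\<xi> k w)) \<partial>M)"
      using mult(2) by (intro nn_integral_cong)
        (subst nn_integral_cmult, auto simp: sets_Q xi_space cong: measurable_cong_sets)
    finally show ?case .
  next
    case (add u v)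
    note [measurable] = add(1) add(3)
    have "(\<integral>\<^sup>+w. indicator A w * (v (\<xi> (k + 1) w) + u (\<xi> (k + 1) w)) \<partial>M) =
        (\<integral>\<^sup>+w. indicator A w * v (\<xi> (k + 1) w) \<partial>M) + (\<integral>\<^sup>+w. indicator A w * u (\<xi> (k + 1) w) \<partial>M)"
      by (subst nn_integral_add[symmetric]) (auto simp: distrib_left)
    also have "\<dots> = (\<integral>\<^sup>+w. indicator A w * (Q_nn v (\<xi> k w) + Q_nn u (\<xi> k w)) \<partial>M)"
      unfolding add.IH by (subst nn_integral_add[symmetric]) (auto simp: distrib_left)
    also have "\<dots> = (\<integral>\<^sup>+w. indicator A w * Q_nn (\<lambda>x. v x + u x) (\<xi> k w) \<partial>M)"
      using add(1,3) by (intro nn_integral_cong)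
        (subst nn_integral_add, auto simp: sets_Q xi_space cong: measurable_cong_sets)
    finally show ?case .
  next
    case (seq U)
    note [measurable] = seq(1)
    have "(\<integral>\<^sup>+w. indicator A w * (SUP i. U i) (\<xi> (k + 1) w) \<partial>M) = (\<integral>\<^sup>+w. (SUP i. indicator A w * U i (\<xi> (k + 1) w)) \<partial>M)"
      by (simp add: SUP_apply image_comp SUP_mult_left_ennreal)
    also have "\<dots> = (SUP i. (\<integral>\<^sup>+w. indicator A w * U i (\<xi> (k + 1) w) \<partial>M))"
      using \<open>incseq U\<close> by (intro nn_integral_monotone_convergence_SUP)
        (auto simp: incseq_def le_fun_def intro!: mult_left_mono)
    also have "\<dots> = (SUP i. (\<integral>\<^sup>+w. indicator A w * Q_nn (U i) (\<xi> k w) \<partial>M))"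
      by (simp add: seq)
    also have "\<dots> = (\<integral>\<^sup>+w. (SUP i. indicator A w * Q_nn (U i) (\<xi> k w)) \<partial>M)"
      using \<open>incseq U\<close> by (intro nn_integral_monotone_convergence_SUP[symmetric])
        (auto simp: incseq_def le_fun_def intro!: mult_left_mono nn_integral_mono)
    also have "\<dots> = (\<integral>\<^sup>+w. indicator A w * Q_nn (SUP i. U i) (\<xi> k w) \<partial>M)"
    proof (intro nn_integral_cong)
      fix w assume w: "w \<in> space M"
      have "Q_nn (SUP i. U i) (\<xi> k w) = (SUP i. Q_nn (U i) (\<xi> k w))"
        unfolding SUP_apply using seq(1) \<open>incseq U\<close> w
        by (subst nn_integral_monotone_convergence_SUP[symmetric])
           (auto simp: image_comp sets_Q xi_space cong: measurable_cong_sets)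
      then show "(SUP i. indicator A w * Q_nn (U i) (\<xi> k w)) = indicator A w * Q_nn (SUP i. U i) (\<xi> k w)"
        by (simp add: SUP_mult_left_ennreal)
    qed
    finally show ?case .
  qed
qed

lemma markov_nn:
  assumes \<Psi>: "\<Psi> \<in> borel_measurable (past k)" and g: "g \<in> borel_measurable S"
  shows "(\<integral>\<^sup>+w. \<Psi> w * g (\<xi> (k + 1) w) \<partial>M) = (\<integral>\<^sup>+w. \<Psi> w * Q_nn g (\<xi> k w) \<partial>M)"
  using \<Psi>
proof (induction \<Psi> rule: borel_measurable_induct)
  case (cong f g)
  then show ?case by (simp cong: nn_integral_cong)
next
  case (set A)
  then show ?case using markov_indicator_fun[OF _ g] by simp
next
  case (mult u c)
  note [measurable] = measurable_from_past[OF mult(2)] g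
  show ?case using mult(4) by (simp add: mult.assoc nn_integral_cmult)
next
  case (add u v)
  note [measurable] = measurable_from_past[OF add(1)] measurable_from_past[OF add(3)] g
  show ?case using add.IH by (simp add: distrib_right nn_integral_add)
next
  case (seq U)
  note [measurable] = measurable_from_past[OF seq(1)] g
  have *: "(\<integral>\<^sup>+w. (SUP i. U i) w * z w \<partial>M) = (SUP i. (\<integral>\<^sup>+w. U i w * z w \<partial>M))"
    if [measurable]: "z \<in> borel_measurable M" for z
  proof -
    have "(\<integral>\<^sup>+w. (SUP i. U i) w * z w \<partial>M) = (\<integral>\<^sup>+w. (SUP i. U i w * z w) \<partial>M)"
      by (simp add: SUP_apply image_comp SUP_mult_right_ennreal)
    also have "\<dots> = (SUP i. (\<integral>\<^sup>+w. U i w * z w \<partial>M))"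
      using \<open>incseq U\<close> by (intro nn_integral_monotone_convergence_SUP)
        (auto simp: incseq_def le_fun_def intro!: mult_right_mono)
    finally show ?thesis .
  qed
  show ?case by (subst *, measurable, subst *, measurable, simp add: seq)
qed

lemma nn_integral_xi: "g \<in> borel_measurable S \<Longrightarrow> (\<integral>\<^sup>+w. g (\<xi> k w) \<partial>M) = (\<integral>\<^sup>+w. g (\<xi> l w) \<partial>M)"
  using nn_integral_distr[OF measurable_xi, of g k] nn_integral_distr[OF measurable_xi, of g l]
  by (simp add: distr_xi sets_pi cong: measurable_cong_sets)

text \<open>\<^term>\<open>cyl\<close> encodes the finite-dimensional laws of the chain: integrating out the last coordinate with
  the Markov property (\<open>cyl_Suc\<close>) and the first one with reversibility (\<open>cyl_front\<close>) are the two moves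
  that yield invariance under shifts and under time reversal.\<close>

definition cyl :: "int \<Rightarrow> nat \<Rightarrow> (nat \<Rightarrow> 's \<Rightarrow> ennreal) \<Rightarrow> ennreal" where
  "cyl k l h = (\<integral>\<^sup>+w. (\<Prod>i\<le>l. h i (\<xi> (k + int i) w)) \<partial>M)"

lemma cyl_cong: "(\<And>i. i \<le> l \<Longrightarrow> h i = h' i) \<Longrightarrow> cyl k l h = cyl k l h'"
  unfolding cyl_def by (intro nn_integral_cong prod.cong) auto

lemma cyl_Suc:
  assumes [measurable]: "\<And>i. h i \<in> borel_measurable S"
  shows "cyl k (Suc l) h = cyl k l (h(l := (\<lambda>x. h l x * Q_nn (h (Suc l)) x)))"
proof -
  have [measurable]: "(\<lambda>w. \<Prod>i\<le>l. h i (\<xi> (k + int i) w)) \<in> borel_measurable (past (k + int l))"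
    by (intro borel_measurable_prod_ennreal measurable_compose[OF measurable_past_xi]) auto
  have "cyl k (Suc l) h = (\<integral>\<^sup>+w. (\<Prod>i\<le>l. h i (\<xi> (k + int i) w)) * h (Suc l) (\<xi> (k + int l + 1) w) \<partial>M)"
    unfolding cyl_def by (simp add: algebra_simps)
  also have "\<dots> = (\<integral>\<^sup>+w. (\<Prod>i\<le>l. h i (\<xi> (k + int i) w)) * Q_nn (h (Suc l)) (\<xi> (k + int l) w) \<partial>M)"
    by (rule markov_nn) auto
  also have "\<dots> = cyl k l (h(l := (\<lambda>x. h l x * Q_nn (h (Suc l)) x)))"
    unfolding cyl_def lessThan_Suc_atMost[symmetric] by (simp add: mult.assoc)
  finally show ?thesis .
qed

lemma cyl_shift:
  assumes "\<And>i. h i \<in> borel_measurable S"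
  shows "cyl k l h = cyl k' l h"
  using assms
proof (induction l arbitrary: h)
  case 0
  then show ?case using nn_integral_xi[of "h 0" k k'] by (simp add: cyl_def)
next
  case (Suc l)
  note [measurable] = Suc.prems
  show ?case by (subst (1 2) cyl_Suc) (auto intro!: Suc.IH)
qed

lemma reversible_pair:
  assumes [measurable]: "g \<in> borel_measurable S" "h \<in> borel_measurable S"
  shows "(\<integral>\<^sup>+w. g (\<xi> 0 w) * h (\<xi> 1 w) \<partial>M) = (\<integral>\<^sup>+w. g (\<xi> 1 w) * h (\<xi> 0 w) \<partial>M)"
proof -
  have "(\<integral>\<^sup>+w. g (\<xi> 0 w) * h (\<xi> 1 w) \<partial>M) =
      (\<integral>\<^sup>+x. g (fst x) * h (snd x) \<partial>distr M (S \<Otimes>\<^sub>M S) (\<lambda>w. (\<xi> 0 w, \<xi> 1 w)))"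
    by (subst nn_integral_distr) auto
  also have "\<dots> = (\<integral>\<^sup>+x. g (fst x) * h (snd x) \<partial>distr M (S \<Otimes>\<^sub>M S) (\<lambda>w. (\<xi> 1 w, \<xi> 0 w)))"
    using rev by (simp add: reversible_chain_def)
  also have "\<dots> = (\<integral>\<^sup>+w. g (\<xi> 1 w) * h (\<xi> 0 w) \<partial>M)"
    by (subst nn_integral_distr) auto
  finally show ?thesis .
qed

text \<open>The base case is reversibility of the pair at times 0 and 1 followed by one Markov step,
  which puts \<open>Q_nn g\<close> on the remaining coordinate. For longer cylinders the last
  coordinate is integrated out on both sides; the factors coming from the front and from the back
  commute even when they meet on one coordinate.\<close>

lemma cyl_front:
  assumes [measurable]: "g \<in> borel_measurable S" and h: "\<And>i. h i \<in> borel_measurable S"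
  shows "cyl k (Suc l) (case_nat g h) = cyl (k + 1) l (h(0 := (\<lambda>x. Q_nn g x * h 0 x)))"
  using h
proof (induction l arbitrary: h)
  case 0
  note [measurable] = 0
  have "cyl k (Suc 0) (case_nat g h) = cyl 0 (Suc 0) (case_nat g h)"
    by (rule cyl_shift) (auto split: nat.split)
  also have "\<dots> = (\<integral>\<^sup>+w. g (\<xi> 0 w) * h 0 (\<xi> 1 w) \<partial>M)"
    by (simp add: cyl_def)
  also have "\<dots> = (\<integral>\<^sup>+w. h 0 (\<xi> 0 w) * g (\<xi> (0 + 1) w) \<partial>M)"
    by (subst reversible_pair) (auto simp: ac_simps)
  also have "\<dots> = (\<integral>\<^sup>+w. h 0 (\<xi> 0 w) * Q_nn g (\<xi> 0 w) \<partial>M)"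
    by (rule markov_nn) (auto intro: measurable_compose[OF measurable_past_xi])
  also have "\<dots> = cyl 0 0 (h(0 := (\<lambda>x. Q_nn g x * h 0 x)))"
    by (simp add: cyl_def ac_simps)
  also have "\<dots> = cyl (k + 1) 0 (h(0 := (\<lambda>x. Q_nn g x * h 0 x)))"
    by (rule cyl_shift) auto
  finally show ?case .
next
  case (Suc l)
  note [measurable] = Suc.prems
  let ?h = "h(l := (\<lambda>x. h l x * Q_nn (h (Suc l)) x))"
  have "cyl k (Suc (Suc l)) (case_nat g h) = cyl k (Suc l) (case_nat g ?h)"
    by (subst cyl_Suc) (auto split: nat.split intro!: cyl_cong)
  also have "\<dots> = cyl (k + 1) l (?h(0 := (\<lambda>x. Q_nn g x * ?h 0 x)))"
    by (rule Suc.IH) auto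
  also have "\<dots> = cyl (k + 1) (Suc l) (h(0 := (\<lambda>x. Q_nn g x * h 0 x)))"
    by (subst cyl_Suc[of _ "k + 1" l]) (auto intro!: cyl_cong simp: ac_simps)
  finally show ?case .
qed

text \<open>Fold the last factor onto its neighbour, reverse the shorter cylinder by induction and
  unfold the same factor at the front. The intermediate shift to \<open>k + 1\<close> makes room for
  the new first coordinate.\<close>

lemma cyl_reverse:
  assumes "\<And>i. h i \<in> borel_measurable S"
  shows "cyl k l h = cyl k l (\<lambda>i. h (l - i))"
  using assms
proof (induction l arbitrary: h)
  case 0
  then show ?case by (simp add: cyl_def)
next
  case (Suc l)
  note [measurable] = Suc.prems
  let ?h = "h(l := (\<lambda>x. h l x * Q_nn (h (Suc l)) x))"
  have "cyl k (Suc l) h = cyl k l ?h" by (rule cyl_Suc) auto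
  also have "\<dots> = cyl k l (\<lambda>i. ?h (l - i))" by (rule Suc.IH) auto
  also have "\<dots> = cyl (k + 1) l (\<lambda>i. ?h (l - i))" by (rule cyl_shift) auto
  also have "\<dots> = cyl (k + 1) l ((\<lambda>i. h (l - i))(0 := (\<lambda>x. Q_nn (h (Suc l)) x * h (l - 0) x)))"
    by (intro cyl_cong) (auto simp: ac_simps)
  also have "\<dots> = cyl k (Suc l) (case_nat (h (Suc l)) (\<lambda>i. h (l - i)))"
    by (rule cyl_front[symmetric]) auto
  also have "\<dots> = cyl k (Suc l) (\<lambda>i. h (Suc l - i))"
    by (intro cyl_cong) (auto split: nat.split)
  finally show ?case .
qed

section \<open>Invariance of the law of the two-sided trajectory\<close>

abbreviation traj :: "(int \<Rightarrow> 's) measure" where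
  "traj \<equiv> PiM UNIV (\<lambda>_. S)"

lemma measurable_traj_component [measurable]: "(\<lambda>x. x i) \<in> traj \<rightarrow>\<^sub>M S"
  by measurable

lemma measurable_path [measurable]: "(\<lambda>w i. \<xi> (\<tau> i) w) \<in> M \<rightarrow>\<^sub>M traj"
  by (rule measurable_PiM_single') (auto simp: xi_space)

text \<open>Inserting the constant 1 at the times outside \<open>J\<close> turns a cylinder over
  \<open>J\<close> into a product over a full window of \<open>2 * n + 1\<close> times, the shape
  handled by \<open>cyl\<close>. The time map \<open>\<tau>\<close> is left free so that shift and
  reversal are both covered.\<close>

lemma emeasure_path_cylinder:
  assumes J: "J \<subseteq> {- int n..int n}" and A: "\<And>i. i \<in> J \<Longrightarrow> A i \<in> sets S"
  defines "h i \<equiv> if int i - int n \<in> J then indicator (A (int i - int n)) else (\<lambda>_. 1)"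
  shows "emeasure (distr M traj (\<lambda>w i. \<xi> (\<tau> i) w)) (prod_emb UNIV (\<lambda>_. S) J (Pi\<^sub>E J A))
    = (\<integral>\<^sup>+w. (\<Prod>i\<le>2 * n. h i (\<xi> (\<tau> (int i - int n)) w)) \<partial>M)"
proof -
  have fin: "finite J" using J by (rule finite_subset) simp
  have eq: "(\<lambda>w i. \<xi> (\<tau> i) w) -` prod_emb UNIV (\<lambda>_. S) J (Pi\<^sub>E J A) \<inter> space M
      = {w\<in>space M. \<forall>j\<in>J. \<xi> (\<tau> j) w \<in> A j}"
    by (auto simp: prod_emb_def PiE_iff xi_space restrict_def extensional_def)
  have "emeasure (distr M traj (\<lambda>w i. \<xi> (\<tau> i) w)) (prod_emb UNIV (\<lambda>_. S) J (Pi\<^sub>E J A))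
      = emeasure M {w\<in>space M. \<forall>j\<in>J. \<xi> (\<tau> j) w \<in> A j}"
    using fin A by (subst emeasure_distr) (auto simp: eq intro!: sets_PiM_I)
  also have "\<dots> = (\<integral>\<^sup>+w. indicator {w\<in>space M. \<forall>j\<in>J. \<xi> (\<tau> j) w \<in> A j} w \<partial>M)"
    using fin A by (subst nn_integral_indicator) (auto intro!: sets.sets_Collect_finite_All)
  also have "\<dots> = (\<integral>\<^sup>+w. (\<Prod>i\<le>2 * n. h i (\<xi> (\<tau> (int i - int n)) w)) \<partial>M)"
  proof (intro nn_integral_cong)
    fix w assume w: "w \<in> space M"
    have "(\<Prod>i\<le>2 * n. h i (\<xi> (\<tau> (int i - int n)) w)) = 1" if "\<forall>j\<in>J. \<xi> (\<tau> j) w \<in> A j"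
      using that by (intro prod.neutral) (auto simp: h_def indicator_def)
    moreover have "(\<Prod>i\<le>2 * n. h i (\<xi> (\<tau> (int i - int n)) w)) = 0" if "j \<in> J" "\<xi> (\<tau> j) w \<notin> A j" for j
    proof (rule prod_zero)
      show "\<exists>a\<in>{..2 * n}. h a (\<xi> (\<tau> (int a - int n)) w) = 0"
      proof (intro bexI[of _ "nat (j + int n)"])
        have "- int n \<le> j" "j \<le> int n" using that J by auto
        then show "nat (j + int n) \<in> {..2 * n}" "h (nat (j + int n)) (\<xi> (\<tau> (int (nat (j + int n)) - int n)) w) = 0"
          using that by (auto simp: h_def indicator_def)
      qed
    qed simp
    ultimately show "indicator {w\<in>space M. \<forall>j\<in>J. \<xi> (\<tau> j) w \<in> A j} w = (\<Prod>i\<le>2 * n. h i (\<xi> (\<tau> (int i - int n)) w))"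
      using w by (auto simp: indicator_def)
  qed
  finally show ?thesis .
qed

text \<open>Cylinder sets determine a finite measure on trajectories. Windows symmetric about 0
  suffice, since every finite \<open>J\<close> lies in one, and time reversal maps them to
  themselves.\<close>

lemma distr_path_eqI:
  assumes "\<And>n h. (\<And>i. h i \<in> borel_measurable S) \<Longrightarrow>
      (\<integral>\<^sup>+w. (\<Prod>i\<le>2 * n. h i (\<xi> (\<tau> (int i - int n)) w)) \<partial>M) = cyl (- int n) (2 * n) h"
  shows "distr M traj (\<lambda>w i. \<xi> (\<tau> i) w) = distr M traj (\<lambda>w i. \<xi> i w)"
proof (rule measure_eqI_PiM_infinite)
  show "finite_measure (distr M traj (\<lambda>w i. \<xi> (\<tau> i) w))"
    by (rule finite_measure_distr) simp
  fix A and J :: "int set"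
  assume J: "finite J" and A: "\<And>i. i \<in> J \<Longrightarrow> A i \<in> sets S"
  define n where "n = nat (Max (insert 0 (abs ` J)))"
  have "\<bar>j\<bar> \<le> Max (insert 0 (abs ` J))" if "j \<in> J" for j
    using J that by (intro Max_ge) auto
  then have "J \<subseteq> {- int n..int n}" by (force simp: n_def)
  note c = emeasure_path_cylinder[OF this A]
  show "emeasure (distr M traj (\<lambda>w i. \<xi> (\<tau> i) w)) (prod_emb UNIV (\<lambda>_. S) J (Pi\<^sub>E J A)) =
      emeasure (distr M traj (\<lambda>w i. \<xi> i w)) (prod_emb UNIV (\<lambda>_. S) J (Pi\<^sub>E J A))"
    using A by (subst (1 2) c, simp, simp, subst assms) (auto simp: cyl_def)
qed simp_all

lemma distr_path_shift: "distr M traj (\<lambda>w i. \<xi> (i + k) w) = distr M traj (\<lambda>w i. \<xi> i w)"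
proof (rule distr_path_eqI)
  fix n and h :: "nat \<Rightarrow> 's \<Rightarrow> ennreal" assume h: "\<And>i. h i \<in> borel_measurable S"
  have "(\<integral>\<^sup>+w. (\<Prod>i\<le>2 * n. h i (\<xi> (int i - int n + k) w)) \<partial>M) = cyl (k - int n) (2 * n) h"
    unfolding cyl_def by (simp add: algebra_simps)
  also have "\<dots> = cyl (- int n) (2 * n) h" by (rule cyl_shift[OF h])
  finally show "(\<integral>\<^sup>+w. (\<Prod>i\<le>2 * n. h i (\<xi> (int i - int n + k) w)) \<partial>M) = cyl (- int n) (2 * n) h" .
qed

lemma distr_path_reverse: "distr M traj (\<lambda>w i. \<xi> (- i) w) = distr M traj (\<lambda>w i. \<xi> i w)"
proof (rule distr_path_eqI)
  fix n and h :: "nat \<Rightarrow> 's \<Rightarrow> ennreal" assume h: "\<And>i. h i \<in> borel_measurable S"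
  have "(\<integral>\<^sup>+w. (\<Prod>i\<le>2 * n. h i (\<xi> (- (int i - int n)) w)) \<partial>M) = cyl (- int n) (2 * n) (\<lambda>i. h (2 * n - i))"
    unfolding cyl_def
  proof (intro nn_integral_cong)
    fix w
    show "(\<Prod>i\<le>2 * n. h i (\<xi> (- (int i - int n)) w)) = (\<Prod>i\<le>2 * n. h (2 * n - i) (\<xi> (- int n + int i) w))"
      by (rule prod.reindex_bij_witness[where i = "\<lambda>i. 2 * n - i" and j = "\<lambda>i. 2 * n - i"])
        (auto simp: of_nat_diff algebra_simps)
  qed
  also have "\<dots> = cyl (- int n) (2 * n) h" by (rule cyl_reverse[OF h, symmetric])
  finally show "(\<integral>\<^sup>+w. (\<Prod>i\<le>2 * n. h i (\<xi> (- (int i - int n)) w)) \<partial>M) = cyl (- int n) (2 * n) h" .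
qed

lemma distr_path_reflect: "distr M traj (\<lambda>w i. \<xi> (k - i) w) = distr M traj (\<lambda>w i. \<xi> i w)"
proof -
  have [measurable]: "(\<lambda>x i. x (i - k)) \<in> traj \<rightarrow>\<^sub>M traj"
    by (rule measurable_PiM_single') (auto simp: space_PiM PiE_iff)
  have "distr M traj (\<lambda>w i. \<xi> (k - i) w) = distr (distr M traj (\<lambda>w i. \<xi> (- i) w)) traj (\<lambda>x i. x (i - k))"
    by (subst distr_distr) (auto simp: o_def)
  also have "\<dots> = distr M traj (\<lambda>w i. \<xi> (i + (-k)) w)"
    unfolding distr_path_reverse by (subst distr_distr) (auto simp: o_def)
  finally show ?thesis unfolding distr_path_shift .
qed

abbreviation path :: "'w \<Rightarrow> int \<Rightarrow> 's" where
  "path w \<equiv> (\<lambda>i. \<xi> i w)"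

lemma integral_shift:
  fixes \<Phi> :: "(int \<Rightarrow> 's) \<Rightarrow> real"
  assumes [measurable]: "\<Phi> \<in> borel_measurable traj"
  shows "(\<integral>w. \<Phi> (\<lambda>i. \<xi> (i + k) w) \<partial>M) = (\<integral>w. \<Phi> (path w) \<partial>M)"
  using integral_distr[of "\<lambda>w i. \<xi> (i + k) w" M traj \<Phi>] integral_distr[of "path" M traj \<Phi>]
  by (simp add: distr_path_shift measurable_path)

lemma integral_reflect:
  fixes \<Phi> :: "(int \<Rightarrow> 's) \<Rightarrow> real"
  assumes [measurable]: "\<Phi> \<in> borel_measurable traj"
  shows "(\<integral>w. \<Phi> (\<lambda>i. \<xi> (k - i) w) \<partial>M) = (\<integral>w. \<Phi> (path w) \<partial>M)"
  using integral_distr[of "\<lambda>w i. \<xi> (k - i) w" M traj \<Phi>] integral_distr[of "path" M traj \<Phi>]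
  by (simp add: distr_path_reflect measurable_path)

lemma prob_shift:
  assumes [measurable]: "Measurable.pred traj P"
  shows "prob {w\<in>space M. P (\<lambda>i. \<xi> (i + k) w)} = prob {w\<in>space M. P (path w)}"
proof -
  show ?thesis unfolding prob_eq_integral_of_bool by (rule integral_shift) measurable
qed

lemma prob_reflect:
  assumes [measurable]: "Measurable.pred traj P"
  shows "prob {w\<in>space M. P (\<lambda>i. \<xi> (k - i) w)} = prob {w\<in>space M. P (path w)}"
proof -
  show ?thesis unfolding prob_eq_integral_of_bool by (rule integral_reflect) measurable
qed

section \<open>The transition operator on square-integrable functions\<close>

lemma L2_xi: "L2 \<pi> g \<Longrightarrow> L2 M (\<lambda>w. g (\<xi> k w))"
  using integrable_distr[OF measurable_xi, of k "\<lambda>x. (g x)\<^sup>2"]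
  by (auto simp: L2_def distr_xi cong: measurable_cong_sets)

lemma L2_pi_measurable: "L2 \<pi> g \<Longrightarrow> g \<in> borel_measurable S"
  by (auto simp: L2_def cong: measurable_cong_sets)

lemma L2_piI:
  assumes [measurable]: "g \<in> borel_measurable S" and "L2 M (\<lambda>w. g (\<xi> 0 w))"
  shows "L2 \<pi> g"
  using assms integrable_distr_eq[OF measurable_xi, of "\<lambda>x. (g x)\<^sup>2" 0]
  by (auto simp: L2_def distr_xi measurable_cong_sets[OF sets_pi refl])

text \<open>A Bochner integral has the value 0 where \<open>g\<close> is not integrable for
  \<open>Q x\<close>. By \<open>AE_L2_Q\<close> the chain almost surely avoids such states when
  \<open>g\<close> is in \<open>L2 \<pi>\<close>, so linearity of \<open>Q_op\<close> is available
  almost surely rather than pointwise.\<close>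

definition Q_op :: "('s \<Rightarrow> real) \<Rightarrow> 's \<Rightarrow> real" where
  "Q_op g x = (\<integral>y. g y \<partial>Q x)"

lemma measurable_Q_op [measurable]: "g \<in> borel_measurable S \<Longrightarrow> Q_op g \<in> borel_measurable S"
  unfolding Q_op_def by (rule measurable_compose[OF measurable_Q' integral_measurable_subprob_algebra])

lemma AE_L2_Q:
  assumes g: "L2 \<pi> g"
  shows "AE w in M. L2 (Q (\<xi> k w)) g"
proof -
  note [measurable] = L2_pi_measurable[OF g]
  have "(\<integral>\<^sup>+w. 1 * Q_nn (\<lambda>x. ennreal ((g x)\<^sup>2)) (\<xi> k w) \<partial>M) = (\<integral>\<^sup>+w. 1 * ennreal ((g (\<xi> (k + 1) w))\<^sup>2) \<partial>M)"
    by (rule markov_nn[symmetric]) auto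
  also have "\<dots> = ennreal (\<integral>w. (g (\<xi> (k + 1) w))\<^sup>2 \<partial>M)"
    using L2_sq[OF L2_xi[OF g, of "k + 1"]] by (simp add: nn_integral_eq_integral)
  also have "\<dots> < \<infinity>" by simp
  finally have "AE w in M. Q_nn (\<lambda>x. ennreal ((g x)\<^sup>2)) (\<xi> k w) \<noteq> \<infinity>"
    by (intro nn_integral_PInf_AE) auto
  then show ?thesis
  proof (rule AE_mp, intro AE_I2 impI)
    fix w assume w: "w \<in> space M" and fin: "Q_nn (\<lambda>x. ennreal ((g x)\<^sup>2)) (\<xi> k w) \<noteq> \<infinity>"
    have gQ [measurable]: "g \<in> borel_measurable (Q (\<xi> k w))"
      using L2_pi_measurable[OF g] by (simp add: sets_Q[OF xi_space[OF w]] cong: measurable_cong_sets)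
    show "L2 (Q (\<xi> k w)) g"
      using fin by (auto simp: L2_def integrable_iff_bounded less_top)
  qed
qed

text \<open>Cauchy-Schwarz against 1 in each kernel gives (Qg)^2 \<le> Q(g^2), and by the Markov
  property the expectation of the right side at \<xi>_0 is the second moment of g(\<xi>_1).\<close>

lemma Q_op_L2:
  assumes g: "L2 \<pi> g"
  shows "L2 \<pi> (Q_op g)"
proof (rule L2_piI)
  note [measurable] = L2_pi_measurable[OF g]
  show "Q_op g \<in> borel_measurable S" by measurable
  have "(\<integral>\<^sup>+w. ennreal ((Q_op g (\<xi> 0 w))\<^sup>2) \<partial>M) \<le> (\<integral>\<^sup>+w. Q_nn (\<lambda>x. ennreal ((g x)\<^sup>2)) (\<xi> 0 w) \<partial>M)"
  proof (rule nn_integral_mono_AE, rule AE_mp[OF AE_L2_Q[OF g, of 0]], intro AE_I2 impI)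
    fix w assume w: "w \<in> space M" and L: "L2 (Q (\<xi> 0 w)) g"
    interpret Q: prob_space "Q (\<xi> 0 w)" by (rule prob_space_Q[OF xi_space[OF w]])
    have "L2 (Q (\<xi> 0 w)) (\<lambda>_. 1)" by (rule Q.L2_bounded) auto
    from L2_cauchy_schwarz[OF L this]
    have "\<bar>Q_op g (\<xi> 0 w)\<bar> \<le> L2norm (Q (\<xi> 0 w)) g"
      by (simp add: Q_op_def L2norm_def Q.prob_space)
    then have "(Q_op g (\<xi> 0 w))\<^sup>2 \<le> (L2norm (Q (\<xi> 0 w)) g)\<^sup>2"
      using power_mono[of "\<bar>Q_op g (\<xi> 0 w)\<bar>" _ 2] by simp
    then show "ennreal ((Q_op g (\<xi> 0 w))\<^sup>2) \<le> Q_nn (\<lambda>x. ennreal ((g x)\<^sup>2)) (\<xi> 0 w)"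
      using L2_sq[OF L] by (simp add: nn_integral_eq_integral L2norm_sq)
  qed
  also have "\<dots> = (\<integral>\<^sup>+w. 1 * Q_nn (\<lambda>x. ennreal ((g x)\<^sup>2)) (\<xi> 0 w) \<partial>M)" by simp
  also have "\<dots> = (\<integral>\<^sup>+w. 1 * ennreal ((g (\<xi> (0 + 1) w))\<^sup>2) \<partial>M)"
    by (rule markov_nn[symmetric]) auto
  also have "\<dots> = ennreal (\<integral>w. (g (\<xi> (0 + 1) w))\<^sup>2 \<partial>M)"
    using L2_sq[OF L2_xi[OF g, of "0 + 1"]] by (simp add: nn_integral_eq_integral)
  also have "\<dots> < \<infinity>" by simp
  finally show "L2 M (\<lambda>w. Q_op g (\<xi> 0 w))"
    by (auto simp: L2_def integrable_iff_bounded)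
qed

lemma markov_real_nonneg:
  assumes g: "L2 \<pi> g" and nn: "\<And>x. 0 \<le> g x" and A: "A \<in> sets (past k)"
  shows "(\<integral>w. indicator A w * g (\<xi> (k + 1) w) \<partial>M) = (\<integral>w. indicator A w * Q_op g (\<xi> k w) \<partial>M)"
proof -
  note [measurable] = L2_pi_measurable[OF g]
  have [measurable]: "A \<in> sets M" using A subalgebra_past by (auto simp: subalgebra_def)
  have nn': "0 \<le> Q_op g x" for x unfolding Q_op_def by (simp add: nn)
  have "(\<integral>\<^sup>+w. ennreal (indicator A w * g (\<xi> (k + 1) w)) \<partial>M) =
      (\<integral>\<^sup>+w. indicator A w * ennreal (g (\<xi> (k + 1) w)) \<partial>M)"
    by (intro nn_integral_cong) (auto simp: indicator_def)
  also have "\<dots> = (\<integral>\<^sup>+w. indicator A w * Q_nn g (\<xi> k w) \<partial>M)"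
    using A by (intro markov_nn) auto
  also have "\<dots> = (\<integral>\<^sup>+w. ennreal (indicator A w * Q_op g (\<xi> k w)) \<partial>M)"
  proof (rule nn_integral_cong_AE, rule AE_mp[OF AE_L2_Q[OF g, of k]], intro AE_I2 impI)
    fix w assume w: "w \<in> space M" and L: "L2 (Q (\<xi> k w)) g"
    interpret Q: prob_space "Q (\<xi> k w)" by (rule prob_space_Q[OF xi_space[OF w]])
    show "indicator A w * Q_nn g (\<xi> k w) = ennreal (indicator A w * Q_op g (\<xi> k w))"
      using Q.L2_integrable[OF L] nn by (auto simp: nn_integral_eq_integral Q_op_def indicator_def)
  qed
  finally show ?thesis
    using nn nn' by (simp add: integral_eq_nn_integral)
qed

lemma markov_real_indicator:
  assumes g: "L2 \<pi> g" and A: "A \<in> sets (past k)"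
  shows "(\<integral>w. indicator A w * g (\<xi> (k + 1) w) \<partial>M) = (\<integral>w. indicator A w * Q_op g (\<xi> k w) \<partial>M)"
proof -
  note [measurable] = L2_pi_measurable[OF g]
  have [measurable]: "A \<in> sets M" using A subalgebra_past by (auto simp: subalgebra_def)
  have IA: "L2 M (indicator A)" by (rule L2_bounded[where B = 1]) (auto simp: indicator_def)
  \<comment> \<open>Positive and negative parts are again square-integrable, so both integrals are
    finite when the identities for nonnegative functions are subtracted.\<close>
  define p n where "p x = max 0 (g x)" and "n x = max 0 (- g x)" for x
  have gpn: "g x = p x - n x" for x by (simp add: p_def n_def max_def)
  have p_alt: "p x = (g x + \<bar>g x\<bar>) / 2" and n_alt: "n x = (\<bar>g x\<bar> - g x) / 2" for x
    by (auto simp: p_def n_def)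
  have p: "L2 \<pi> p" and n: "L2 \<pi> n"
    unfolding p_alt[abs_def] n_alt[abs_def] by (intro L2_intros g)+
  note pn [measurable] = L2_pi_measurable[OF p] L2_pi_measurable[OF n]
  have "(\<integral>w. indicator A w * g (\<xi> (k + 1) w) \<partial>M)
      = (\<integral>w. indicator A w * p (\<xi> (k + 1) w) \<partial>M) - (\<integral>w. indicator A w * n (\<xi> (k + 1) w) \<partial>M)"
    using L2_mult_integrable[OF IA L2_xi[OF p]] L2_mult_integrable[OF IA L2_xi[OF n]]
    by (subst Bochner_Integration.integral_diff[symmetric]) (auto simp: gpn algebra_simps)
  also have "\<dots> = (\<integral>w. indicator A w * Q_op p (\<xi> k w) \<partial>M) - (\<integral>w. indicator A w * Q_op n (\<xi> k w) \<partial>M)"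
    using markov_real_nonneg[OF p _ A] markov_real_nonneg[OF n _ A] by (simp add: p_def n_def)
  also have "\<dots> = (\<integral>w. indicator A w * Q_op p (\<xi> k w) - indicator A w * Q_op n (\<xi> k w) \<partial>M)"
    using L2_mult_integrable[OF IA L2_xi[OF Q_op_L2[OF p]]] L2_mult_integrable[OF IA L2_xi[OF Q_op_L2[OF n]]]
    by (subst Bochner_Integration.integral_diff[symmetric]) auto
  also have "\<dots> = (\<integral>w. indicator A w * Q_op g (\<xi> k w) \<partial>M)"
  proof (rule integral_cong_AE)
    show "AE w in M. indicator A w * Q_op p (\<xi> k w) - indicator A w * Q_op n (\<xi> k w) = indicator A w * Q_op g (\<xi> k w)"
      using AE_L2_Q[OF p, of k] AE_L2_Q[OF n, of k] AE_space
    proof eventually_elim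
      case (elim w)
      interpret Q: prob_space "Q (\<xi> k w)" by (rule prob_space_Q[OF xi_space[OF elim(3)]])
      have "Q_op g (\<xi> k w) = Q_op p (\<xi> k w) - Q_op n (\<xi> k w)"
        unfolding Q_op_def gpn using Q.L2_integrable[OF elim(1)] Q.L2_integrable[OF elim(2)] by simp
      then show ?case by (simp only: right_diff_distrib)
    qed
  qed measurable
  finally show ?thesis .
qed

text \<open>This is the weak form of E(g(\<xi>_{k+1}) | F_k) = Qg(\<xi>_k). Testing against
  square-integrable variables of the past avoids juggling versions of conditional expectations; the
  variance and martingale estimates use the Markov property in this form.\<close>

lemma markov_real:
  assumes g: "L2 \<pi> g" and \<Psi>: "\<Psi> \<in> borel_measurable (past k)" and L: "L2 M \<Psi>"
  shows "(\<integral>w. \<Psi> w * g (\<xi> (k + 1) w) \<partial>M) = (\<integral>w. \<Psi> w * Q_op g (\<xi> k w) \<partial>M)"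
proof -
  interpret sigma_finite_subalgebra M "past k" by (rule sigma_finite_past)
  note [measurable] = L2_pi_measurable[OF g] measurable_from_past[OF \<Psi>]
  have ce: "AE w in M. real_cond_exp M (past k) (\<lambda>w. g (\<xi> (k + 1) w)) w = Q_op g (\<xi> k w)"
  proof (rule real_cond_exp_charact)
    show "integrable M (\<lambda>w. g (\<xi> (k + 1) w))" by (rule L2_integrable[OF L2_xi[OF g]])
    show "integrable M (\<lambda>w. Q_op g (\<xi> k w))" by (rule L2_integrable[OF L2_xi[OF Q_op_L2[OF g]]])
    show "(\<lambda>w. Q_op g (\<xi> k w)) \<in> borel_measurable (past k)"
      by (rule measurable_compose[OF measurable_past_xi]) auto
  qed (use markov_real_indicator[OF g] in \<open>auto simp: set_lebesgue_integral_def\<close>)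
  have "(\<integral>w. \<Psi> w * g (\<xi> (k + 1) w) \<partial>M) = (\<integral>w. \<Psi> w * real_cond_exp M (past k) (\<lambda>w. g (\<xi> (k + 1) w)) w \<partial>M)"
    by (rule real_cond_exp_intg(2)[symmetric]) (use L2_mult_integrable[OF L L2_xi[OF g]] \<Psi> in auto)
  also have "\<dots> = (\<integral>w. \<Psi> w * Q_op g (\<xi> k w) \<partial>M)"
    using ce by (intro integral_cong_AE) (auto intro!: measurable_compose[OF _ measurable_from_past])
  finally show ?thesis .
qed

section \<open>Adapted variables and Doob's inequality\<close>

lemma measurable_past_comp:
  "i \<le> k \<Longrightarrow> g \<in> borel_measurable S \<Longrightarrow> (\<lambda>w. g (\<xi> i w)) \<in> borel_measurable (past k)"
  by (rule measurable_compose[OF measurable_past_xi])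

lemma measurable_past_mono:
  assumes "k \<le> l" "\<Psi> \<in> borel_measurable (past k)"
  shows "\<Psi> \<in> borel_measurable (past l)"
proof (rule measurable_from_subalg[OF _ assms(2)])
  have "sets (past k) \<subseteq> sets (past l)"
    unfolding past_sigma_def sets_measure_of[OF past_gen]
  proof (intro sigma_sets_mono' subsetI)
    fix B assume "B \<in> {\<xi> i -` A \<inter> space M | i A. i \<le> k \<and> A \<in> sets S}"
    then obtain i A where "B = \<xi> i -` A \<inter> space M" "i \<le> k" "A \<in> sets S" by auto
    moreover have "i \<le> l" using \<open>i \<le> k\<close> assms(1) by simp
    ultimately show "B \<in> {\<xi> i -` A \<inter> space M | i A. i \<le> l \<and> A \<in> sets S}" by auto
  qed
  then show "subalgebra (past l) (past k)" by (simp add: subalgebra_def)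
qed

text \<open>Doob's inequality bounds a times the probability p by the mean of |Y_n| on the event
  that the level is reached, which involves the whole path. Splitting that mean at |Y_n| = a / 2
  costs at most (a / 2) p, which is absorbed on the left, and what remains depends on Y_n
  alone.\<close>

lemma doob_maximal:
  fixes Y :: "nat \<Rightarrow> 'w \<Rightarrow> real"
  assumes ad: "\<And>k. Y k \<in> borel_measurable (past (int k))" and L: "\<And>k. L2 M (Y k)"
    and mart: "\<And>k \<Psi>. k \<le> n \<Longrightarrow> \<Psi> \<in> borel_measurable (past (int k)) \<Longrightarrow> L2 M \<Psi> \<Longrightarrow>
      (\<integral>w. \<Psi> w * Y n w \<partial>M) = (\<integral>w. \<Psi> w * Y k w \<partial>M)"
    and a: "a > 0"
  shows "a / 2 * prob {w\<in>space M. \<exists>k\<le>n. \<bar>Y k w\<bar> > a} \<le> (\<integral>w. \<bar>Y n w\<bar> * of_bool (\<bar>Y n w\<bar> > a / 2) \<partial>M)"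
proof -
  note [measurable] = L2_measurable[OF L]
  define T where "T k w \<longleftrightarrow> \<bar>Y k w\<bar> > a \<and> (\<forall>i<k. \<not> \<bar>Y i w\<bar> > a)" for k w
  have Tm [measurable]: "Measurable.pred M (T k)" for k unfolding T_def[abs_def] by measurable
  have TF: "(\<lambda>w. sgn (Y k w) * of_bool (T k w)) \<in> borel_measurable (past (int k))" for k
  proof -
    have [measurable]: "Y i \<in> borel_measurable (past (int k))" if "i \<le> k" for i
      by (rule measurable_past_mono[OF _ ad]) (use that in simp)
    have [measurable]: "Measurable.pred (past (int k)) (T k)"
      unfolding T_def[abs_def] by measurable
    show ?thesis by measurable
  qed
  have TL: "L2 M (\<lambda>w. sgn (Y k w) * of_bool (T k w))" for k
    by (rule L2_bounded[where B = 1]) (auto simp: sgn_real_def)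
  have OL: "L2 M (\<lambda>w. of_bool (P w))" if [measurable]: "Measurable.pred M P" for P
    by (rule L2_bounded[where B = 1]) auto
  note int = L2_mult_integrable[OF L2_abs[OF L] OL]
  have "a * prob {w\<in>space M. \<exists>k\<le>n. \<bar>Y k w\<bar> > a} = (\<integral>w. a * (\<Sum>k\<le>n. of_bool (T k w)) \<partial>M)"
    unfolding T_def sum_first_passage by (simp add: prob_eq_integral_of_bool)
  also have "\<dots> = (\<Sum>k\<le>n. \<integral>w. a * of_bool (T k w) \<partial>M)"
    unfolding sum_distrib_left by (intro Bochner_Integration.integral_sum integrable_mult_right L2_integrable OL Tm)
  also have "\<dots> \<le> (\<Sum>k\<le>n. \<integral>w. \<bar>Y n w\<bar> * of_bool (T k w) \<partial>M)"
  proof (rule sum_mono)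
    fix k assume "k \<in> {..n}"
    then have k: "k \<le> n" by simp
    have "(\<integral>w. a * of_bool (T k w) \<partial>M) \<le> (\<integral>w. \<bar>Y k w\<bar> * of_bool (T k w) \<partial>M)"
      using a by (intro integral_mono int Tm integrable_mult_right L2_integrable OL) (auto simp: T_def)
    \<comment> \<open>The sign of Y_k goes into the test variable, so the martingale property
      applies without a conditional Jensen inequality for |Y|.\<close>
    also have "\<dots> = (\<integral>w. (sgn (Y k w) * of_bool (T k w)) * Y k w \<partial>M)"
      by (intro Bochner_Integration.integral_cong) (auto simp: abs_sgn ac_simps)
    also have "\<dots> = (\<integral>w. (sgn (Y k w) * of_bool (T k w)) * Y n w \<partial>M)"
      by (rule mart[OF k TF TL, symmetric])
    also have "\<dots> \<le> (\<integral>w. \<bar>Y n w\<bar> * of_bool (T k w) \<partial>M)"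
      by (intro integral_mono int Tm L2_mult_integrable TL L) (auto simp: sgn_real_def)
    finally show "(\<integral>w. a * of_bool (T k w) \<partial>M) \<le> (\<integral>w. \<bar>Y n w\<bar> * of_bool (T k w) \<partial>M)" .
  qed
  also have "\<dots> = (\<integral>w. \<bar>Y n w\<bar> * (\<Sum>k\<le>n. of_bool (T k w)) \<partial>M)"
    unfolding sum_distrib_left by (intro Bochner_Integration.integral_sum[symmetric] int Tm)
  also have "\<dots> = (\<integral>w. \<bar>Y n w\<bar> * of_bool (\<exists>k\<le>n. \<bar>Y k w\<bar> > a) \<partial>M)"
    unfolding T_def sum_first_passage ..
  also have "\<dots> \<le> (\<integral>w. \<bar>Y n w\<bar> * of_bool (\<bar>Y n w\<bar> > a / 2) + a / 2 * of_bool (\<exists>k\<le>n. \<bar>Y k w\<bar> > a) \<partial>M)"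
  proof (rule integral_mono)
    show "integrable M (\<lambda>w. \<bar>Y n w\<bar> * of_bool (\<bar>Y n w\<bar> > a / 2) + a / 2 * of_bool (\<exists>k\<le>n. \<bar>Y k w\<bar> > a))"
      by (intro Bochner_Integration.integrable_add int integrable_mult_right L2_integrable OL) measurable
    show "integrable M (\<lambda>w. \<bar>Y n w\<bar> * of_bool (\<exists>k\<le>n. \<bar>Y k w\<bar> > a))"
      by (intro int) measurable
  qed (use a in auto)
  also have "\<dots> = (\<integral>w. \<bar>Y n w\<bar> * of_bool (\<bar>Y n w\<bar> > a / 2) \<partial>M) + a / 2 * prob {w\<in>space M. \<exists>k\<le>n. \<bar>Y k w\<bar> > a}"
  proof -
    have 1: "integrable M (\<lambda>w. \<bar>Y n w\<bar> * of_bool (\<bar>Y n w\<bar> > a / 2))"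
      by (intro int) measurable
    have 2: "integrable M (\<lambda>w. a / 2 * of_bool (\<exists>k\<le>n. \<bar>Y k w\<bar> > a))"
      by (intro integrable_mult_right L2_integrable OL) measurable
    show ?thesis
      unfolding Bochner_Integration.integral_add[OF 1 2] prob_eq_integral_of_bool by simp
  qed
  finally show ?thesis by simp
qed

end

section \<open>Correlations of the functional along the chain\<close>

locale reversible_markov_functional = reversible_markov M S \<xi> \<pi> Q
  for M :: "'w measure" and S :: "'s measure" and \<xi> :: "int \<Rightarrow> 'w \<Rightarrow> 's"
    and \<pi> :: "'s measure" and Q :: "'s \<Rightarrow> 's measure" +
  fixes f :: "'s \<Rightarrow> real"
  assumes f_L2_0: "L2_0 \<pi> f"
begin

definition \<phi> :: "nat \<Rightarrow> 's \<Rightarrow> real" where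
  "\<phi> i = (Q_op ^^ i) f"

lemma phi_0 [simp]: "\<phi> 0 = f"
  by (simp add: \<phi>_def)

lemma f_L2: "L2 \<pi> f"
  using f_L2_0 by (simp add: L2_0_def L2_def)

lemma phi_L2: "L2 \<pi> (\<phi> i)"
  unfolding \<phi>_def by (induction i) (simp_all add: f_L2 Q_op_L2)

lemma measurable_phi [measurable]: "\<phi> i \<in> borel_measurable S"
  by (rule L2_pi_measurable[OF phi_L2])

lemma measurable_f [measurable]: "f \<in> borel_measurable S"
  by (rule L2_pi_measurable[OF f_L2])

lemma phi_step:
  assumes \<Psi>: "\<Psi> \<in> borel_measurable (past k)" "L2 M \<Psi>"
  shows "(\<integral>w. \<Psi> w * \<phi> i (\<xi> (k + 1) w) \<partial>M) = (\<integral>w. \<Psi> w * \<phi> (Suc i) (\<xi> k w) \<partial>M)"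
  using markov_real[OF phi_L2[of i] \<Psi>] by (simp add: \<phi>_def)

lemma phi_lag:
  assumes \<Psi>: "\<Psi> \<in> borel_measurable (past k)" "L2 M \<Psi>"
  shows "(\<integral>w. \<Psi> w * \<phi> i (\<xi> (k + int n) w) \<partial>M) = (\<integral>w. \<Psi> w * \<phi> (i + n) (\<xi> k w) \<partial>M)"
proof (induction n arbitrary: i)
  case (Suc n)
  have "(\<integral>w. \<Psi> w * \<phi> i (\<xi> (k + int (Suc n)) w) \<partial>M) = (\<integral>w. \<Psi> w * \<phi> i (\<xi> (k + int n + 1) w) \<partial>M)"
    by (simp add: algebra_simps)
  also have "\<dots> = (\<integral>w. \<Psi> w * \<phi> (Suc i) (\<xi> (k + int n) w) \<partial>M)"
    by (rule phi_step) (use \<Psi> in \<open>auto intro: measurable_past_mono[of k]\<close>)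
  also have "\<dots> = (\<integral>w. \<Psi> w * \<phi> (i + Suc n) (\<xi> k w) \<partial>M)"
    using Suc.IH[of "Suc i"] by simp
  finally show ?case .
qed simp

definition cov :: "nat \<Rightarrow> real" where
  "cov n = (\<integral>w. f (\<xi> 0 w) * f (\<xi> (int n) w) \<partial>M)"

lemma measurable_traj_fun [measurable]: "g \<in> borel_measurable S \<Longrightarrow> (\<lambda>x. g (x i)) \<in> borel_measurable traj"
  by (rule measurable_compose[OF measurable_traj_component])

lemma integral_pair_shift:
  fixes g h :: "'s \<Rightarrow> real"
  assumes [measurable]: "g \<in> borel_measurable S" "h \<in> borel_measurable S"
  shows "(\<integral>w. g (\<xi> (a + k) w) * h (\<xi> (b + k) w) \<partial>M) = (\<integral>w. g (\<xi> a w) * h (\<xi> b w) \<partial>M)"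
proof (rule integral_shift[of "\<lambda>x. g (x a) * h (x b)" k])
  show "(\<lambda>x. g (x a) * h (x b)) \<in> borel_measurable traj"
    by (intro borel_measurable_times measurable_traj_fun assms)
qed

lemma integral_pair_reflect:
  fixes g h :: "'s \<Rightarrow> real"
  assumes [measurable]: "g \<in> borel_measurable S" "h \<in> borel_measurable S"
  shows "(\<integral>w. g (\<xi> (k - a) w) * h (\<xi> (k - b) w) \<partial>M) = (\<integral>w. g (\<xi> a w) * h (\<xi> b w) \<partial>M)"
proof (rule integral_reflect[of "\<lambda>x. g (x a) * h (x b)" k])
  show "(\<lambda>x. g (x a) * h (x b)) \<in> borel_measurable traj"
    by (intro borel_measurable_times measurable_traj_fun assms)
qed

lemma cov_shift: "(\<integral>w. f (\<xi> a w) * f (\<xi> b w) \<partial>M) = cov (nat \<bar>b - a\<bar>)"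
proof -
  have "(\<integral>w. f (\<xi> a w) * f (\<xi> b w) \<partial>M) = cov (nat (b - a))" if "a \<le> b" for a b
  proof -
    have "(\<integral>w. f (\<xi> (0 + a) w) * f (\<xi> ((b - a) + a) w) \<partial>M) = (\<integral>w. f (\<xi> 0 w) * f (\<xi> (b - a) w) \<partial>M)"
      by (rule integral_pair_shift) measurable
    then show ?thesis using that by (simp add: cov_def)
  qed
  note * = this
  show ?thesis
  proof (cases "a \<le> b")
    case True
    then show ?thesis by (simp add: *)
  next
    case False
    have "(\<integral>w. f (\<xi> a w) * f (\<xi> b w) \<partial>M) = (\<integral>w. f (\<xi> b w) * f (\<xi> a w) \<partial>M)"
      by (simp only: mult.commute)
    with False show ?thesis by (simp add: *)
  qed
qed

lemma integral_phi_lag: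
  "(\<integral>w. \<phi> i (\<xi> k w) * \<phi> j (\<xi> (k + int n) w) \<partial>M) = (\<integral>w. \<phi> i (\<xi> k w) * \<phi> (j + n) (\<xi> k w) \<partial>M)"
  by (rule phi_lag) (auto intro: measurable_past_comp L2_xi[OF phi_L2])

text \<open>Self-adjointness of Q in terms of the path: powers of Q on one factor are traded for a
  time lag, the two times are exchanged by reflecting the path, and the lag is traded back. Hence
  the inner product depends on \<open>i + j\<close> only.\<close>

lemma integral_phi_phi: "(\<integral>w. \<phi> i (\<xi> k w) * \<phi> j (\<xi> k w) \<partial>M) = cov (i + j)"
proof -
  have "(\<integral>w. \<phi> i (\<xi> k w) * \<phi> j (\<xi> k w) \<partial>M) = (\<integral>w. \<phi> i (\<xi> k w) * \<phi> 0 (\<xi> (k + int j) w) \<partial>M)"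
    using integral_phi_lag[of i k 0 j] by simp
  also have "\<dots> = (\<integral>w. \<phi> i (\<xi> (k + int j) w) * \<phi> 0 (\<xi> k w) \<partial>M)"
    using integral_pair_reflect[of "\<phi> i" "\<phi> 0" "k + (k + int j)" "k + int j" k] by simp
  also have "\<dots> = (\<integral>w. \<phi> 0 (\<xi> k w) * \<phi> i (\<xi> (k + int j) w) \<partial>M)"
    by (simp only: mult.commute)
  also have "\<dots> = (\<integral>w. \<phi> 0 (\<xi> k w) * \<phi> 0 (\<xi> (k + int (i + j)) w) \<partial>M)"
    using integral_phi_lag[of 0 k i j] integral_phi_lag[of 0 k 0 "i + j"] by simp
  also have "\<dots> = cov (nat \<bar>(k + int (i + j)) - k\<bar>)" unfolding phi_0 by (rule cov_shift)
  finally show ?thesis by (simp add: nat_int_add)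
qed

section \<open>Growth of the variance\<close>

text \<open>A function of the trajectory rather than of the sample point, so that shifted and
  reflected paths can be substituted. The block uses the times a + 1, ..., a + n, that is, the
  future seen from time a.\<close>

definition bsum :: "int \<Rightarrow> nat \<Rightarrow> (int \<Rightarrow> 's) \<Rightarrow> real" where
  "bsum a n x = (\<Sum>i=1..n. f (x (a + int i)))"

definition var :: "nat \<Rightarrow> real" where
  "var n = (\<integral>w. (bsum 0 n (path w))\<^sup>2 \<partial>M)"

text \<open>Along the chain \<open>Vf n (\<xi> k w)\<close> is a version of the conditional
  expectation of \<open>bsum k n (path w)\<close> given the past of time k; \<open>cond_bsum\<close>
  is the weak form of this.\<close>

definition Vf :: "nat \<Rightarrow> 's \<Rightarrow> real" where
  "Vf n x = (\<Sum>i=1..n. \<phi> i x)"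

definition Vf_sq :: "nat \<Rightarrow> real" where
  "Vf_sq n = (\<integral>w. (Vf n (\<xi> 0 w))\<^sup>2 \<partial>M)"

lemma measurable_bsum [measurable]: "bsum a n \<in> borel_measurable traj"
  unfolding bsum_def by (intro borel_measurable_sum measurable_traj_fun measurable_f)

lemma measurable_bsum_path [measurable]: "(\<lambda>w. bsum a n (path w)) \<in> borel_measurable M"
  by (rule measurable_compose[OF measurable_path measurable_bsum])

lemma bsum_past: "a + int n \<le> k \<Longrightarrow> (\<lambda>w. bsum a n (path w)) \<in> borel_measurable (past k)"
  unfolding bsum_def by (intro borel_measurable_sum measurable_past_comp measurable_f) auto

lemma bsum_shift: "bsum a n (\<lambda>i. x (i + k)) = bsum (a + k) n x"
  by (simp add: bsum_def algebra_simps)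

lemma bsum_shift_path: "bsum a n (\<lambda>i. \<xi> (i + k) w) = bsum (a + k) n (path w)"
  by (rule bsum_shift)

lemma bsum_add: "bsum a (m + n) x = bsum a m x + bsum (a + int m) n x"
proof -
  have "bsum a (m + n) x = (\<Sum>i=1..m. f (x (a + int i))) + (\<Sum>i=m + 1..m + n. f (x (a + int i)))"
    unfolding bsum_def by (subst sum.ub_add_nat) auto
  also have "(\<Sum>i=m + 1..m + n. f (x (a + int i))) = bsum (a + int m) n x"
    unfolding bsum_def using sum.shift_bounds_cl_nat_ivl[of "\<lambda>i. f (x (a + int i))" 1 m n]
    by (simp add: add.commute add.left_commute)
  finally show ?thesis by (simp add: bsum_def)
qed

lemma L2_f_xi: "L2 M (\<lambda>w. f (\<xi> k w))"
  by (rule L2_xi[OF f_L2])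

lemma L2_bsum: "L2 M (\<lambda>w. bsum a n (path w))"
  unfolding bsum_def by (intro L2_sum L2_f_xi)

lemma integral_f_sq: "(\<integral>w. (f (\<xi> k w))\<^sup>2 \<partial>M) = cov 0"
  using cov_shift[of k k] by (simp add: power2_eq_square)

lemma integral_bsum_sq: "(\<integral>w. (bsum a n (path w))\<^sup>2 \<partial>M) = var n"
proof -
  have "(\<integral>w. (bsum 0 n (\<lambda>i. \<xi> (i + a) w))\<^sup>2 \<partial>M) = var n"
    unfolding var_def by (rule integral_shift[of "\<lambda>x. (bsum 0 n x)\<^sup>2"]) measurable
  then show ?thesis by (simp add: bsum_shift_path)
qed

lemma measurable_Vf [measurable]: "Vf n \<in> borel_measurable S"
  unfolding Vf_def by (intro borel_measurable_sum measurable_phi)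

lemma Vf_L2: "L2 \<pi> (Vf n)"
  unfolding Vf_def by (intro L2_sum phi_L2)

lemma L2_Vf_xi: "L2 M (\<lambda>w. Vf n (\<xi> k w))"
  by (rule L2_xi[OF Vf_L2])

lemma integral_sq_xi:
  fixes g :: "'s \<Rightarrow> real"
  assumes [measurable]: "g \<in> borel_measurable S"
  shows "(\<integral>w. (g (\<xi> k w))\<^sup>2 \<partial>M) = (\<integral>w. (g (\<xi> 0 w))\<^sup>2 \<partial>M)"
  using integral_pair_shift[OF assms assms, of 0 k 0] by (simp add: power2_eq_square)

lemma integral_Vf_sq: "(\<integral>w. (Vf n (\<xi> k w))\<^sup>2 \<partial>M) = Vf_sq n"
  unfolding Vf_sq_def by (rule integral_sq_xi[OF measurable_Vf])

lemma cond_bsum: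
  assumes \<Psi>: "\<Psi> \<in> borel_measurable (past k)" "L2 M \<Psi>"
  shows "(\<integral>w. \<Psi> w * bsum k n (path w) \<partial>M) = (\<integral>w. \<Psi> w * Vf n (\<xi> k w) \<partial>M)"
proof -
  have "(\<integral>w. \<Psi> w * bsum k n (path w) \<partial>M) = (\<Sum>i=1..n. \<integral>w. \<Psi> w * f (\<xi> (k + int i) w) \<partial>M)"
    unfolding bsum_def sum_distrib_left
    by (intro Bochner_Integration.integral_sum L2_mult_integrable \<Psi> L2_f_xi)
  also have "\<dots> = (\<Sum>i=1..n. \<integral>w. \<Psi> w * \<phi> i (\<xi> k w) \<partial>M)"
    using phi_lag[OF \<Psi>, of 0] by simp
  also have "\<dots> = (\<integral>w. \<Psi> w * Vf n (\<xi> k w) \<partial>M)"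
    unfolding Vf_def sum_distrib_left
    by (intro Bochner_Integration.integral_sum[symmetric] L2_mult_integrable \<Psi> L2_xi phi_L2)
  finally show ?thesis .
qed

text \<open>Centre $S_{2n}$ at time $0$: the future half may be replaced by $V_n f(\xi_0)$, and by time reversal so may the
  past half, up to its two boundary terms.\<close>

lemma Vf_sq_le: "Vf_sq n \<le> 2 / 3 * (var (2 * n) - 2 * var n) + 16 / 3 * cov 0"
proof -
  define A B V Y R where "A w = bsum (- int n) n (path w)" and "B w = bsum 0 n (path w)"
    and "V w = Vf n (\<xi> 0 w)" and "Y w = f (\<xi> 0 w) - f (\<xi> (- int n) w)"
    and "R w = (\<Sum>i=1..n. f (\<xi> (0 - int i) w))" for w
  have A: "L2 M A" and B: "L2 M B" and V: "L2 M V" and Y: "L2 M Y" and R: "L2 M R"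
    unfolding A_def[abs_def] B_def[abs_def] V_def[abs_def] Y_def[abs_def] R_def[abs_def]
    by (intro L2_bsum L2_Vf_xi L2_diff L2_sum L2_f_xi)+
  have "var (2 * n) = (\<integral>w. (A w + B w)\<^sup>2 \<partial>M)"
    using integral_bsum_sq[of "- int n" "n + n"] by (simp add: A_def B_def bsum_add mult_2)
  also have "\<dots> = var n + 2 * (\<integral>w. A w * B w \<partial>M) + var n"
    using integral_add_sq[OF A B] by (simp add: A_def B_def integral_bsum_sq)
  finally have 1: "var (2 * n) - 2 * var n = 2 * (\<integral>w. A w * B w \<partial>M)" by simp
  have Apast: "A \<in> borel_measurable (past 0)"
    unfolding A_def[abs_def] by (rule bsum_past) simp
  have Vpast: "V \<in> borel_measurable (past 0)"
    unfolding V_def[abs_def] by (rule measurable_past_comp) (simp_all add: measurable_Vf)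
  have 2: "(\<integral>w. A w * B w \<partial>M) = (\<integral>w. A w * V w \<partial>M)"
    using cond_bsum[OF Apast A, of n] by (simp only: B_def V_def)
  \<comment> \<open>\<open>A\<close> uses the times -n + 1, ..., 0 and the reflected sum
    \<open>R\<close> the times -n, ..., -1; the difference is the pair of end terms in
    \<open>Y\<close>.\<close>
  have AYR: "A w = Y w + R w" for w
  proof -
    have "(\<Sum>i=0..n. f (\<xi> (- int n + int i) w)) = (\<Sum>i=0..n. f (\<xi> (0 - int i) w))"
      by (rule sum.reindex_bij_witness[where i = "\<lambda>i. n - i" and j = "\<lambda>i. n - i"]) (auto simp: of_nat_diff)
    then show ?thesis
      by (simp add: A_def Y_def R_def bsum_def sum.atLeast_Suc_atMost[of 0 n])
  qed
  have 3: "(\<integral>w. A w * V w \<partial>M) = (\<integral>w. Y w * V w \<partial>M) + (\<integral>w. R w * V w \<partial>M)"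
    using L2_mult_integrable[OF Y V] L2_mult_integrable[OF R V] by (simp add: AYR distrib_right)
  have "(\<integral>w. R w * V w \<partial>M) = (\<integral>w. bsum 0 n (\<lambda>i. \<xi> (0 - i) w) * Vf n (\<xi> (0 - 0) w) \<partial>M)"
    by (simp add: R_def V_def bsum_def)
  also have "\<dots> = (\<integral>w. bsum 0 n (path w) * Vf n (\<xi> 0 w) \<partial>M)"
    by (rule integral_reflect[of "\<lambda>x. bsum 0 n x * Vf n (x 0)"])
       (intro borel_measurable_times measurable_bsum measurable_traj_fun measurable_Vf)
  also have "\<dots> = (\<integral>w. V w * bsum 0 n (path w) \<partial>M)"
    by (simp only: mult.commute V_def)
  also have "\<dots> = (\<integral>w. V w * Vf n (\<xi> 0 w) \<partial>M)"
    by (rule cond_bsum[OF Vpast V])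
  also have "\<dots> = Vf_sq n" by (simp add: V_def Vf_sq_def power2_eq_square)
  finally have 4: "(\<integral>w. R w * V w \<partial>M) = Vf_sq n" .
  have Y4: "(\<integral>w. (Y w)\<^sup>2 \<partial>M) \<le> 4 * cov 0"
    unfolding Y_def using integral_diff_sq_le[OF L2_f_xi L2_f_xi, of 0 "- int n"] by (simp add: integral_f_sq)
  \<comment> \<open>The weight 1 / 2 bounds the mixed term from below at the cost of a quarter of
    \<open>Vf_sq n\<close>. Three quarters remain and the covariance of the halves is counted twice,
    which gives the constants 2 / 3 and 16 / 3.\<close>
  have "0 \<le> (\<integral>w. (Y w + V w / 2)\<^sup>2 \<partial>M)" by simp
  also have "\<dots> = (\<integral>w. (Y w)\<^sup>2 \<partial>M) + (\<integral>w. Y w * V w \<partial>M) + Vf_sq n / 4"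
    using integral_add_sq[OF Y L2_divide[OF V, of 2]] by (simp add: V_def Vf_sq_def power_divide)
  finally have 5: "0 \<le> (\<integral>w. (Y w)\<^sup>2 \<partial>M) + (\<integral>w. Y w * V w \<partial>M) + Vf_sq n / 4" .
  have lin: "0 \<le> y + e + w / 4 \<Longrightarrow> y \<le> 4 * c \<Longrightarrow> d = 2 * (e + w) \<Longrightarrow> w \<le> 2 / 3 * d + 16 / 3 * c" for y e w c d :: real
    by (simp add: field_simps)
  show ?thesis by (rule lin[OF 5 Y4]) (simp only: 1 2 3 4)
qed

text \<open>\<open>A + V\<close> is the conditional expectation of S_n given time m, an orthogonal
  projection, so its second moment is at most \<open>var n\<close>; S_m is recovered from it by
  subtracting \<open>V\<close>.\<close>

lemma var_le:
  assumes "m \<le> n"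
  shows "var m \<le> 2 * var n + 2 * Vf_sq (n - m)"
proof -
  define A B V where "A w = bsum 0 m (path w)" and "B w = bsum (int m) (n - m) (path w)"
    and "V w = Vf (n - m) (\<xi> (int m) w)" for w
  have A: "L2 M A" and B: "L2 M B" and V: "L2 M V"
    unfolding A_def[abs_def] B_def[abs_def] V_def[abs_def] by (intro L2_bsum L2_Vf_xi)+
  have Apast: "A \<in> borel_measurable (past (int m))"
    unfolding A_def[abs_def] by (rule bsum_past) simp
  have Vpast: "V \<in> borel_measurable (past (int m))"
    unfolding V_def[abs_def] by (rule measurable_past_comp) (simp_all add: measurable_Vf)
  let ?C = "\<lambda>w. A w + V w"
  have "var n = (\<integral>w. (?C w + (B w - V w))\<^sup>2 \<partial>M)"
    using assms bsum_add[of 0 m "n - m"] by (simp add: A_def B_def var_def)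
  also have "\<dots> = (\<integral>w. (?C w)\<^sup>2 \<partial>M) + 2 * (\<integral>w. ?C w * (B w - V w) \<partial>M) + (\<integral>w. (B w - V w)\<^sup>2 \<partial>M)"
    by (rule integral_add_sq) (intro L2_intros A B V)+
  also have "(\<integral>w. ?C w * (B w - V w) \<partial>M) = (\<integral>w. ?C w * B w \<partial>M) - (\<integral>w. ?C w * V w \<partial>M)"
    using L2_mult_integrable[OF L2_add[OF A V] B] L2_mult_integrable[OF L2_add[OF A V] V]
    by (simp add: right_diff_distrib)
  also have "(\<integral>w. ?C w * B w \<partial>M) = (\<integral>w. ?C w * V w \<partial>M)"
    using cond_bsum[OF borel_measurable_add[OF Apast Vpast] L2_add[OF A V], of "n - m"]
    by (simp only: B_def V_def)
  finally have "(\<integral>w. (?C w)\<^sup>2 \<partial>M) \<le> var n" by simp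
  moreover have "var m \<le> 2 * (\<integral>w. (?C w)\<^sup>2 \<partial>M) + 2 * Vf_sq (n - m)"
    using integral_diff_sq_le[OF L2_add[OF A V] V] by (simp add: var_def A_def V_def integral_Vf_sq)
  ultimately show ?thesis by simp
qed

lemma var_nonneg: "0 \<le> var n" by (simp add: var_def)
lemma Vf_sq_nonneg: "0 \<le> Vf_sq n" by (simp add: Vf_sq_def)

text \<open>The maximum over $j \le n$ is controlled without regular variation of $\sigma$ along all integers: by
  \<open>var_le\<close> the running maximum of the variances is at most $2\,\mathrm{var}\,n$ plus half of itself plus a constant.\<close>

lemma Vf_sq_small:
  assumes ratio: "(\<lambda>n. var (2 * n) / var n) \<longlonglongrightarrow> 2" and inf: "filterlim var at_top sequentially"
    and "\<epsilon> > 0"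
  shows "\<exists>C. \<forall>n. \<forall>j\<le>n. Vf_sq j \<le> \<epsilon> * var n + C"
proof -
  have *: "\<exists>C\<ge>0. \<forall>n. Vf_sq n \<le> \<epsilon> * var n + C" if "\<epsilon> > 0" for \<epsilon>
  proof -
    have "eventually (\<lambda>n. \<bar>var (2 * n) / var n - 2\<bar> < \<epsilon>) sequentially"
      using tendstoD[OF ratio \<open>\<epsilon> > 0\<close>] by (simp add: dist_real_def)
    moreover have "eventually (\<lambda>n. var n > 0) sequentially"
      using inf by (simp add: filterlim_at_top_dense)
    ultimately have "eventually (\<lambda>n. Vf_sq n \<le> \<epsilon> * var n + 16 / 3 * cov 0) sequentially"
    proof eventually_elim
      case (elim n)
      then have "var (2 * n) - 2 * var n \<le> \<epsilon> * var n" by (simp add: field_simps abs_less_iff)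
      moreover have "0 \<le> \<epsilon> * var n" using elim \<open>\<epsilon> > 0\<close> by simp
      ultimately show ?case using Vf_sq_le[of n] by (simp add: field_simps)
    qed
    then obtain N where N: "\<And>n. n \<ge> N \<Longrightarrow> Vf_sq n \<le> \<epsilon> * var n + 16 / 3 * cov 0"
      by (auto simp: eventually_sequentially)
    define C where "C = max (\<bar>16 / 3 * cov 0\<bar>) (Max (Vf_sq ` {..N}))"
    have "Vf_sq n \<le> \<epsilon> * var n + C" for n
    proof (cases "n \<ge> N")
      case True
      then show ?thesis using N[of n] by (simp add: C_def)
    next
      case False
      then have "Vf_sq n \<le> Max (Vf_sq ` {..N})" by (intro Max_ge) auto
      moreover have "0 \<le> \<epsilon> * var n" using \<open>\<epsilon> > 0\<close> var_nonneg by simp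
      ultimately show ?thesis by (simp add: C_def)
    qed
    moreover have "C \<ge> 0" by (simp add: C_def le_max_iff_disj)
    ultimately show ?thesis by blast
  qed
  \<comment> \<open>The fraction 1 / 4 turns the factor 2 of \<open>var_le\<close> into one half of
    the running maximum, which can be moved to the left side.\<close>
  obtain D where D: "D \<ge> 0" "\<And>n. Vf_sq n \<le> 1 / 4 * var n + D" using *[of "1 / 4"] by auto
  have max: "var j \<le> 4 * var n + 4 * D" if "j \<le> n" for j n
  proof -
    define s where "s = Max (var ` {..n})"
    have le: "var m \<le> s" if "m \<le> n" for m unfolding s_def using that by (intro Max_ge) auto
    have "s \<in> var ` {..n}" unfolding s_def by (intro Max_in) auto
    then obtain m where m: "m \<in> {..n}" "s = var m" by blast
    have "s \<le> 2 * var n + 2 * Vf_sq (n - m)" unfolding m(2) using m(1) by (intro var_le) simp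
    also have "Vf_sq (n - m) \<le> 1 / 4 * s + D" using D(2)[of "n - m"] le[of "n - m"] by simp
    finally have "s \<le> 2 * var n + 2 * (1 / 4 * s + D)" by simp
    then have "s \<le> 4 * var n + 4 * D" by simp
    then show ?thesis using le[OF that] by simp
  qed
  obtain C where C: "\<And>n. Vf_sq n \<le> \<epsilon> / 4 * var n + C" using *[of "\<epsilon> / 4"] \<open>\<epsilon> > 0\<close> by auto
  have "Vf_sq j \<le> \<epsilon> * var n + (\<epsilon> * D + C)" if "j \<le> n" for j n
  proof -
    have "\<epsilon> / 4 * var j \<le> \<epsilon> / 4 * (4 * var n + 4 * D)"
      using max[OF that] \<open>\<epsilon> > 0\<close> by (intro mult_left_mono) auto
    then show ?thesis using C[of j] by (simp add: algebra_simps)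
  qed
  then show ?thesis by blast
qed

lemma integral_phi_phi_1: "(\<integral>w. \<phi> a (\<xi> k w) * \<phi> b (\<xi> (k + 1) w) \<partial>M) = cov (a + b + 1)"
  using integral_phi_lag[of a k b 1] integral_phi_phi[of a k "b + 1"] by simp

text \<open>With $Z_j = f(\xi_j) + f(\xi_{j+1})$ the sums $\sum_{k=1}^m \mathbb{E} Z_0 Z_k$ are nonnegative: the terms with odd $k$
  are squared norms, and so are, up to a factor, the sums of an odd term and its successor.\<close>

lemma var_linear_lower_bound:
  assumes inf: "filterlim var at_top sequentially"
  shows "\<exists>c>0. \<exists>C. \<forall>n. c * real n - C \<le> var n"
proof -
  \<comment> \<open>In spectral terms \<open>cov k\<close> integrates \<lambda>^k, and sums of
    \<lambda>^k over k \<ge> 1 can be negative for negative \<lambda>. For neighbours added together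
    the k-th correlation integrates (1 + \<lambda>)^2 \<lambda>^(k - 1); its partial sums start at
    the power 0 and are nonnegative on [-1, 1].\<close>
  define Z where "Z j w = f (\<xi> (int j) w) + f (\<xi> (int j + 1) w)" for j :: nat and w
  define \<gamma> where "\<gamma> k = (\<integral>w. Z 0 w * Z k w \<partial>M)" for k
  have Z: "L2 M (Z j)" for j unfolding Z_def[abs_def] by (intro L2_add L2_f_xi)
  have ZZ: "(\<integral>w. Z a w * Z b w \<partial>M) = 2 * cov (nat \<bar>int b - int a\<bar>) + cov (nat \<bar>int b - int a - 1\<bar>) + cov (nat \<bar>int b - int a + 1\<bar>)" for a b
  proof -
    let ?X = "\<lambda>j w. f (\<xi> j w)"
    have i: "integrable M (\<lambda>w. ?X i w * ?X j w)" for i j by (intro L2_mult_integrable L2_f_xi)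
    have "(\<integral>w. Z a w * Z b w \<partial>M) = (\<integral>w. ?X (int a) w * ?X (int b) w + ?X (int a) w * ?X (int b + 1) w
        + ?X (int a + 1) w * ?X (int b) w + ?X (int a + 1) w * ?X (int b + 1) w \<partial>M)"
      by (simp add: Z_def distrib_left distrib_right add.assoc add.left_commute)
    also have "\<dots> = (\<integral>w. ?X (int a) w * ?X (int b) w \<partial>M) + (\<integral>w. ?X (int a) w * ?X (int b + 1) w \<partial>M)
        + (\<integral>w. ?X (int a + 1) w * ?X (int b) w \<partial>M) + (\<integral>w. ?X (int a + 1) w * ?X (int b + 1) w \<partial>M)"
      using i by simp
    moreover have "int b + 1 - int a = int b - int a + 1" "int b - (int a + 1) = int b - int a - 1"
      "int b + 1 - (int a + 1) = int b - int a" by simp_all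
    ultimately show ?thesis by (simp only: cov_shift)
  qed
  have \<gamma>: "\<gamma> (Suc k) = 2 * cov (Suc k) + cov k + cov (Suc (Suc k))" for k
    unfolding \<gamma>_def by (simp add: ZZ nat_add_distrib)
  have ZZ\<gamma>: "(\<integral>w. Z j w * Z n w \<partial>M) = \<gamma> (n - j)" if "j \<le> n" for j n
    unfolding \<gamma>_def ZZ using that by (simp add: of_nat_diff)
  have phi_sq: "(\<integral>w. (\<phi> a (\<xi> k w))\<^sup>2 \<partial>M) = cov (2 * a)" for a k
    using integral_phi_phi[of a k a] by (simp add: power2_eq_square mult_2[symmetric])
  have odd: "\<gamma> (Suc (2 * i)) = (\<integral>w. (\<phi> i (\<xi> k w) + \<phi> (Suc i) (\<xi> k w))\<^sup>2 \<partial>M)" for i k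
    using integral_add_sq[OF L2_xi[OF phi_L2] L2_xi[OF phi_L2], of i k "Suc i" k]
    by (simp add: \<gamma> integral_phi_phi phi_sq mult_2[symmetric])
  \<comment> \<open>With u the function \<open>\<phi> i + \<phi> (Suc i)\<close>, the two
    correlations are the means of u(\<xi>_0)^2 and of u(\<xi>_0) u(\<xi>_1); their sum is half the
    mean of (u(\<xi>_0) + u(\<xi>_1))^2.\<close>
  have pair: "0 \<le> \<gamma> (Suc (2 * i)) + \<gamma> (Suc (Suc (2 * i)))" for i
  proof -
    let ?u = "\<lambda>k w. \<phi> i (\<xi> k w) + \<phi> (Suc i) (\<xi> k w)"
    have u: "L2 M (?u k)" for k by (intro L2_add L2_xi phi_L2)
    have i: "integrable M (\<lambda>w. \<phi> a (\<xi> j w) * \<phi> b (\<xi> k w))" for a b j k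
      by (intro L2_mult_integrable L2_xi phi_L2)
    have "(\<integral>w. ?u 0 w * ?u 1 w \<partial>M) = (\<integral>w. \<phi> i (\<xi> 0 w) * \<phi> i (\<xi> (0 + 1) w) + \<phi> i (\<xi> 0 w) * \<phi> (Suc i) (\<xi> (0 + 1) w)
        + \<phi> (Suc i) (\<xi> 0 w) * \<phi> i (\<xi> (0 + 1) w) + \<phi> (Suc i) (\<xi> 0 w) * \<phi> (Suc i) (\<xi> (0 + 1) w) \<partial>M)"
      by (simp add: distrib_left distrib_right add.assoc add.left_commute)
    also have "\<dots> = cov (i + i + 1) + cov (i + Suc i + 1) + cov (Suc i + i + 1) + cov (Suc i + Suc i + 1)"
      using i by (simp only: Bochner_Integration.integral_add Bochner_Integration.integrable_add integral_phi_phi_1)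
    finally have "(\<integral>w. ?u 0 w * ?u 1 w \<partial>M) = cov (Suc (2 * i)) + 2 * cov (Suc (Suc (2 * i))) + cov (Suc (Suc (Suc (2 * i))))"
      by (simp add: mult_2[symmetric])
    moreover have "0 \<le> (\<integral>w. (?u 0 w + ?u 1 w)\<^sup>2 \<partial>M)" by simp
    ultimately show ?thesis
      using integral_add_sq[OF u u, of 0 1] odd[of i 0] odd[of i 1] \<gamma>[of "2 * i"] \<gamma>[of "Suc (2 * i)"] by simp
  qed
  have even_sum: "0 \<le> (\<Sum>k=1..2 * i. \<gamma> k)" for i
  proof (induction i)
    case (Suc i)
    then show ?case using pair[of i] by simp
  qed simp
  have part: "0 \<le> (\<Sum>k=1..m. \<gamma> k)" for m
  proof (cases "even m")
    case True
    then show ?thesis using even_sum by (auto elim!: evenE)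
  next
    case False
    then obtain i where "m = Suc (2 * i)" by (auto elim!: oddE)
    moreover have "0 \<le> \<gamma> (Suc (2 * i))" unfolding odd[of i 0] by simp
    ultimately show ?thesis using even_sum[of i] by simp
  qed
  define A where "A n w = (\<Sum>j<n. Z j w)" for n w
  have A: "L2 M (A n)" for n unfolding A_def[abs_def] by (intro L2_sum Z)
  have A_sq: "(\<integral>w. (A (Suc n) w)\<^sup>2 \<partial>M) = (\<integral>w. (A n w)\<^sup>2 \<partial>M) + 2 * (\<Sum>k=1..n. \<gamma> k) + \<gamma> 0" for n
  proof -
    have "(\<integral>w. A n w * Z n w \<partial>M) = (\<Sum>j<n. \<integral>w. Z j w * Z n w \<partial>M)"
      unfolding A_def sum_distrib_right by (intro Bochner_Integration.integral_sum L2_mult_integrable Z)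
    also have "\<dots> = (\<Sum>j<n. \<gamma> (n - j))" by (intro sum.cong) (auto simp: ZZ\<gamma>)
    also have "\<dots> = (\<Sum>k=1..n. \<gamma> k)"
      by (rule sum.reindex_bij_witness[where i = "\<lambda>k. n - k" and j = "\<lambda>j. n - j"]) auto
    finally show ?thesis
      using integral_add_sq[OF A Z, of n n] ZZ\<gamma>[of n n] by (simp add: A_def power2_eq_square)
  qed
  have A_lower: "real n * \<gamma> 0 \<le> (\<integral>w. (A n w)\<^sup>2 \<partial>M)" for n
  proof (induction n)
    case (Suc n)
    then show ?case using part[of n] A_sq[of n] by (simp add: algebra_simps)
  qed simp
  \<comment> \<open>The neighbouring pairs count each of the times 0, ..., n twice except the two
    ends; the offset -1 makes the block begin at time 0.\<close>
  have AS: "A n w = 2 * bsum (-1) (Suc n) (path w) - (f (\<xi> 0 w) + f (\<xi> (int n) w))" for n w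
    by (induction n) (simp_all add: A_def Z_def bsum_def algebra_simps)
  let ?E = "\<lambda>n w. f (\<xi> 0 w) + f (\<xi> (int n) w)"
  have E: "L2 M (?E n)" for n by (intro L2_add L2_f_xi)
  have E4: "(\<integral>w. (?E n w)\<^sup>2 \<partial>M) \<le> 4 * cov 0" for n
    using integral_diff_sq_le[OF L2_f_xi L2_minus[OF L2_f_xi], of 0 "int n"] by (simp add: integral_f_sq)
  have S4: "(\<integral>w. (2 * bsum (-1) n (path w))\<^sup>2 \<partial>M) = 4 * var n" for n
    by (simp add: power_mult_distrib integral_bsum_sq)
  have main: "real n * \<gamma> 0 \<le> 8 * var (Suc n) + 8 * cov 0" for n
  proof -
    have "(\<integral>w. (A n w)\<^sup>2 \<partial>M) \<le> 2 * (4 * var (Suc n)) + 2 * (4 * cov 0)"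
      unfolding AS using integral_diff_sq_le[OF L2_scale[OF L2_bsum] E, of 2 "-1" "Suc n" n] E4[of n] S4[of "Suc n"] by simp
    then show ?thesis using A_lower[of n] by simp
  qed
  have "\<gamma> 0 \<ge> 0" by (simp add: \<gamma>_def)
  \<comment> \<open>If \<open>\<gamma> 0\<close> vanished, every \<open>A n\<close> would vanish in
    L2 and twice the block sum would reduce to its two end terms, against the growth of
    \<open>var\<close>.\<close>
  moreover have "\<gamma> 0 \<noteq> 0"
  proof
    assume 0: "\<gamma> 0 = 0"
    have "\<gamma> k = 0" for k
    proof -
      have "L2norm M (Z 0) = 0" using 0 by (simp add: L2norm_def \<gamma>_def power2_eq_square)
      then show ?thesis using L2_cauchy_schwarz[OF Z Z, of 0 k] by (simp add: \<gamma>_def)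
    qed
    then have A0: "(\<integral>w. (A n w)\<^sup>2 \<partial>M) = 0" for n
      by (induction n) (simp_all add: A_sq, simp add: A_def)
    have "var (Suc n) \<le> 2 * cov 0" for n
    proof -
      have "4 * var (Suc n) = (\<integral>w. (A n w - (- ?E n w))\<^sup>2 \<partial>M)"
        unfolding AS S4[symmetric] by simp
      also have "\<dots> \<le> 2 * 0 + 2 * (4 * cov 0)"
        using integral_diff_sq_le[OF A L2_minus[OF E], of n n] E4[of n] A0[of n]
        unfolding power2_minus by linarith
      finally show ?thesis by simp
    qed
    moreover have "eventually (\<lambda>n. var n > 2 * cov 0) sequentially"
      using inf by (simp add: filterlim_at_top_dense)
    then obtain n where "var (Suc n) > 2 * cov 0"
      by (auto simp: eventually_sequentially) (metis le_SucI order_refl)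
    ultimately show False by (meson not_less)
  qed
  ultimately have "\<gamma> 0 > 0" by simp
  moreover have "\<gamma> 0 / 8 * real n - (\<gamma> 0 / 8 + \<bar>cov 0\<bar>) \<le> var n" for n
  proof (cases n)
    case 0
    then show ?thesis using var_nonneg[of 0] \<open>\<gamma> 0 > 0\<close> by simp
  next
    case (Suc m)
    then show ?thesis using main[of m] by (simp add: field_simps)
  qed
  ultimately show ?thesis
    by (intro exI[of _ "\<gamma> 0 / 8"] conjI exI[of _ "\<gamma> 0 / 8 + \<bar>cov 0\<bar>"]) auto
qed

section \<open>Forward-backward martingales and the maximal inequality\<close>

text \<open>\<open>poisson n\<close> averages the partial sums of the Neumann series for $(1-Q)^{-1} f$, and \<open>poisson_Q n\<close> is its
  image under $Q$. The latter is defined separately because \<^term>\<open>Q_op\<close>, being a pointwise integral with junk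
  value \<open>0\<close>, is additive only almost everywhere.\<close>

definition poisson_Q :: "nat \<Rightarrow> 's \<Rightarrow> real" where
  "poisson_Q n x = (\<Sum>j<n. Vf (Suc j) x) / real n"

definition poisson :: "nat \<Rightarrow> 's \<Rightarrow> real" where
  "poisson n x = (\<Sum>j<n. \<Sum>i\<le>j. \<phi> i x) / real n"

text \<open>This is Poisson's equation (1 - Q) g = f for g = \<open>poisson n\<close>, with error
  -V_n f / n. A single truncated Neumann series would leave the error Q^n f; the averaged error,
  summed over n times, has L2 norm at most that of V_n f.\<close>

lemma poisson_eq: "n > 0 \<Longrightarrow> poisson n x = poisson_Q n x + f x - Vf n x / real n"
proof -
  assume "n > 0"
  have 1: "(\<Sum>i\<le>j. \<phi> i x) + \<phi> (Suc j) x = Vf (Suc j) x + f x" for j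
    by (induction j) (simp_all add: Vf_def)
  have 2: "Vf n x = (\<Sum>j<n. \<phi> (Suc j) x)"
    unfolding Vf_def by (rule sum.reindex_bij_witness[where i = Suc and j = "\<lambda>i. i - 1"]) auto
  have "(\<Sum>j<n. (\<Sum>i\<le>j. \<phi> i x)) + Vf n x = (\<Sum>j<n. Vf (Suc j) x) + real n * f x"
    unfolding 2 sum.distrib[symmetric] 1 by (simp add: sum.distrib)
  then have "poisson n x = ((\<Sum>j<n. Vf (Suc j) x) + real n * f x - Vf n x) / real n"
    by (simp add: poisson_def eq_diff_eq)
  then show ?thesis using \<open>n > 0\<close> by (simp add: poisson_Q_def add_divide_distrib diff_divide_distrib)
qed

lemma measurable_poisson_Q [measurable]: "poisson_Q n \<in> borel_measurable S"
  unfolding poisson_Q_def[abs_def] by (intro borel_measurable_divide borel_measurable_sum measurable_Vf measurable_const) simp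

lemma measurable_poisson [measurable]: "poisson n \<in> borel_measurable S"
  unfolding poisson_def[abs_def] by (intro borel_measurable_divide borel_measurable_sum measurable_phi measurable_const) simp

lemma L2_poisson_Q: "L2 \<pi> (poisson_Q n)"
  unfolding poisson_Q_def[abs_def] by (intro L2_divide L2_sum Vf_L2)

lemma L2_poisson: "L2 \<pi> (poisson n)"
  unfolding poisson_def[abs_def] by (intro L2_divide L2_sum phi_L2)

lemma poisson_step:
  assumes \<Psi>: "\<Psi> \<in> borel_measurable (past k)" "L2 M \<Psi>"
  shows "(\<integral>w. \<Psi> w * poisson n (\<xi> (k + 1) w) \<partial>M) = (\<integral>w. \<Psi> w * poisson_Q n (\<xi> k w) \<partial>M)"
proof -
  have i: "integrable M (\<lambda>w. \<Psi> w * \<phi> i (\<xi> j w))" for i j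
    by (intro L2_mult_integrable \<Psi> L2_xi phi_L2)
  have Vf: "Vf (Suc j) x = (\<Sum>i\<le>j. \<phi> (Suc i) x)" for j x
    by (induction j) (simp_all add: Vf_def)
  have "(\<integral>w. \<Psi> w * poisson n (\<xi> (k + 1) w) \<partial>M) = (\<Sum>j<n. \<Sum>i\<le>j. \<integral>w. \<Psi> w * \<phi> i (\<xi> (k + 1) w) \<partial>M) / real n"
    unfolding poisson_def times_divide_eq_right sum_distrib_left integral_divide_zero
    by (simp only: i Bochner_Integration.integral_sum Bochner_Integration.integrable_sum)
  also have "\<dots> = (\<Sum>j<n. \<Sum>i\<le>j. \<integral>w. \<Psi> w * \<phi> (Suc i) (\<xi> k w) \<partial>M) / real n"
    by (simp only: phi_step[OF \<Psi>])
  also have "\<dots> = (\<integral>w. \<Psi> w * poisson_Q n (\<xi> k w) \<partial>M)"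
    unfolding poisson_Q_def Vf times_divide_eq_right sum_distrib_left integral_divide_zero
    by (simp only: i Bochner_Integration.integral_sum Bochner_Integration.integrable_sum)
  finally show ?thesis .
qed

text \<open>The differences g(\<xi>_j) - Qg(\<xi>_{j-1}) for g = \<open>poisson n\<close> are
  summed; n selects the solution and k is time. With a trajectory as argument the same formula
  serves for the reversed path.\<close>

definition mart :: "nat \<Rightarrow> nat \<Rightarrow> (int \<Rightarrow> 's) \<Rightarrow> real" where
  "mart n k x = (\<Sum>j=1..k. poisson n (x (int j)) - poisson_Q n (x (int j - 1)))"

lemma measurable_mart [measurable]: "mart n k \<in> borel_measurable traj"
  unfolding mart_def[abs_def]
  by (intro borel_measurable_sum borel_measurable_diff measurable_traj_fun measurable_poisson measurable_poisson_Q)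

lemma L2_mart: "L2 M (\<lambda>w. mart n k (path w))"
  unfolding mart_def by (intro L2_sum L2_diff L2_xi L2_poisson L2_poisson_Q)

lemma mart_past: "(\<lambda>w. mart n k (path w)) \<in> borel_measurable (past (int k))"
  unfolding mart_def
  by (intro borel_measurable_sum borel_measurable_diff measurable_past_comp measurable_poisson measurable_poisson_Q) auto

lemma mart_martingale:
  assumes \<Psi>: "\<Psi> \<in> borel_measurable (past (int k))" "L2 M \<Psi>" and "k \<le> m"
  shows "(\<integral>w. \<Psi> w * mart n m (path w) \<partial>M) = (\<integral>w. \<Psi> w * mart n k (path w) \<partial>M)"
  using \<open>k \<le> m\<close>
proof (induction m rule: dec_induct)
  case (step m)
  have \<Psi>m: "\<Psi> \<in> borel_measurable (past (int m))"
    by (rule measurable_past_mono[OF _ \<Psi>(1)]) (use step in simp)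
  have i: "integrable M (\<lambda>w. \<Psi> w * mart n m (path w))" "integrable M (\<lambda>w. \<Psi> w * poisson n (\<xi> (int m + 1) w))"
    "integrable M (\<lambda>w. \<Psi> w * poisson_Q n (\<xi> (int m) w))"
    by (intro L2_mult_integrable \<Psi> L2_mart L2_xi L2_poisson L2_poisson_Q)+
  have "(\<integral>w. \<Psi> w * mart n (Suc m) (path w) \<partial>M) =
      (\<integral>w. \<Psi> w * mart n m (path w) + (\<Psi> w * poisson n (\<xi> (int m + 1) w) - \<Psi> w * poisson_Q n (\<xi> (int m) w)) \<partial>M)"
    by (simp add: mart_def algebra_simps)
  also have "\<dots> = (\<integral>w. \<Psi> w * mart n m (path w) \<partial>M)"
    using i poisson_step[OF \<Psi>m \<Psi>(2), of n] by simp
  finally show ?case using step by simp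
qed simp

text \<open>Telescoping with Poisson's equation. The formula is applied at the terminal time
  \<open>k = n\<close>, where the remainder is small in L2; for a maximum over k the value of
  \<open>poisson_Q n\<close> at time k would stand in the way, and \<open>forward_backward\<close>
  takes over.\<close>

lemma mart_eq:
  assumes "n > 0"
  shows "mart n k x = bsum 0 k x + (poisson_Q n (x (int k)) - poisson_Q n (x 0) - (\<Sum>j=1..k. Vf n (x (int j))) / real n)"
  by (induction k) (simp_all add: mart_def bsum_def poisson_eq[OF assms] add_divide_distrib)

text \<open>The step from j to j + 1 contributes g(\<xi>_{j+1}) - Qg(\<xi>_j) forwards and
  g(\<xi>_j) - Qg(\<xi>_{j+1}) backwards. In the sum only g - Qg at the two times survives, to which
  Poisson's equation applies, so no value of g is left as an error. The backward part is the
  increment of the reversed martingale between the times n - k and n.\<close>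

lemma forward_backward:
  assumes "n > 0" "k \<le> n"
  shows "2 * bsum 0 k x = mart n k x + (mart n n (\<lambda>i. x (int n - i)) - mart n (n - k) (\<lambda>i. x (int n - i)))
    + 2 * (\<Sum>j=1..k. Vf n (x (int j))) / real n - (f (x 0) - Vf n (x 0) / real n) + (f (x (int k)) - Vf n (x (int k)) / real n)"
  using assms(2)
proof (induction k)
  case (Suc k)
  have eq: "n - k = Suc (n - Suc k)" using Suc.prems by simp
  have "mart n (n - k) (\<lambda>i. x (int n - i)) - mart n (n - Suc k) (\<lambda>i. x (int n - i)) = poisson n (x (int k)) - poisson_Q n (x (int k + 1))"
    unfolding eq using Suc.prems by (simp add: mart_def of_nat_diff)
  moreover have "mart n (Suc k) x = mart n k x + poisson n (x (int k + 1)) - poisson_Q n (x (int k))"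
    by (simp add: mart_def algebra_simps)
  moreover have "bsum 0 (Suc k) x = bsum 0 k x + f (x (int k + 1))"
    by (simp add: bsum_def algebra_simps)
  moreover have "(\<Sum>j=1..Suc k. Vf n (x (int j))) = (\<Sum>j=1..k. Vf n (x (int j))) + Vf n (x (int k + 1))"
    by (simp add: algebra_simps)
  moreover have "int (Suc k) = int k + 1" by simp
  ultimately show ?case
    using Suc poisson_eq[OF assms(1), of "x (int k)"] poisson_eq[OF assms(1), of "x (int k + 1)"]
    by (simp only:) (simp add: add_divide_distrib algebra_simps)
qed (simp add: bsum_def mart_def)

section \<open>The maximal inequality for partial sums\<close>

lemma L2norm_Vf_xi: "L2norm M (\<lambda>w. Vf n (\<xi> k w)) = sqrt (Vf_sq n)"
  by (simp add: L2norm_def integral_Vf_sq)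

lemma L2norm_poisson_Q_xi:
  assumes K: "0 \<le> K" "\<And>j. j \<le> n \<Longrightarrow> sqrt (Vf_sq j) \<le> K" and n: "n > 0"
  shows "L2norm M (\<lambda>w. poisson_Q n (\<xi> k w)) \<le> K"
proof -
  have "L2norm M (\<lambda>w. poisson_Q n (\<xi> k w)) = 1 / real n * L2norm M (\<lambda>w. \<Sum>j<n. Vf (Suc j) (\<xi> k w))"
    unfolding poisson_Q_def using L2norm_scale[of M "1 / real n"] by simp
  also have "\<dots> \<le> 1 / real n * (\<Sum>j<n. sqrt (Vf_sq (Suc j)))"
    using L2norm_sum_le[of "{..<n}" M "\<lambda>j w. Vf (Suc j) (\<xi> k w)"] L2_Vf_xi
    by (intro mult_left_mono) (auto simp: L2norm_Vf_xi)
  also have "(\<Sum>j<n. sqrt (Vf_sq (Suc j))) \<le> (\<Sum>j<n. K)"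
    by (intro sum_mono K) auto
  finally show ?thesis using n by (simp add: divide_right_mono)
qed

text \<open>Union bound: if |S_k| exceeds 2 a, then the forward or the backward martingale exceeds
  a, or the average \<open>R\<close> exceeds a / 8, or some |f(\<xi>_j)| exceeds a / 4. The two
  martingale events have equal probability by reflection, and in Doob's bound the terminal value is
  replaced by S_n.\<close>

lemma max_tail_bound:
  assumes n: "n > 0" and a: "a > 0" and K: "0 \<le> K" "\<And>j. j \<le> n \<Longrightarrow> sqrt (Vf_sq j) \<le> K"
  shows "prob {w\<in>space M. \<exists>k\<le>n. \<bar>bsum 0 k (path w)\<bar> > 2 * a} \<le>
    8 / a * (\<integral>w. \<bar>bsum 0 n (path w)\<bar> * of_bool (\<bar>bsum 0 n (path w)\<bar> > a / 4) \<partial>M) + 24 * K / a + 256 * K\<^sup>2 / a\<^sup>2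
      + 16 * (real n + 1) / a\<^sup>2 * (\<integral>w. (f (\<xi> 0 w))\<^sup>2 * of_bool (\<bar>f (\<xi> 0 w)\<bar> > a / 4) \<partial>M)"
proof -
  \<comment> \<open>One variable that dominates, for every k \<le> n at once, all terms of
    \<open>forward_backward\<close> containing V_n f, so that no maximal inequality is spent on
    them.\<close>
  define R where "R w = (\<Sum>j\<le>n. \<bar>Vf n (\<xi> (int j) w)\<bar>) / real n" for w
  define E where "E w = poisson_Q n (\<xi> (int n) w) - poisson_Q n (\<xi> 0 w) - (\<Sum>j=1..n. Vf n (\<xi> (int j) w)) / real n" for w
  let ?S = "\<lambda>k w. bsum 0 k (path w)"
  let ?Y = "\<lambda>k w. mart n k (path w)"
  let ?rev = "\<lambda>w i. \<xi> (int n - i) w"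
  have LV: "L2 M (\<lambda>w. Vf n (\<xi> (int j) w))" for j by (rule L2_Vf_xi)
  have LR: "L2 M R" unfolding R_def[abs_def] by (intro L2_divide L2_sum L2_abs LV)
  have LE: "L2 M E" unfolding E_def[abs_def] by (intro L2_divide L2_sum L2_diff LV L2_xi L2_poisson_Q)
  note [measurable] = L2_measurable[OF LR] L2_measurable[OF LE]
  have [measurable]: "(\<lambda>w. mart n k (path w)) \<in> borel_measurable M" for k
    by (rule L2_measurable[OF L2_mart])
  have [measurable]: "?rev \<in> M \<rightarrow>\<^sub>M traj" by (rule measurable_path)
  have [measurable]: "(\<lambda>w. mart n k (?rev w)) \<in> borel_measurable M" for k
    by (rule measurable_compose[OF _ measurable_mart]) measurable
  have [measurable]: "(\<lambda>w. f (\<xi> j w)) \<in> borel_measurable M" for j by (rule L2_measurable[OF L2_f_xi])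
  have sumV: "L2norm M (\<lambda>w. \<Sum>j\<in>J. X j w) \<le> real (card J) * K"
    if "finite J" "\<And>j. L2 M (X j)" "\<And>j. L2norm M (X j) \<le> K" for J :: "nat set" and X
  proof -
    have "L2norm M (\<lambda>w. \<Sum>j\<in>J. X j w) \<le> (\<Sum>j\<in>J. L2norm M (X j))"
      by (rule L2norm_sum_le) (use that in auto)
    also have "\<dots> \<le> (\<Sum>j\<in>J. K)" by (intro sum_mono that)
    finally show ?thesis by simp
  qed
  have VK: "L2norm M (\<lambda>w. Vf n (\<xi> (int j) w)) \<le> K" for j using K(2)[of n] by (simp add: L2norm_Vf_xi)
  have normR: "L2norm M R \<le> 2 * K"
  proof -
    have "L2norm M R = 1 / real n * L2norm M (\<lambda>w. \<Sum>j\<le>n. \<bar>Vf n (\<xi> (int j) w)\<bar>)"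
      unfolding R_def[abs_def] using L2norm_scale[of M "1 / real n"] by simp
    also have "\<dots> \<le> 1 / real n * (real (card {..n}) * K)"
      by (intro mult_left_mono sumV L2_abs LV) (auto simp: L2norm_abs VK)
    also have "\<dots> \<le> 2 * K" using n K(1) mult_right_mono[of 1 "real n" K] by (simp add: field_simps)
    finally show ?thesis .
  qed
  have normE: "L2norm M E \<le> 3 * K"
  proof -
    have "L2norm M E \<le> L2norm M (\<lambda>w. poisson_Q n (\<xi> (int n) w) - poisson_Q n (\<xi> 0 w)) + L2norm M (\<lambda>w. (\<Sum>j=1..n. Vf n (\<xi> (int j) w)) / real n)"
      unfolding E_def[abs_def] by (intro L2norm_triangle_diff L2_diff L2_divide L2_sum LV L2_xi L2_poisson_Q)
    also have "L2norm M (\<lambda>w. poisson_Q n (\<xi> (int n) w) - poisson_Q n (\<xi> 0 w)) \<le> L2norm M (\<lambda>w. poisson_Q n (\<xi> (int n) w)) + L2norm M (\<lambda>w. poisson_Q n (\<xi> 0 w))"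
      by (intro L2norm_triangle_diff L2_xi L2_poisson_Q)
    also have "L2norm M (\<lambda>w. poisson_Q n (\<xi> (int n) w)) \<le> K" by (rule L2norm_poisson_Q_xi[OF K n])
    also have "L2norm M (\<lambda>w. poisson_Q n (\<xi> 0 w)) \<le> K" by (rule L2norm_poisson_Q_xi[OF K n])
    also have "L2norm M (\<lambda>w. (\<Sum>j=1..n. Vf n (\<xi> (int j) w)) / real n) = 1 / real n * L2norm M (\<lambda>w. \<Sum>j=1..n. Vf n (\<xi> (int j) w))"
      using L2norm_scale[of M "1 / real n"] by simp
    also have "\<dots> \<le> 1 / real n * (real (card {1..n}) * K)"
      by (intro mult_left_mono sumV LV VK) auto
    also have "\<dots> = K" using n by simp
    finally show ?thesis by simp
  qed
  have YS: "?Y n w = ?S n w + E w" for w using mart_eq[OF n, of n "path w"] by (simp add: E_def)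
  have OL: "L2 M (\<lambda>w. of_bool (P w))" if [measurable]: "Measurable.pred M P" for P
    by (rule L2_bounded[where B = 1]) auto
  have YI: "(\<integral>w. \<bar>?Y n w\<bar> * of_bool (\<bar>?Y n w\<bar> > a / 2) \<partial>M) \<le> 2 * (\<integral>w. \<bar>?S n w\<bar> * of_bool (\<bar>?S n w\<bar> > a / 4) \<partial>M) + 6 * K"
  proof -
    have i1: "integrable M (\<lambda>w. \<bar>?S n w\<bar> * of_bool (\<bar>?S n w\<bar> > a / 4))"
      by (intro L2_mult_integrable L2_abs L2_bsum OL) measurable
    have i2: "integrable M (\<lambda>w. \<bar>E w\<bar>)" by (intro L2_integrable L2_abs LE)
    have "(\<integral>w. \<bar>?Y n w\<bar> * of_bool (\<bar>?Y n w\<bar> > a / 2) \<partial>M) \<le> (\<integral>w. 2 * (\<bar>?S n w\<bar> * of_bool (\<bar>?S n w\<bar> > a / 4)) + 2 * \<bar>E w\<bar> \<partial>M)"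
    proof (rule integral_mono)
      show "integrable M (\<lambda>w. \<bar>?Y n w\<bar> * of_bool (\<bar>?Y n w\<bar> > a / 2))"
        by (intro L2_mult_integrable L2_abs L2_mart OL) measurable
      show "integrable M (\<lambda>w. 2 * (\<bar>?S n w\<bar> * of_bool (\<bar>?S n w\<bar> > a / 4)) + 2 * \<bar>E w\<bar>)"
        using i1 i2 by simp
      fix w
      \<comment> \<open>If |s| \<le> |e| the left side is at most 2 |e|; otherwise |s + e| < 2 |s|,
        and |s + e| > a / 2 forces |s| > a / 4.\<close>
      have "\<bar>s + e\<bar> * of_bool (\<bar>s + e\<bar> > a / 2) \<le> 2 * (\<bar>s\<bar> * of_bool (\<bar>s\<bar> > a / 4)) + 2 * \<bar>e\<bar>" for s e :: real
        using abs_triangle_ineq[of s e] abs_ge_zero[of s] abs_ge_zero[of e] unfolding of_bool_def by (cases "\<bar>s\<bar> \<le> \<bar>e\<bar>"; simp; linarith)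
      then show "\<bar>?Y n w\<bar> * of_bool (\<bar>?Y n w\<bar> > a / 2) \<le> 2 * (\<bar>?S n w\<bar> * of_bool (\<bar>?S n w\<bar> > a / 4)) + 2 * \<bar>E w\<bar>"
        unfolding YS .
    qed
    also have "\<dots> = 2 * (\<integral>w. \<bar>?S n w\<bar> * of_bool (\<bar>?S n w\<bar> > a / 4) \<partial>M) + 2 * (\<integral>w. \<bar>E w\<bar> \<partial>M)"
      using i1 i2 by simp
    also have "(\<integral>w. \<bar>E w\<bar> \<partial>M) \<le> 3 * K" using L1_le_L2norm[OF LE] normE by simp
    finally show ?thesis by simp
  qed
  let ?A = "{w\<in>space M. \<exists>k\<le>n. \<bar>?Y k w\<bar> > a}" and ?B = "{w\<in>space M. \<exists>k\<le>n. \<bar>mart n k (?rev w)\<bar> > a}"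
    and ?C = "{w\<in>space M. \<bar>R w\<bar> > a / 8}" and ?D = "\<lambda>j. {w\<in>space M. \<bar>f (\<xi> (int j) w)\<bar> > a / 4}"
  have "{w\<in>space M. \<exists>k\<le>n. \<bar>?S k w\<bar> > 2 * a} \<subseteq> (?A \<union> ?B) \<union> (?C \<union> (\<Union>j\<le>n. ?D j))"
  proof (rule subsetI, rule ccontr)
    fix w assume "w \<in> {w\<in>space M. \<exists>k\<le>n. \<bar>?S k w\<bar> > 2 * a}"
      and no: "w \<notin> (?A \<union> ?B) \<union> (?C \<union> (\<Union>j\<le>n. ?D j))"
    then obtain k where k: "k \<le> n" "\<bar>?S k w\<bar> > 2 * a" and w: "w \<in> space M" by auto
    have A: "\<bar>?Y j w\<bar> \<le> a" and B: "\<bar>mart n j (?rev w)\<bar> \<le> a" and D: "\<bar>f (\<xi> (int j) w)\<bar> \<le> a / 4" if "j \<le> n" for j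
      using no w that by (auto simp: not_less)
    have C: "\<bar>R w\<bar> \<le> a / 8" using no w by (auto simp: not_less)
    have V1: "\<bar>(\<Sum>j=1..k. Vf n (\<xi> (int j) w)) / real n\<bar> \<le> R w"
    proof -
      have "\<bar>\<Sum>j=1..k. Vf n (\<xi> (int j) w)\<bar> \<le> (\<Sum>j=1..k. \<bar>Vf n (\<xi> (int j) w)\<bar>)" by (rule sum_abs)
      also have "\<dots> \<le> (\<Sum>j\<le>n. \<bar>Vf n (\<xi> (int j) w)\<bar>)" using k by (intro sum_mono2) auto
      finally show ?thesis by (simp add: R_def divide_right_mono)
    qed
    have V2: "\<bar>Vf n (\<xi> (int j) w) / real n\<bar> \<le> R w" if "j \<le> n" for j
    proof -
      have "\<bar>Vf n (\<xi> (int j) w)\<bar> \<le> (\<Sum>j\<le>n. \<bar>Vf n (\<xi> (int j) w)\<bar>)"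
        using that by (intro member_le_sum) auto
      then show ?thesis by (simp add: R_def divide_right_mono)
    qed
    \<comment> \<open>Budget: three martingale values give 3 a, four terms of size at most r \<le> a
      / 8 give a / 2, and two values of f give a / 2; hence 2 |s| \<le> 4 a.\<close>
    have key: "\<bar>s\<bar> \<le> 2 * a" if "2 * s = m1 + (m2 - m3) + 2 * v - (f0 - v0) + (f1 - v1)"
      "\<bar>m1\<bar> \<le> a" "\<bar>m2\<bar> \<le> a" "\<bar>m3\<bar> \<le> a" "\<bar>v\<bar> \<le> r" "\<bar>v0\<bar> \<le> r" "\<bar>v1\<bar> \<le> r" "\<bar>r\<bar> \<le> a / 8"
      "\<bar>f0\<bar> \<le> a / 4" "\<bar>f1\<bar> \<le> a / 4" for s m1 m2 m3 v v0 v1 f0 f1 r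
      using that unfolding abs_le_iff by (elim conjE, intro conjI; linarith)
    have "\<bar>?S k w\<bar> \<le> 2 * a"
      by (rule key[OF forward_backward[OF n k(1), of "path w", unfolded times_divide_eq_right[symmetric]] A[OF k(1)] B B V1 V2[OF le0, unfolded of_nat_0] V2[OF k(1)] C D[OF le0, unfolded of_nat_0] D[OF k(1)]])
         auto
    then show False using k(2) by simp
  qed
  then have "prob {w\<in>space M. \<exists>k\<le>n. \<bar>?S k w\<bar> > 2 * a} \<le> prob ((?A \<union> ?B) \<union> (?C \<union> (\<Union>j\<le>n. ?D j)))"
    by (intro finite_measure_mono) measurable
  also have "\<dots> \<le> prob (?A \<union> ?B) + prob (?C \<union> (\<Union>j\<le>n. ?D j))"
    by (intro measure_Un_le) measurable
  also have "prob (?A \<union> ?B) \<le> prob ?A + prob ?B"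
    by (intro measure_Un_le) measurable
  also have "prob (?C \<union> (\<Union>j\<le>n. ?D j)) \<le> prob ?C + prob (\<Union>j\<le>n. ?D j)"
    by (intro measure_Un_le) measurable
  also have "prob (\<Union>j\<le>n. ?D j) \<le> (\<Sum>j\<le>n. prob (?D j))"
    by (intro finite_measure_subadditive_finite) auto
  also have "prob ?B = prob ?A"
    by (rule prob_reflect[of "\<lambda>x. \<exists>k\<le>n. \<bar>mart n k x\<bar> > a"]) measurable
  also have "prob ?A \<le> 2 / a * (2 * (\<integral>w. \<bar>?S n w\<bar> * of_bool (\<bar>?S n w\<bar> > a / 4) \<partial>M) + 6 * K)"
  proof -
    have "a / 2 * prob ?A \<le> (\<integral>w. \<bar>?Y n w\<bar> * of_bool (\<bar>?Y n w\<bar> > a / 2) \<partial>M)"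
      by (rule doob_maximal[OF mart_past L2_mart mart_martingale a])
    also note YI
    finally show ?thesis using a by (simp add: field_simps)
  qed
  also have "prob ?C \<le> (2 * K)\<^sup>2 / (a / 8)\<^sup>2"
  proof -
    have "prob ?C \<le> (L2norm M R)\<^sup>2 / (a / 8)\<^sup>2" by (rule L2norm_markov[OF LR]) (use a in simp)
    also have "\<dots> \<le> (2 * K)\<^sup>2 / (a / 8)\<^sup>2" by (intro divide_right_mono power_mono normR) auto
    finally show ?thesis .
  qed
  also have "(\<Sum>j\<le>n. prob (?D j)) \<le> (\<Sum>j\<le>n. 16 / a\<^sup>2 * (\<integral>w. (f (\<xi> 0 w))\<^sup>2 * of_bool (\<bar>f (\<xi> 0 w)\<bar> > a / 4) \<partial>M))"
  proof (rule sum_mono)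
    fix j
    have [measurable]: "Measurable.pred traj (\<lambda>x. \<bar>f (x 0)\<bar> > a / 4)"
      using measurable_traj_fun[OF measurable_f, of 0] by measurable
    have "prob (?D j) = prob (?D 0)"
      using prob_shift[of "\<lambda>x. \<bar>f (x 0)\<bar> > a / 4" "int j"] by simp
    moreover have "(a / 4)\<^sup>2 * prob (?D 0) \<le> (\<integral>w. (f (\<xi> 0 w))\<^sup>2 * of_bool (\<bar>f (\<xi> 0 w)\<bar> > a / 4) \<partial>M)"
      using tail_truncated_second_moment[OF L2_f_xi, of "a / 4" 0] a by simp
    ultimately show "prob (?D j) \<le> 16 / a\<^sup>2 * (\<integral>w. (f (\<xi> 0 w))\<^sup>2 * of_bool (\<bar>f (\<xi> 0 w)\<bar> > a / 4) \<partial>M)"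
      using a by (simp add: field_simps power_divide)
  qed
  finally have "prob {w\<in>space M. \<exists>k\<le>n. \<bar>?S k w\<bar> > 2 * a} \<le>
      2 * (2 / a * (2 * (\<integral>w. \<bar>?S n w\<bar> * of_bool (\<bar>?S n w\<bar> > a / 4) \<partial>M) + 6 * K)) + (2 * K)\<^sup>2 / (a / 8)\<^sup>2
      + (\<Sum>j\<le>n. 16 / a\<^sup>2 * (\<integral>w. (f (\<xi> 0 w))\<^sup>2 * of_bool (\<bar>f (\<xi> 0 w)\<bar> > a / 4) \<partial>M))"
    by simp
  also have "\<dots> = 8 / a * (\<integral>w. \<bar>?S n w\<bar> * of_bool (\<bar>?S n w\<bar> > a / 4) \<partial>M) + 24 * K / a + 256 * K\<^sup>2 / a\<^sup>2
      + 16 * (real n + 1) / a\<^sup>2 * (\<integral>w. (f (\<xi> 0 w))\<^sup>2 * of_bool (\<bar>f (\<xi> 0 w)\<bar> > a / 4) \<partial>M)"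
    using a by (simp add: power_mult_distrib power_divide algebra_simps)
  finally show ?thesis .
qed

text \<open>\<open>max_tail_bound\<close> at a = b \<sigma>_n, multiplied by b^2. For fixed b the
  remainders vanish: those with K because the norms of V_j f are o(\<sigma>_n) uniformly in j \<le>
  n, the last one because n = O(\<sigma>_n^2) and the truncated second moment of f(\<xi>_0) tends to
  0.\<close>

lemma max_tail_asymptotic:
  assumes ratio: "(\<lambda>n. var (2 * n) / var n) \<longlonglongrightarrow> 2" and inf: "filterlim var at_top sequentially"
    and b: "b > 0"
  shows "\<exists>\<delta>. \<delta> \<longlonglongrightarrow> 0 \<and> (\<forall>\<^sub>F n in sequentially.
    b\<^sup>2 * prob {w\<in>space M. \<exists>k\<le>n. \<bar>bsum 0 k (path w)\<bar> > 2 * b * sqrt (var n)} \<le>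
    8 * b * (\<integral>w. \<bar>bsum 0 n (path w) / sqrt (var n)\<bar> * of_bool (\<bar>bsum 0 n (path w) / sqrt (var n)\<bar> > b / 4) \<partial>M) + \<delta> n)"
proof -
  define \<sigma> K where "\<sigma> n = sqrt (var n)" and "K n = sqrt (Max (Vf_sq ` {..n}))" for n
  define T where "T n = (\<integral>w. (f (\<xi> 0 w))\<^sup>2 * of_bool (\<bar>f (\<xi> 0 w)\<bar> > b * \<sigma> n / 4) \<partial>M)" for n
  define \<delta> where "\<delta> n = 24 * b * (K n / \<sigma> n) + 256 * (K n / \<sigma> n)\<^sup>2 + 16 * ((real n + 1) / var n * T n)" for n
  have K: "0 \<le> K n" "\<And>j. j \<le> n \<Longrightarrow> sqrt (Vf_sq j) \<le> K n" for n
  proof -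
    have "Vf_sq 0 \<le> Max (Vf_sq ` {..n})" by (intro Max_ge) auto
    then have "0 \<le> Max (Vf_sq ` {..n})" using Vf_sq_nonneg[of 0] by linarith
    then show "0 \<le> K n" unfolding K_def by (simp only: real_sqrt_ge_0_iff)
    show "sqrt (Vf_sq j) \<le> K n" if "j \<le> n" for j
      unfolding K_def using that by (intro real_sqrt_le_mono Max_ge) auto
  qed
  have pos: "eventually (\<lambda>n. var n > B) sequentially" for B
    using inf by (simp add: filterlim_at_top_dense)
  have K2: "(\<lambda>n. (K n / \<sigma> n)\<^sup>2) \<longlonglongrightarrow> 0"
  proof (rule tendstoI)
    fix e :: real assume e: "e > 0"
    obtain C where C: "\<And>n j. j \<le> n \<Longrightarrow> Vf_sq j \<le> e / 2 * var n + C"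
      using Vf_sq_small[OF ratio inf, of "e / 2"] e by auto
    show "eventually (\<lambda>n. dist ((K n / \<sigma> n)\<^sup>2) 0 < e) sequentially"
      using pos[of 0] pos[of "2 * C / e"]
    proof eventually_elim
      case (elim n)
      have "Max (Vf_sq ` {..n}) \<le> e / 2 * var n + C" by (subst Max_le_iff) (use C in auto)
      also have "\<dots> < e * var n" using elim e by (simp add: field_simps)
      finally have M: "Max (Vf_sq ` {..n}) < e * var n" .
      have "0 \<le> Max (Vf_sq ` {..n})" using K(1)[of n] by (simp add: K_def)
      then show ?case using M elim by (simp add: K_def \<sigma>_def power_divide field_simps)
    qed
  qed
  have K1: "(\<lambda>n. K n / \<sigma> n) \<longlonglongrightarrow> 0"
  proof -
    have "(\<lambda>n. sqrt ((K n / \<sigma> n)\<^sup>2)) \<longlonglongrightarrow> sqrt 0" by (intro tendsto_real_sqrt K2)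
    moreover have "sqrt ((K n / \<sigma> n)\<^sup>2) = K n / \<sigma> n" for n
      using K(1)[of n] var_nonneg[of n] by (simp add: \<sigma>_def)
    ultimately show ?thesis by simp
  qed
  have T0: "T \<longlonglongrightarrow> 0"
    unfolding T_def[abs_def]
  proof (rule truncated_second_moment_LIMSEQ_0[OF L2_f_xi])
    have "filterlim (\<lambda>n. b / 4 * \<sigma> n) at_top sequentially"
      unfolding \<sigma>_def using b
      by (intro filterlim_tendsto_pos_mult_at_top[OF tendsto_const] filterlim_compose[OF sqrt_at_top inf]) simp
    then show "filterlim (\<lambda>n. b * \<sigma> n / 4) at_top sequentially" by simp
  qed
  obtain c C where c: "c > 0" "\<And>n. c * real n - C \<le> var n"
    using var_linear_lower_bound[OF inf] by blast
  have nT0: "(\<lambda>n. (real n + 1) / var n * T n) \<longlonglongrightarrow> 0"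
  proof (rule Lim_null_comparison)
    show "eventually (\<lambda>n. norm ((real n + 1) / var n * T n) \<le> 2 / c * T n) sequentially"
      \<comment> \<open>Beyond this size \<open>var n\<close> absorbs both C and the extra c coming
        from n + 1, which gives the ratio bound 2 / c.\<close>
      using pos[of "\<bar>C\<bar> + c"]
    proof eventually_elim
      case (elim n)
      have "T n \<ge> 0" unfolding T_def by simp
      have "c * (real n + 1) \<le> 2 * var n" using elim c(2)[of n] by (simp add: algebra_simps)
      then have "(real n + 1) / var n \<le> 2 / c" using elim c(1) by (simp add: field_simps)
      moreover have "0 \<le> (real n + 1) / var n" using var_nonneg by simp
      ultimately show ?case using \<open>T n \<ge> 0\<close> by (simp only: real_norm_def abs_mult abs_of_nonneg mult_right_mono)
    qed
    show "(\<lambda>n. 2 / c * T n) \<longlonglongrightarrow> 0" using tendsto_mult_left[OF T0, of "2 / c"] by simp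
  qed
  have "\<delta> \<longlonglongrightarrow> 24 * b * 0 + 256 * 0 + 16 * 0"
    unfolding \<delta>_def[abs_def] by (intro tendsto_intros K1 K2 nT0)
  then have "\<delta> \<longlonglongrightarrow> 0" by simp
  moreover have "eventually (\<lambda>n. b\<^sup>2 * prob {w\<in>space M. \<exists>k\<le>n. \<bar>bsum 0 k (path w)\<bar> > 2 * b * sqrt (var n)} \<le>
    8 * b * (\<integral>w. \<bar>bsum 0 n (path w) / sqrt (var n)\<bar> * of_bool (\<bar>bsum 0 n (path w) / sqrt (var n)\<bar> > b / 4) \<partial>M) + \<delta> n) sequentially"
    using pos[of 0] eventually_gt_at_top[of 0]
  proof eventually_elim
    case (elim n)
    then have s: "\<sigma> n > 0" and s2: "(\<sigma> n)\<^sup>2 = var n" by (simp_all add: \<sigma>_def)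
    define I where "I = (\<integral>w. \<bar>bsum 0 n (path w)\<bar> * of_bool (\<bar>bsum 0 n (path w)\<bar> > b * \<sigma> n / 4) \<partial>M)"
    have I: "(\<integral>w. \<bar>bsum 0 n (path w) / \<sigma> n\<bar> * of_bool (\<bar>bsum 0 n (path w) / \<sigma> n\<bar> > b / 4) \<partial>M) = I / \<sigma> n"
    proof -
      have eq: "\<bar>y / \<sigma> n\<bar> * of_bool (\<bar>y / \<sigma> n\<bar> > b / 4) = \<bar>y\<bar> * of_bool (\<bar>y\<bar> > b * \<sigma> n / 4) / \<sigma> n" for y
        using s by (simp add: field_simps abs_divide)
      show ?thesis unfolding eq I_def by simp
    qed
    have "prob {w\<in>space M. \<exists>k\<le>n. \<bar>bsum 0 k (path w)\<bar> > 2 * (b * \<sigma> n)} \<le>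
      8 / (b * \<sigma> n) * I + 24 * K n / (b * \<sigma> n) + 256 * (K n)\<^sup>2 / (b * \<sigma> n)\<^sup>2 + 16 * (real n + 1) / (b * \<sigma> n)\<^sup>2 * T n"
      unfolding T_def I_def using elim s b by (intro max_tail_bound K) auto
    then have "b\<^sup>2 * prob {w\<in>space M. \<exists>k\<le>n. \<bar>bsum 0 k (path w)\<bar> > 2 * b * \<sigma> n} \<le>
      b\<^sup>2 * (8 / (b * \<sigma> n) * I + 24 * K n / (b * \<sigma> n) + 256 * (K n)\<^sup>2 / (b * \<sigma> n)\<^sup>2 + 16 * (real n + 1) / (b * \<sigma> n)\<^sup>2 * T n)"
      by (intro mult_left_mono) (auto simp: mult.assoc)
    also have "\<dots> = 8 * b * (I / \<sigma> n) + \<delta> n"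
      using s b by (simp add: \<delta>_def s2[symmetric] power_mult_distrib power_divide power2_eq_square algebra_simps add_divide_distrib)
    finally show ?case using I by (simp only: \<sigma>_def)
  qed
  ultimately show ?thesis by blast
qed

end

section \<open>Asymptotic independence of blocks\<close>

text \<open>The Lipschitz condition in particular says that \<open>H\<close> depends only on its first \<open>m\<close> coordinates.\<close>

definition bdd_lip :: "nat \<Rightarrow> ((nat \<Rightarrow> real) \<Rightarrow> real) \<Rightarrow> real \<Rightarrow> real \<Rightarrow> bool" where
  "bdd_lip m H K B \<longleftrightarrow> 0 \<le> K \<and> (\<forall>y. \<bar>H y\<bar> \<le> B) \<and> (\<forall>y z. \<bar>H y - H z\<bar> \<le> K * (\<Sum>j<m. \<bar>y j - z j\<bar>))"

lemma bdd_lip_cong: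
  assumes "bdd_lip m H K B" "\<And>j. j < m \<Longrightarrow> y j = z j"
  shows "H y = H z"
proof -
  have "\<bar>H y - H z\<bar> \<le> K * (\<Sum>j<m. \<bar>y j - z j\<bar>)" using assms(1) by (simp add: bdd_lip_def)
  also have "(\<Sum>j<m. \<bar>y j - z j\<bar>) = 0" using assms(2) by simp
  finally show ?thesis by simp
qed

lemma bdd_lip_bound: "bdd_lip m H K B \<Longrightarrow> \<bar>H y\<bar> \<le> B"
  by (simp add: bdd_lip_def)

lemma bdd_lip_dist: "bdd_lip m H K B \<Longrightarrow> \<bar>H y - H z\<bar> \<le> K * (\<Sum>j<m. \<bar>y j - z j\<bar>)"
  by (simp add: bdd_lip_def)

lemma bdd_lip_nonneg: "bdd_lip m H K B \<Longrightarrow> 0 \<le> B"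
  using bdd_lip_bound[of m H K B undefined] by (meson abs_ge_zero order_trans)

text \<open>Finitely many coordinates enter, so the Lipschitz bound gives continuity for the product
  topology on sequences.\<close>

lemma bdd_lip_measurable:
  assumes H: "bdd_lip m H K B"
  shows "H \<in> borel_measurable borel"
proof (rule borel_measurable_continuous_onI, unfold continuous_on_eq_continuous_at[OF open_UNIV], intro ballI)
  fix y :: "nat \<Rightarrow> real"
  have c: "((\<lambda>z. z j) \<longlongrightarrow> y j) (at y)" for j
  proof -
    have "continuous_on UNIV (\<lambda>z :: nat \<Rightarrow> real. z j)" by (rule continuous_on_product_coordinates)
    then have "isCont (\<lambda>z :: nat \<Rightarrow> real. z j) y" by (simp only: continuous_on_eq_continuous_at[OF open_UNIV] UNIV_I)
    then show ?thesis by (simp add: isCont_def)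
  qed
  have "((\<lambda>z. H z - H y) \<longlongrightarrow> 0) (at y)"
  proof (rule Lim_null_comparison)
    show "eventually (\<lambda>z. norm (H z - H y) \<le> K * (\<Sum>j<m. \<bar>z j - y j\<bar>)) (at y)"
      using H by (simp add: bdd_lip_def)
    have "((\<lambda>z. K * (\<Sum>j<m. \<bar>z j - y j\<bar>)) \<longlongrightarrow> K * (\<Sum>j<m. \<bar>y j - y j\<bar>)) (at y)"
      by (intro tendsto_intros c)
    then show "((\<lambda>z. K * (\<Sum>j<m. \<bar>z j - y j\<bar>)) \<longlongrightarrow> 0) (at y)" by simp
  qed
  then show "isCont H y" by (simp add: isCont_def LIM_zero_iff)
qed

lemma bdd_lip_measurable_comp:
  assumes H: "bdd_lip m H K B" and Y: "\<And>j. Y j \<in> borel_measurable M"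
  shows "(\<lambda>w. H (\<lambda>j. Y j w)) \<in> borel_measurable M"
  by (rule measurable_compose[OF measurable_coordinatewise_then_product[OF Y] bdd_lip_measurable[OF H]])

lemma bdd_lip_fix_last:
  assumes H: "bdd_lip (Suc i) H K B"
  shows "bdd_lip i (\<lambda>u. H (u(i := a))) K B"
proof -
  have "\<bar>H (u(i := a)) - H (v(i := a))\<bar> \<le> K * (\<Sum>j<i. \<bar>u j - v j\<bar>)" for u v
  proof -
    have "\<bar>H (u(i := a)) - H (v(i := a))\<bar> \<le> K * (\<Sum>j<Suc i. \<bar>(u(i := a)) j - (v(i := a)) j\<bar>)"
      by (rule bdd_lip_dist[OF H])
    then show ?thesis by simp
  qed
  then show ?thesis using H by (simp add: bdd_lip_def)
qed

lemma bdd_lip_last: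
  assumes H: "bdd_lip (Suc i) H K B"
  shows "\<bar>H (u(i := a)) - H (u(i := b))\<bar> \<le> K * \<bar>a - b\<bar>"
proof -
  have "\<bar>H (u(i := a)) - H (u(i := b))\<bar> \<le> K * (\<Sum>j<Suc i. \<bar>(u(i := a)) j - (u(i := b)) j\<bar>)"
    by (rule bdd_lip_dist[OF H])
  then show ?thesis by simp
qed

lemma measurable_update_last:
  assumes H: "bdd_lip m H K B" and L: "L \<in> borel_measurable N"
  shows "(\<lambda>x. H (u(i := L x))) \<in> borel_measurable N"
proof -
  have "(\<lambda>x. H (\<lambda>j. if j = i then L x else u j)) \<in> borel_measurable N"
    by (rule bdd_lip_measurable_comp[OF H]) (use L in auto)
  then show ?thesis by (simp add: fun_upd_def)
qed

text \<open>Integrating out the last coordinate stays inside the class with the same constants; this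
  lets the induction in \<open>fdd\<close> remove one block at a time.\<close>

lemma (in prob_space) bdd_lip_integrate_last:
  assumes H: "bdd_lip (Suc i) H K B" and L: "L \<in> borel_measurable M"
  shows "bdd_lip i (\<lambda>u. \<integral>x. H (u(i := L x)) \<partial>M) K B"
proof -
  have int: "integrable M (\<lambda>x. H (u(i := L x)))" for u
    using bdd_lip_bound[OF H] by (intro integrable_const_bound[where B = B] measurable_update_last[OF H L]) auto
  have "\<bar>\<integral>x. H (u(i := L x)) \<partial>M\<bar> \<le> B" for u
  proof -
    have "\<bar>\<integral>x. H (u(i := L x)) \<partial>M\<bar> \<le> (\<integral>x. \<bar>H (u(i := L x))\<bar> \<partial>M)" by (rule integral_abs_bound)
    also have "\<dots> \<le> (\<integral>x. B \<partial>M)" using int bdd_lip_bound[OF H] by (intro integral_mono) auto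
    finally show ?thesis by (simp add: prob_space)
  qed
  moreover have "\<bar>(\<integral>x. H (u(i := L x)) \<partial>M) - (\<integral>x. H (v(i := L x)) \<partial>M)\<bar> \<le> K * (\<Sum>j<i. \<bar>u j - v j\<bar>)" for u v
  proof -
    have "\<bar>(\<integral>x. H (u(i := L x)) \<partial>M) - (\<integral>x. H (v(i := L x)) \<partial>M)\<bar> = \<bar>\<integral>x. H (u(i := L x)) - H (v(i := L x)) \<partial>M\<bar>"
      using int by simp
    also have "\<dots> \<le> (\<integral>x. \<bar>H (u(i := L x)) - H (v(i := L x))\<bar> \<partial>M)" by (rule integral_abs_bound)
    also have "\<dots> \<le> (\<integral>x. K * (\<Sum>j<i. \<bar>u j - v j\<bar>) \<partial>M)"
      using int bdd_lip_fix_last[OF H] by (intro integral_mono) (auto simp: bdd_lip_def)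
    finally show ?thesis by (simp add: prob_space)
  qed
  ultimately show ?thesis using H by (simp add: bdd_lip_def)
qed

section \<open>Hat functions and interpolation\<close>

definition ramp :: "real \<Rightarrow> real" where "ramp x = max 0 (min 1 x)"

text \<open>The tent of height 1 and half-width 1 centred at the integer p - P. Written as a
  difference of shifted ramps, the tents for p = 0, ..., 2 P have a telescoping sum, which equals 1
  on [-P, P].\<close>

definition hat :: "nat \<Rightarrow> nat \<Rightarrow> real \<Rightarrow> real" where
  "hat P p t = ramp (t + real P - real p + 1) - ramp (t + real P - real p)"

lemma hat_nonneg: "0 \<le> hat P p t" and hat_le_1: "hat P p t \<le> 1"
  by (auto simp: hat_def ramp_def)

lemma hat_support: "hat P p t \<noteq> 0 \<Longrightarrow> \<bar>t - (real p - real P)\<bar> \<le> 1"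
  by (auto simp: hat_def ramp_def max_def min_def split: if_splits)

lemma sum_hat: "(\<Sum>p\<le>2 * P. hat P p t) = ramp (t + real P + 1) - ramp (t - real P)"
proof -
  have "(\<Sum>p\<le>n. hat P p t) = ramp (t + real P + 1) - ramp (t + real P - real n)" for n
    by (induction n) (simp_all add: hat_def algebra_simps)
  from this[of "2 * P"] show ?thesis by (simp add: algebra_simps)
qed

lemma sum_hat_bounds: "0 \<le> (\<Sum>p\<le>2 * P. hat P p t)" "(\<Sum>p\<le>2 * P. hat P p t) \<le> 1"
  by (rule sum_nonneg, rule hat_nonneg) (auto simp: sum_hat ramp_def)

lemma sum_hat_eq_1: "\<bar>t\<bar> \<le> real P \<Longrightarrow> (\<Sum>p\<le>2 * P. hat P p t) = 1"
  by (auto simp: sum_hat ramp_def)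

lemma continuous_hat: "continuous_on UNIV (\<lambda>y. hat P p (y / \<delta>))"
proof (cases "\<delta> = 0")
  case False
  then show ?thesis unfolding hat_def ramp_def by (intro continuous_intros) auto
qed simp

lemma measurable_hat [measurable]: "(\<lambda>y. hat P p (y / \<delta>)) \<in> borel_measurable borel"
  by (rule borel_measurable_continuous_onI[OF continuous_hat])

text \<open>A tent of nonzero weight has its node within \<delta> of y, where the Lipschitz
  condition gives K \<delta>; the weight missing from a full partition of unity is charged at the
  bound B.\<close>

lemma hat_interpolation:
  assumes H: "bdd_lip (Suc i) H K B" and \<delta>: "\<delta> > 0"
  shows "\<bar>H (u(i := y)) - (\<Sum>p\<le>2 * P. H (u(i := \<delta> * (real p - real P))) * hat P p (y / \<delta>))\<bar>
    \<le> K * \<delta> + B * (1 - (\<Sum>p\<le>2 * P. hat P p (y / \<delta>)))"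
proof -
  define q where "q = (\<Sum>p\<le>2 * P. hat P p (y / \<delta>))"
  have q: "0 \<le> q" "q \<le> 1" unfolding q_def by (rule sum_hat_bounds)+
  have K: "K \<ge> 0" using H by (simp add: bdd_lip_def)
  define h where "h p = H (u(i := \<delta> * (real p - real P)))" for p
  define t where "t p = hat P p (y / \<delta>)" for p
  have t0: "0 \<le> t p" for p unfolding t_def by (rule hat_nonneg)
  have eq: "H (u(i := y)) - (\<Sum>p\<le>2 * P. h p * t p) = (\<Sum>p\<le>2 * P. (H (u(i := y)) - h p) * t p) + H (u(i := y)) * (1 - (\<Sum>p\<le>2 * P. t p))"
    by (simp add: left_diff_distrib sum_subtractf sum_distrib_left right_diff_distrib)
  have 1: "\<bar>H (u(i := y)) * (1 - q)\<bar> \<le> B * (1 - q)"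
    using q bdd_lip_bound[OF H] by (simp add: abs_mult mult_right_mono)
  have "\<bar>(H (u(i := y)) - h p) * t p\<bar> \<le> (K * \<delta>) * t p" for p
  proof (cases "t p = 0")
    case False
    have "\<bar>y / \<delta> - (real p - real P)\<bar> * \<delta> \<le> 1 * \<delta>"
      using hat_support[of P p "y / \<delta>"] False \<delta> by (intro mult_right_mono) (auto simp: t_def)
    moreover have "\<bar>y / \<delta> - (real p - real P)\<bar> * \<delta> = \<bar>(y / \<delta> - (real p - real P)) * \<delta>\<bar>"
      using \<delta> by (simp add: abs_mult)
    moreover have "(y / \<delta> - (real p - real P)) * \<delta> = y - \<delta> * (real p - real P)"
      using \<delta> by (simp add: field_simps)
    ultimately have *: "\<bar>y - \<delta> * (real p - real P)\<bar> \<le> \<delta>" by simp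
    have "\<bar>H (u(i := y)) - h p\<bar> \<le> K * \<delta>"
      unfolding h_def by (rule order_trans[OF bdd_lip_last[OF H] mult_left_mono[OF * K]])
    then show ?thesis using t0[of p] by (simp add: abs_mult mult_right_mono)
  qed simp
  then have "\<bar>\<Sum>p\<le>2 * P. (H (u(i := y)) - h p) * t p\<bar> \<le> (\<Sum>p\<le>2 * P. (K * \<delta>) * t p)"
    by (intro order_trans[OF sum_abs sum_mono])
  moreover have "(\<Sum>p\<le>2 * P. (K * \<delta>) * t p) = (K * \<delta>) * q" by (simp add: q_def t_def sum_distrib_left)
  moreover have "(K * \<delta>) * q \<le> K * \<delta>" using q K \<delta> mult_left_mono[of q 1 "K * \<delta>"] by simp
  ultimately have 2: "\<bar>\<Sum>p\<le>2 * P. (H (u(i := y)) - h p) * t p\<bar> \<le> K * \<delta>" by simp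
  have q': "q = (\<Sum>p\<le>2 * P. t p)" by (simp add: q_def t_def)
  have "\<bar>H (u(i := y)) - (\<Sum>p\<le>2 * P. h p * t p)\<bar> \<le> K * \<delta> + B * (1 - q)"
    unfolding eq q'[symmetric] by (rule order_trans[OF abs_triangle_ineq add_mono[OF 2 1]])
  then show ?thesis unfolding h_def t_def q_def .
qed

text \<open>\<open>H\<close> is approximated by sums of products of a function of the first \<open>i\<close> coordinates and a hat function of the
  last one, which reduces the claim to test functions of the form assumed in \<open>key\<close>.\<close>

lemma replace_last_coordinate:
  fixes Y :: "nat \<Rightarrow> 'a \<Rightarrow> real" and U :: "nat \<Rightarrow> nat \<Rightarrow> 'a \<Rightarrow> real"
  assumes M: "prob_space M" and N: "prob_space N" and L [measurable]: "L \<in> borel_measurable N"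
    and H: "bdd_lip (Suc i) H K B"
    and Y [measurable]: "\<And>n. Y n \<in> borel_measurable M" and U [measurable]: "\<And>n j. U n j \<in> borel_measurable M"
    and key: "\<And>G K' B' g. bdd_lip i G K' B' \<Longrightarrow> continuous_on UNIV g \<Longrightarrow> bounded (range g) \<Longrightarrow>
      (\<lambda>n. (\<integral>w. G (\<lambda>j. U n j w) * g (Y n w) \<partial>M) - (\<integral>w. G (\<lambda>j. U n j w) \<partial>M) * (\<integral>x. g (L x) \<partial>N)) \<longlonglongrightarrow> 0"
  shows "(\<lambda>n. (\<integral>w. H ((\<lambda>j. U n j w)(i := Y n w)) \<partial>M) - (\<integral>w. (\<integral>x. H ((\<lambda>j. U n j w)(i := L x)) \<partial>N) \<partial>M)) \<longlonglongrightarrow> 0"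
    (is "?D \<longlonglongrightarrow> 0")
proof -
  interpret M: prob_space M by fact
  interpret N: prob_space N by fact
  have B0: "0 \<le> B" by (rule bdd_lip_nonneg[OF H])
  have K0: "0 \<le> K" using H by (simp add: bdd_lip_def)
  have Hm [measurable]: "(\<lambda>w. H ((\<lambda>j. U n j w)(i := Y n w))) \<in> borel_measurable M" for n
  proof -
    have "(\<lambda>w. H (\<lambda>j. if j = i then Y n w else U n j w)) \<in> borel_measurable M"
      by (rule bdd_lip_measurable_comp[OF H]) auto
    then show ?thesis by (simp add: fun_upd_def)
  qed
  have Him [measurable]: "(\<lambda>w. \<integral>x. H ((\<lambda>j. U n j w)(i := L x)) \<partial>N) \<in> borel_measurable M" for n
    by (rule bdd_lip_measurable_comp[OF N.bdd_lip_integrate_last[OF H L]]) (rule U)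
  have Ham [measurable]: "(\<lambda>w. H ((\<lambda>j. U n j w)(i := a))) \<in> borel_measurable M" for n a
    by (rule bdd_lip_measurable_comp[OF bdd_lip_fix_last[OF H]]) (rule U)
  have approx: "eventually (\<lambda>n. \<bar>?D n\<bar> \<le> 2 * K * \<delta> + 3 * B * \<delta> + \<delta>) sequentially" if \<delta>: "\<delta> > 0" for \<delta>
  proof -
    define q where "q P y = (\<Sum>p\<le>2 * P. hat P p (y / \<delta>))" for P y
    have q01: "0 \<le> q P y" "q P y \<le> 1" for P y unfolding q_def by (rule sum_hat_bounds)+
    have qc: "continuous_on UNIV (q P)" for P unfolding q_def[abs_def] by (intro continuous_on_sum continuous_hat)
    have [measurable]: "q P \<in> borel_measurable borel" for P by (rule borel_measurable_continuous_onI[OF qc])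
    \<comment> \<open>The mean weight that L places outside the tents vanishes as P grows; P is then
      fixed so that less than \<delta> is missed.\<close>
    have "(\<lambda>P. \<integral>x. 1 - q P (L x) \<partial>N) \<longlonglongrightarrow> (\<integral>x. 0 \<partial>N)"
    proof (rule integral_dominated_convergence[where w = "\<lambda>_. 1"])
      show "AE x in N. (\<lambda>P. 1 - q P (L x)) \<longlonglongrightarrow> 0"
      proof (intro AE_I2 tendsto_eventually)
        fix x
        obtain P0 :: nat where P0: "\<bar>L x / \<delta>\<bar> \<le> real P0" using real_arch_simple by blast
        show "eventually (\<lambda>P. 1 - q P (L x) = 0) sequentially"
          using eventually_ge_at_top[of P0]
        proof eventually_elim
          case (elim P)
          then have "\<bar>L x / \<delta>\<bar> \<le> real P" using P0 by linarith
          then show ?case using sum_hat_eq_1 by (simp add: q_def)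
        qed
      qed
    qed (use q01 in \<open>auto simp: abs_le_iff\<close>)
    then have "eventually (\<lambda>P. (\<integral>x. 1 - q P (L x) \<partial>N) < \<delta>) sequentially"
      using order_tendstoD(2)[of _ "\<integral>x. 0 \<partial>N" sequentially \<delta>] \<delta> by simp
    then obtain P where P: "(\<integral>x. 1 - q P (L x) \<partial>N) < \<delta>" by (auto simp: eventually_sequentially)
    define a where "a p = \<delta> * (real p - real P)" for p
    define e where "e p = (\<integral>x. hat P p (L x / \<delta>) \<partial>N)" for p
    define A where "A n p = (\<integral>w. H ((\<lambda>j. U n j w)(i := a p)) * hat P p (Y n w / \<delta>) \<partial>M)" for n p
    define C where "C n p = (\<integral>w. H ((\<lambda>j. U n j w)(i := a p)) \<partial>M)" for n p
    have bd_hat: "bounded (range (\<lambda>y. hat P p (y / \<delta>)))" for p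
    proof (rule boundedI[of _ 1])
      fix z assume "z \<in> range (\<lambda>y. hat P p (y / \<delta>))"
      then obtain y where "z = hat P p (y / \<delta>)" by auto
      then show "norm z \<le> 1" using hat_nonneg[of P p "y / \<delta>"] hat_le_1[of P p "y / \<delta>"] by simp
    qed
    have AC: "(\<lambda>n. \<Sum>p\<le>2 * P. A n p - C n p * e p) \<longlonglongrightarrow> (\<Sum>p\<le>2 * P. 0)"
      unfolding A_def C_def e_def
      by (intro tendsto_sum key[OF bdd_lip_fix_last[OF H] continuous_hat bd_hat])
    have bd_q: "bounded (range (\<lambda>y. 1 - q P y))"
    proof (rule boundedI[of _ 1])
      fix z assume "z \<in> range (\<lambda>y. 1 - q P y)"
      then obtain y where "z = 1 - q P y" by auto
      then show "norm z \<le> 1" using q01[of P y] by simp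
    qed
    \<comment> \<open>With \<open>G\<close> constant 1, \<open>key\<close> is convergence of the
      expectations of g; it carries the small missed weight over from L to \<open>Y n\<close>, with
      the bound 2 \<delta>.\<close>
    have "bdd_lip i (\<lambda>_. 1) 0 1" by (simp add: bdd_lip_def)
    from key[OF this _ bd_q] qc have "(\<lambda>n. (\<integral>w. 1 - q P (Y n w) \<partial>M) - (\<integral>x. 1 - q P (L x) \<partial>N)) \<longlonglongrightarrow> 0"
      by (simp add: continuous_on_diff M.prob_space)
    then have "eventually (\<lambda>n. (\<integral>w. 1 - q P (Y n w) \<partial>M) - (\<integral>x. 1 - q P (L x) \<partial>N) < \<delta>) sequentially"
      by (rule order_tendstoD(2)) (rule \<delta>)
    moreover have "eventually (\<lambda>n. \<bar>\<Sum>p\<le>2 * P. A n p - C n p * e p\<bar> < \<delta>) sequentially"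
      using tendstoD[OF AC \<delta>] by (simp add: dist_real_def)
    ultimately show ?thesis
    proof eventually_elim
      case (elim n)
      have intH: "integrable M (\<lambda>w. H ((\<lambda>j. U n j w)(i := Y n w)))"
        using bdd_lip_bound[OF H] by (intro M.integrable_const_bound[where B = B]) auto
      have intA: "integrable M (\<lambda>w. H ((\<lambda>j. U n j w)(i := a p)) * hat P p (Y n w / \<delta>))" for p
      proof (rule M.integrable_const_bound[where B = B])
        show "AE w in M. norm (H ((\<lambda>j. U n j w)(i := a p)) * hat P p (Y n w / \<delta>)) \<le> B"
        proof (intro AE_I2)
          fix w
          have "\<bar>H ((\<lambda>j. U n j w)(i := a p))\<bar> * \<bar>hat P p (Y n w / \<delta>)\<bar> \<le> B * 1"
            using bdd_lip_bound[OF H] hat_nonneg[of P p] hat_le_1[of P p] B0 by (intro mult_mono) auto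
          then show "norm (H ((\<lambda>j. U n j w)(i := a p)) * hat P p (Y n w / \<delta>)) \<le> B" by (simp add: abs_mult)
        qed
      qed measurable
      have intC: "integrable M (\<lambda>w. H ((\<lambda>j. U n j w)(i := a p)))" for p
        using bdd_lip_bound[OF H] by (intro M.integrable_const_bound[where B = B]) auto
      have intq: "integrable M (\<lambda>w. 1 - q P (Y n w))"
        using q01 by (intro M.integrable_const_bound[where B = 1]) (auto simp: abs_le_iff)
      have intHi: "integrable M (\<lambda>w. \<integral>x. H ((\<lambda>j. U n j w)(i := L x)) \<partial>N)"
        using bdd_lip_bound[OF N.bdd_lip_integrate_last[OF H L]]
        by (intro M.integrable_const_bound[where B = B]) auto
      have 1: "\<bar>(\<integral>w. H ((\<lambda>j. U n j w)(i := Y n w)) \<partial>M) - (\<Sum>p\<le>2 * P. A n p)\<bar> \<le> K * \<delta> + B * (2 * \<delta>)"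
      proof -
        have eq: "(\<integral>w. H ((\<lambda>j. U n j w)(i := Y n w)) \<partial>M) - (\<Sum>p\<le>2 * P. A n p) =
            (\<integral>w. H ((\<lambda>j. U n j w)(i := Y n w)) - (\<Sum>p\<le>2 * P. H ((\<lambda>j. U n j w)(i := a p)) * hat P p (Y n w / \<delta>)) \<partial>M)"
          unfolding A_def using intA intH by simp
        have "\<bar>(\<integral>w. H ((\<lambda>j. U n j w)(i := Y n w)) \<partial>M) - (\<Sum>p\<le>2 * P. A n p)\<bar> \<le> (\<integral>w. \<bar>H ((\<lambda>j. U n j w)(i := Y n w)) - (\<Sum>p\<le>2 * P. H ((\<lambda>j. U n j w)(i := a p)) * hat P p (Y n w / \<delta>))\<bar> \<partial>M)"
          unfolding eq by (rule integral_abs_bound)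
        also have "\<dots> \<le> (\<integral>w. K * \<delta> + B * (1 - q P (Y n w)) \<partial>M)"
        proof (rule integral_mono)
          show "integrable M (\<lambda>w. \<bar>H ((\<lambda>j. U n j w)(i := Y n w)) - (\<Sum>p\<le>2 * P. H ((\<lambda>j. U n j w)(i := a p)) * hat P p (Y n w / \<delta>))\<bar>)"
            by (intro integrable_abs Bochner_Integration.integrable_diff Bochner_Integration.integrable_sum intA intH)
          show "integrable M (\<lambda>w. K * \<delta> + B * (1 - q P (Y n w)))"
            by (intro Bochner_Integration.integrable_add integrable_mult_right intq) simp
        qed (unfold q_def a_def, rule hat_interpolation[OF H \<delta>])
        also have "\<dots> = K * \<delta> + B * (\<integral>w. 1 - q P (Y n w) \<partial>M)"
          using intq by (subst Bochner_Integration.integral_add) (auto simp: M.prob_space)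
        also have "\<dots> \<le> K * \<delta> + B * (2 * \<delta>)"
          using elim(1) P B0 by (intro add_left_mono mult_left_mono) auto
        finally show ?thesis .
      qed
      have 2: "\<bar>(\<integral>w. (\<integral>x. H ((\<lambda>j. U n j w)(i := L x)) \<partial>N) \<partial>M) - (\<Sum>p\<le>2 * P. C n p * e p)\<bar> \<le> K * \<delta> + B * \<delta>"
      proof -
        have pt: "\<bar>(\<integral>x. H (u(i := L x)) \<partial>N) - (\<Sum>p\<le>2 * P. H (u(i := a p)) * e p)\<bar> \<le> K * \<delta> + B * \<delta>" for u
        proof -
          have i1: "integrable N (\<lambda>x. H (u(i := L x)))"
            using bdd_lip_bound[OF H] by (intro N.integrable_const_bound[where B = B] measurable_update_last[OF H L]) auto
          have i2: "integrable N (\<lambda>x. H (u(i := a p)) * hat P p (L x / \<delta>))" for p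
            by (intro integrable_mult_right N.integrable_const_bound[where B = 1])
               (auto simp: hat_le_1 hat_nonneg abs_of_nonneg)
          have i3: "integrable N (\<lambda>x. 1 - q P (L x))"
            using q01 by (intro N.integrable_const_bound[where B = 1]) (auto simp: abs_le_iff)
          have eq: "(\<integral>x. H (u(i := L x)) \<partial>N) - (\<Sum>p\<le>2 * P. H (u(i := a p)) * e p) =
              (\<integral>x. H (u(i := L x)) - (\<Sum>p\<le>2 * P. H (u(i := a p)) * hat P p (L x / \<delta>)) \<partial>N)"
            unfolding e_def using i1 i2
            by (subst Bochner_Integration.integral_diff) (auto simp: Bochner_Integration.integral_sum)
          have "\<bar>(\<integral>x. H (u(i := L x)) \<partial>N) - (\<Sum>p\<le>2 * P. H (u(i := a p)) * e p)\<bar> \<le> (\<integral>x. \<bar>H (u(i := L x)) - (\<Sum>p\<le>2 * P. H (u(i := a p)) * hat P p (L x / \<delta>))\<bar> \<partial>N)"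
            unfolding eq by (rule integral_abs_bound)
          also have "\<dots> \<le> (\<integral>x. K * \<delta> + B * (1 - q P (L x)) \<partial>N)"
          proof (rule integral_mono)
            show "integrable N (\<lambda>x. \<bar>H (u(i := L x)) - (\<Sum>p\<le>2 * P. H (u(i := a p)) * hat P p (L x / \<delta>))\<bar>)"
              by (intro integrable_abs Bochner_Integration.integrable_diff Bochner_Integration.integrable_sum i1 i2)
            show "integrable N (\<lambda>x. K * \<delta> + B * (1 - q P (L x)))"
              by (intro Bochner_Integration.integrable_add integrable_mult_right i3) simp
          qed (unfold q_def a_def, rule hat_interpolation[OF H \<delta>])
          also have "\<dots> = K * \<delta> + B * (\<integral>x. 1 - q P (L x) \<partial>N)"
            using i3 by (subst Bochner_Integration.integral_add) (auto simp: N.prob_space)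
          also have "\<dots> \<le> K * \<delta> + B * \<delta>"
            using P B0 by (intro add_left_mono mult_left_mono) auto
          finally show ?thesis .
        qed
        have eq: "(\<integral>w. (\<integral>x. H ((\<lambda>j. U n j w)(i := L x)) \<partial>N) \<partial>M) - (\<Sum>p\<le>2 * P. C n p * e p) =
            (\<integral>w. (\<integral>x. H ((\<lambda>j. U n j w)(i := L x)) \<partial>N) - (\<Sum>p\<le>2 * P. H ((\<lambda>j. U n j w)(i := a p)) * e p) \<partial>M)"
          unfolding C_def using intHi intC
          by (subst Bochner_Integration.integral_diff) (auto simp: Bochner_Integration.integral_sum)
        have "\<bar>(\<integral>w. (\<integral>x. H ((\<lambda>j. U n j w)(i := L x)) \<partial>N) \<partial>M) - (\<Sum>p\<le>2 * P. C n p * e p)\<bar> \<le> (\<integral>w. \<bar>(\<integral>x. H ((\<lambda>j. U n j w)(i := L x)) \<partial>N) - (\<Sum>p\<le>2 * P. H ((\<lambda>j. U n j w)(i := a p)) * e p)\<bar> \<partial>M)"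
          unfolding eq by (rule integral_abs_bound)
        also have "\<dots> \<le> (\<integral>w. K * \<delta> + B * \<delta> \<partial>M)"
        proof (rule integral_mono)
          show "integrable M (\<lambda>w. \<bar>(\<integral>x. H ((\<lambda>j. U n j w)(i := L x)) \<partial>N) - (\<Sum>p\<le>2 * P. H ((\<lambda>j. U n j w)(i := a p)) * e p)\<bar>)"
            by (intro integrable_abs Bochner_Integration.integrable_diff Bochner_Integration.integrable_sum integrable_mult_left intHi intC)
        qed (use pt in auto)
        finally show ?thesis by (simp add: M.prob_space)
      qed
      have 3: "\<bar>(\<Sum>p\<le>2 * P. A n p) - (\<Sum>p\<le>2 * P. C n p * e p)\<bar> < \<delta>"
        using elim(2) by (simp add: sum_subtractf)
      have tri: "\<bar>x - a\<bar> \<le> k1 \<Longrightarrow> \<bar>y - b\<bar> \<le> k2 \<Longrightarrow> \<bar>a - b\<bar> < d \<Longrightarrow> \<bar>x - y\<bar> \<le> k1 + k2 + d" for x y a b k1 k2 d :: real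
        by linarith
      show ?case using tri[OF 1 2 3] by (simp add: algebra_simps)
    qed
  qed
  show ?thesis
  proof (rule tendstoI)
    fix r :: real assume r: "r > 0"
    define c where "c = 2 * K + 3 * B + 1"
    define \<delta> where "\<delta> = r / (2 * c)"
    have pos: "c > 0" unfolding c_def using K0 B0 by simp
    have \<delta>: "\<delta> > 0" unfolding \<delta>_def using r pos by simp
    have eq: "2 * K * \<delta> + 3 * B * \<delta> + \<delta> = r / 2"
    proof -
      have "2 * K * \<delta> + 3 * B * \<delta> + \<delta> = c * \<delta>" by (simp add: c_def algebra_simps)
      also have "c * \<delta> = r / 2" unfolding \<delta>_def using pos by simp
      finally show ?thesis .
    qed
    show "eventually (\<lambda>n. dist (?D n) 0 < r) sequentially"
      using approx[OF \<delta>] unfolding eq by eventually_elim (use r in simp)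
  qed
qed

text \<open>Fubini for \<open>Z i\<close> and the coordinates before it. Both are padded with zeros
  to full sequences, so that independence yields a product law on two copies of the sequence space,
  where \<open>H\<close> is measurable; the padding is invisible to \<open>H\<close>, which sees
  only the first \<open>Suc i\<close> coordinates.\<close>

lemma (in prob_space) indep_integrate_last:
  fixes Z :: "nat \<Rightarrow> 'a \<Rightarrow> real"
  assumes ind: "indep_vars (\<lambda>_. borel) Z {..<m}" and i: "i < m" and Z [measurable]: "\<And>j. Z j \<in> borel_measurable M"
    and law: "distr M borel (Z i) = distr N borel L" and L [measurable]: "L \<in> borel_measurable N"
    and H: "bdd_lip (Suc i) H K B"
  shows "(\<integral>w. H (\<lambda>j. Z j w) \<partial>M) = (\<integral>w. (\<integral>x. H ((\<lambda>j. Z j w)(i := L x)) \<partial>N) \<partial>M)"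
proof -
  define X where "X w = (\<lambda>j. if j < i then Z j w else 0)" for w
  define X' where "X' w = (\<lambda>j. if j = i then Z i w else 0)" for w
  have "indep_var (PiM {..<i} (\<lambda>_. borel)) (\<lambda>w. restrict (\<lambda>j. Z j w) {..<i}) (PiM {i} (\<lambda>_. borel)) (\<lambda>w. restrict (\<lambda>j. Z j w) {i})"
    by (rule indep_var_restrict[OF ind]) (use i in auto)
  then have "indep_var borel ((\<lambda>r j. if j < i then r j else 0) \<circ> (\<lambda>w. restrict (\<lambda>j. Z j w) {..<i}))
    borel ((\<lambda>r j. if j = i then r i else 0) \<circ> (\<lambda>w. restrict (\<lambda>j. Z j w) {i}))"
  proof (rule indep_var_compose)
    show "(\<lambda>r j. if j < i then r j else 0) \<in> PiM {..<i} (\<lambda>_. borel) \<rightarrow>\<^sub>M (borel :: (nat \<Rightarrow> real) measure)"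
    proof (rule measurable_coordinatewise_then_product)
      fix j show "(\<lambda>r. if j < i then r j else 0 :: real) \<in> borel_measurable (PiM {..<i} (\<lambda>_. borel))"
        by (cases "j < i") auto
    qed
    show "(\<lambda>r j. if j = i then r i else 0) \<in> PiM {i} (\<lambda>_. borel) \<rightarrow>\<^sub>M (borel :: (nat \<Rightarrow> real) measure)"
    proof (rule measurable_coordinatewise_then_product)
      fix j show "(\<lambda>r. if j = i then r i else 0 :: real) \<in> borel_measurable (PiM {i} (\<lambda>_. borel))"
        by (cases "j = i") auto
    qed
  qed
  moreover have "(\<lambda>r j. if j < i then r j else 0) \<circ> (\<lambda>w. restrict (\<lambda>j. Z j w) {..<i}) = X"
    by (auto simp: X_def fun_eq_iff)
  moreover have "(\<lambda>r j. if j = i then r i else 0) \<circ> (\<lambda>w. restrict (\<lambda>j. Z j w) {i}) = X'"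
    by (auto simp: X'_def fun_eq_iff)
  ultimately have indep: "indep_var borel X borel X'" by simp
  then have Xm [measurable]: "X \<in> borel_measurable M" "X' \<in> borel_measurable M"
    by (simp_all add: indep_var_distribution_eq)
  have pd: "distr M borel X \<Otimes>\<^sub>M distr M borel X' = distr M (borel \<Otimes>\<^sub>M borel) (\<lambda>w. (X w, X' w))"
    using indep by (simp add: indep_var_distribution_eq)
  have upd [measurable]: "(\<lambda>p. H ((fst p)(i := snd p i))) \<in> borel_measurable (borel \<Otimes>\<^sub>M borel)"
  proof -
    have "(\<lambda>p. H (\<lambda>j. if j = i then snd p i else fst p j)) \<in> borel_measurable (borel \<Otimes>\<^sub>M borel)"
    proof (rule bdd_lip_measurable_comp[OF H])
      fix j show "(\<lambda>p. if j = i then snd p i else fst p j) \<in> borel_measurable (borel \<Otimes>\<^sub>M borel)"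
        by (cases "j = i")
          (auto intro: measurable_compose[OF measurable_fst measurable_product_coordinates]
            measurable_compose[OF measurable_snd measurable_product_coordinates])
    qed
    then show ?thesis by (simp add: fun_upd_def)
  qed
  interpret DX: prob_space "distr M borel X" by (rule prob_space_distr) simp
  interpret DZ: prob_space "distr M borel X'" by (rule prob_space_distr) simp
  interpret P: pair_prob_space "distr M borel X" "distr M borel X'" ..
  have "(\<integral>w. H (\<lambda>j. Z j w) \<partial>M) = (\<integral>w. H ((X w)(i := X' w i)) \<partial>M)"
    by (intro Bochner_Integration.integral_cong bdd_lip_cong[OF H]) (auto simp: X_def X'_def)
  also have "\<dots> = (\<integral>p. H ((fst p)(i := snd p i)) \<partial>distr M (borel \<Otimes>\<^sub>M borel) (\<lambda>w. (X w, X' w)))"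
    by (subst integral_distr) auto
  also have "\<dots> = (\<integral>p. H ((fst p)(i := snd p i)) \<partial>(distr M borel X \<Otimes>\<^sub>M distr M borel X'))"
    unfolding pd ..
  also have "\<dots> = (\<integral>u. (\<integral>v. H (u(i := v i)) \<partial>distr M borel X') \<partial>distr M borel X)"
  proof -
    have "integrable (distr M borel X \<Otimes>\<^sub>M distr M borel X') (\<lambda>p. H ((fst p)(i := snd p i)))"
      using bdd_lip_bound[OF H] by (intro P.integrable_const_bound[where B = B]) auto
    from P.integral_fst'[OF this] show ?thesis by simp
  qed
  also have "\<dots> = (\<integral>u. (\<integral>x. H (u(i := L x)) \<partial>N) \<partial>distr M borel X)"
  proof -
    have "(\<integral>v. H (u(i := v i)) \<partial>distr M borel X') = (\<integral>x. H (u(i := L x)) \<partial>N)" for u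
    proof -
      have um: "(\<lambda>z. H (u(i := z))) \<in> borel_measurable borel"
        by (rule measurable_update_last[OF H]) simp
      have "(\<integral>v. H (u(i := v i)) \<partial>distr M borel X') = (\<integral>w. H (u(i := X' w i)) \<partial>M)"
        by (rule integral_distr[OF Xm(2)]) (rule measurable_compose[OF measurable_product_coordinates um])
      also have "\<dots> = (\<integral>z. H (u(i := z)) \<partial>distr M borel (Z i))"
        by (subst integral_distr[OF Z um]) (simp add: X'_def)
      also have "\<dots> = (\<integral>x. H (u(i := L x)) \<partial>N)"
        unfolding law by (rule integral_distr[OF L um])
      finally show ?thesis .
    qed
    then show ?thesis by simp
  qed
  also have "\<dots> = (\<integral>w. (\<integral>x. H ((X w)(i := L x)) \<partial>N) \<partial>M)"
  proof (subst integral_distr)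
    interpret DL: prob_space "distr N borel L" unfolding law[symmetric] by (rule prob_space_distr) simp
    have "bdd_lip i (\<lambda>u. \<integral>x. H (u(i := x)) \<partial>distr N borel L) K B"
      by (rule DL.bdd_lip_integrate_last[OF H, of "\<lambda>x. x"]) simp
    moreover have "(\<integral>x. H (u(i := x)) \<partial>distr N borel L) = (\<integral>x. H (u(i := L x)) \<partial>N)" for u
      by (rule integral_distr[OF L measurable_update_last[OF H]]) simp
    ultimately have "bdd_lip i (\<lambda>u. \<integral>x. H (u(i := L x)) \<partial>N) K B" by simp
    then show "(\<lambda>u. \<integral>x. H (u(i := L x)) \<partial>N) \<in> borel_measurable borel" by (rule bdd_lip_measurable)
  qed auto
  also have "\<dots> = (\<integral>w. (\<integral>x. H ((\<lambda>j. Z j w)(i := L x)) \<partial>N) \<partial>M)"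
    by (intro Bochner_Integration.integral_cong bdd_lip_cong[OF H] refl) (auto simp: X_def)
  finally show ?thesis .
qed

text \<open>Slow variation is recorded as the limit of \<open>var (m * n) / var n\<close> for fixed
  m, the form in which a sum is compared with its m blocks of equal length.\<close>

locale cond_clt = reversible_markov_functional M S \<xi> \<pi> Q f
  for M :: "'w measure" and S :: "'s measure" and \<xi> :: "int \<Rightarrow> 'w \<Rightarrow> 's"
    and \<pi> :: "'s measure" and Q :: "'s \<Rightarrow> 's measure" and f :: "'s \<Rightarrow> real" +
  fixes N :: "'l measure" and L :: "'l \<Rightarrow> real"
  assumes ratio: "\<And>m. m > 0 \<Longrightarrow> (\<lambda>n. var (m * n) / var n) \<longlonglongrightarrow> real m"
    and inf: "filterlim var at_top sequentially"
    and N: "prob_space N" and L [measurable]: "L \<in> borel_measurable N"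
    and cond_conv: "\<And>(g :: real \<Rightarrow> real) \<epsilon>. continuous_on UNIV g \<Longrightarrow> bounded (range g) \<Longrightarrow> \<epsilon> > 0 \<Longrightarrow>
      (\<lambda>n. prob {w\<in>space M. \<bar>real_cond_exp M (past_sigma M S \<xi> 0) (\<lambda>w. g (bsum 0 n (\<lambda>i. \<xi> i w) / sqrt (var n))) w
          - (\<integral>x. g (L x) \<partial>N)\<bar> > \<epsilon>}) \<longlonglongrightarrow> 0"
begin

sublocale N: prob_space N by (rule N)

section \<open>Consequences of the conditional convergence\<close>

definition sd :: "nat \<Rightarrow> real" where "sd n = sqrt (var n)"

definition nsum :: "int \<Rightarrow> nat \<Rightarrow> 'w \<Rightarrow> real" where
  "nsum a n w = bsum a n (path w) / sd n"

lemma measurable_nsum [measurable]: "nsum a n \<in> borel_measurable M"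
  unfolding nsum_def[abs_def] by measurable

lemma sd_pos: "eventually (\<lambda>n. sd n > 0) sequentially"
  using inf by (simp add: sd_def filterlim_at_top_dense)

lemma sd_nonneg: "0 \<le> sd n" by (simp add: sd_def var_nonneg)

lemma sd_sq: "(sd n)\<^sup>2 = var n" by (simp add: sd_def var_nonneg)

lemma L2_nsum: "L2 M (nsum a n)"
  unfolding nsum_def[abs_def] by (intro L2_divide L2_bsum)

text \<open>Equality holds unless \<open>sd n = 0\<close>, where division yields 0.\<close>

lemma nsum_sq_le: "(\<integral>w. (nsum a n w)\<^sup>2 \<partial>M) \<le> 1"
  by (simp add: nsum_def power_divide integral_bsum_sq sd_sq)

lemma nsum_L1_le: "(\<integral>w. \<bar>nsum a n w\<bar> \<partial>M) \<le> 1"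
proof -
  have "(L2norm M (nsum a n))\<^sup>2 \<le> 1\<^sup>2" by (simp add: L2norm_sq nsum_sq_le)
  then have "L2norm M (nsum a n) \<le> 1" by (rule power2_le_imp_le) simp
  then show ?thesis using L1_le_L2norm[OF L2_nsum, of a n] by simp
qed

text \<open>The conditional expectations inherit the bound of g, so convergence in probability
  upgrades to convergence in mean.\<close>

lemma cond_exp_L1:
  fixes g :: "real \<Rightarrow> real"
  assumes g: "continuous_on UNIV g" and b: "bounded (range g)"
  shows "(\<lambda>n. \<integral>w. \<bar>real_cond_exp M (past 0) (\<lambda>w. g (nsum 0 n w)) w - (\<integral>x. g (L x) \<partial>N)\<bar> \<partial>M) \<longlonglongrightarrow> 0"
proof -
  interpret F: sigma_finite_subalgebra M "past 0" by (rule sigma_finite_past)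
  have [measurable]: "g \<in> borel_measurable borel" by (rule borel_measurable_continuous_onI[OF g])
  obtain G where G: "\<And>y. \<bar>g y\<bar> \<le> G" using b by (auto simp: bounded_iff)
  have G0: "0 \<le> G" using G[of 0] by simp
  define c where "c = (\<integral>x. g (L x) \<partial>N)"
  define e where "e n = real_cond_exp M (past 0) (\<lambda>w. g (nsum 0 n w))" for n
  have [measurable]: "e n \<in> borel_measurable M" for n unfolding e_def by simp
  have intg: "integrable M (\<lambda>w. g (nsum 0 n w))" for n
    using G by (intro integrable_const_bound[where B = G]) auto
  have cG: "\<bar>c\<bar> \<le> G"
  proof -
    have i: "integrable N (\<lambda>x. \<bar>g (L x)\<bar>)"
      using G by (intro N.integrable_const_bound[where B = G]) auto
    have "\<bar>c\<bar> \<le> (\<integral>x. \<bar>g (L x)\<bar> \<partial>N)" unfolding c_def by (rule integral_abs_bound)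
    also have "\<dots> \<le> (\<integral>x. G \<partial>N)" by (rule integral_mono[OF i]) (use G in auto)
    finally show ?thesis by (simp add: N.prob_space)
  qed
  have eG: "AE w in M. \<bar>e n w\<bar> \<le> G" for n
  proof -
    have "AE w in M. e n w \<ge> -G"
      unfolding e_def by (rule F.real_cond_exp_ge_c[OF intg]) (use G in \<open>auto simp: abs_le_iff minus_le_iff\<close>)
    moreover have "AE w in M. e n w \<le> G"
      unfolding e_def by (rule F.real_cond_exp_le_c[OF intg]) (use G in \<open>auto simp: abs_le_iff\<close>)
    ultimately show ?thesis by eventually_elim auto
  qed
  have conv: "(\<lambda>n. prob {w\<in>space M. \<bar>e n w - c\<bar> > \<epsilon>}) \<longlonglongrightarrow> 0" if "\<epsilon> > 0" for \<epsilon>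
    using cond_conv[OF g b that] by (simp only: e_def c_def nsum_def sd_def)
  have bound: "(\<integral>w. \<bar>e n w - c\<bar> \<partial>M) \<le> \<epsilon> + 2 * G * prob {w\<in>space M. \<bar>e n w - c\<bar> > \<epsilon>}" if "\<epsilon> > 0" for n \<epsilon>
  proof -
    have i1: "integrable M (\<lambda>w. of_bool (\<bar>e n w - c\<bar> > \<epsilon>) :: real)"
      by (intro integrable_const_bound[where B = 1]) auto
    have ie: "integrable M (\<lambda>w. \<bar>e n w - c\<bar>)"
      unfolding e_def using F.real_cond_exp_int(1)[OF intg] by auto
    have "(\<integral>w. \<bar>e n w - c\<bar> \<partial>M) \<le> (\<integral>w. \<epsilon> + 2 * G * of_bool (\<bar>e n w - c\<bar> > \<epsilon>) \<partial>M)"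
    proof (rule integral_mono_AE)
      show "AE w in M. \<bar>e n w - c\<bar> \<le> \<epsilon> + 2 * G * of_bool (\<bar>e n w - c\<bar> > \<epsilon>)"
        using eG[of n]
      proof eventually_elim
        case (elim w)
        then show ?case using cG that by (cases "\<bar>e n w - c\<bar> > \<epsilon>") auto
      qed
    qed (use i1 ie in auto)
    also have "\<dots> = \<epsilon> + 2 * G * prob {w\<in>space M. \<bar>e n w - c\<bar> > \<epsilon>}"
      unfolding prob_eq_integral_of_bool using i1 by (simp add: prob_space)
    finally show ?thesis .
  qed
  have "(\<lambda>n. \<integral>w. \<bar>e n w - c\<bar> \<partial>M) \<longlonglongrightarrow> 0"
  proof (rule tendstoI)
    fix r :: real assume r: "r > 0"
    have "eventually (\<lambda>n. prob {w\<in>space M. \<bar>e n w - c\<bar> > r / 2} < r / 2 / (2 * G + 1)) sequentially"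
      using conv[of "r / 2"] r G0 by (intro order_tendstoD(2)[of _ 0]) (auto intro!: divide_pos_pos)
    then show "eventually (\<lambda>n. dist (\<integral>w. \<bar>e n w - c\<bar> \<partial>M) 0 < r) sequentially"
    proof eventually_elim
      case (elim n)
      let ?p = "prob {w\<in>space M. \<bar>e n w - c\<bar> > r / 2}"
      have "2 * G * ?p \<le> (2 * G + 1) * ?p" by (intro mult_right_mono) auto
      also have "\<dots> < r / 2" using elim G0 by (simp add: field_simps)
      finally have "(\<integral>w. \<bar>e n w - c\<bar> \<partial>M) < r" using bound[of "r / 2" n] r by simp
      then show ?case by simp
    qed
  qed
  then show ?thesis unfolding e_def c_def .
qed

text \<open>Convergence in mean is uniform over all test variables bounded by B, so
  \<open>\<Psi>\<close> may vary with n; in \<open>fdd\<close> it is a function of the earlier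
  blocks.\<close>

lemma cond_Psi:
  fixes g :: "real \<Rightarrow> real"
  assumes g: "continuous_on UNIV g" and b: "bounded (range g)"
    and \<Psi>: "\<And>n. \<Psi> n \<in> borel_measurable (past 0)" and B: "\<And>n w. \<bar>\<Psi> n w\<bar> \<le> B"
  shows "(\<lambda>n. (\<integral>w. \<Psi> n w * g (nsum 0 n w) \<partial>M) - (\<integral>w. \<Psi> n w \<partial>M) * (\<integral>x. g (L x) \<partial>N)) \<longlonglongrightarrow> 0"
proof -
  interpret F: sigma_finite_subalgebra M "past 0" by (rule sigma_finite_past)
  have [measurable]: "g \<in> borel_measurable borel" by (rule borel_measurable_continuous_onI[OF g])
  have \<Psi>M [measurable]: "\<Psi> n \<in> borel_measurable M" for n by (rule measurable_from_past[OF \<Psi>])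
  obtain G where G: "\<And>y. \<bar>g y\<bar> \<le> G" using b by (auto simp: bounded_iff)
  have B0: "0 \<le> B" using B[of 0 undefined] by simp
  define c where "c = (\<integral>x. g (L x) \<partial>N)"
  define e where "e n = real_cond_exp M (past 0) (\<lambda>w. g (nsum 0 n w))" for n
  have [measurable]: "e n \<in> borel_measurable M" for n unfolding e_def by simp
  have intg: "integrable M (\<lambda>w. g (nsum 0 n w))" for n
    using G by (intro integrable_const_bound[where B = G]) auto
  have int\<Psi>g: "integrable M (\<lambda>w. \<Psi> n w * g (nsum 0 n w))" for n
  proof (rule integrable_const_bound[where B = "B * G"])
    show "AE w in M. norm (\<Psi> n w * g (nsum 0 n w)) \<le> B * G"
      using B G B0 by (auto simp: abs_mult intro!: mult_mono)
  qed measurable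
  have int\<Psi>: "integrable M (\<Psi> n)" for n using B by (intro integrable_const_bound[where B = B]) auto
  have ie: "integrable M (\<lambda>w. \<bar>e n w - c\<bar>)" for n
    unfolding e_def using F.real_cond_exp_int(1)[OF intg] by auto
  show ?thesis
  proof (rule Lim_null_comparison)
    show "(\<lambda>n. B * (\<integral>w. \<bar>e n w - c\<bar> \<partial>M)) \<longlonglongrightarrow> 0"
      using tendsto_mult_left[OF cond_exp_L1[OF g b], of B] unfolding e_def c_def by simp
    show "eventually (\<lambda>n. norm ((\<integral>w. \<Psi> n w * g (nsum 0 n w) \<partial>M) - (\<integral>w. \<Psi> n w \<partial>M) * (\<integral>x. g (L x) \<partial>N))
        \<le> B * (\<integral>w. \<bar>e n w - c\<bar> \<partial>M)) sequentially"
    proof (intro always_eventually allI)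
      fix n
      have 1: "(\<integral>w. \<Psi> n w * g (nsum 0 n w) \<partial>M) = (\<integral>w. \<Psi> n w * e n w \<partial>M)"
        unfolding e_def by (rule F.real_cond_exp_intg(2)[OF int\<Psi>g \<Psi>, symmetric]) measurable
      have i2: "integrable M (\<lambda>w. \<Psi> n w * e n w)"
        unfolding e_def by (rule F.real_cond_exp_intg(1)[OF int\<Psi>g \<Psi>]) measurable
      have eq: "(\<integral>w. \<Psi> n w * g (nsum 0 n w) \<partial>M) - (\<integral>w. \<Psi> n w \<partial>M) * c = (\<integral>w. \<Psi> n w * (e n w - c) \<partial>M)"
        unfolding 1 right_diff_distrib using i2 int\<Psi> by simp
      have "\<bar>\<integral>w. \<Psi> n w * (e n w - c) \<partial>M\<bar> \<le> (\<integral>w. \<bar>\<Psi> n w * (e n w - c)\<bar> \<partial>M)"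
        by (rule integral_abs_bound)
      also have "\<dots> \<le> (\<integral>w. B * \<bar>e n w - c\<bar> \<partial>M)"
      proof (rule integral_mono)
        show "integrable M (\<lambda>w. \<bar>\<Psi> n w * (e n w - c)\<bar>)"
          unfolding right_diff_distrib using i2 int\<Psi> by auto
        show "integrable M (\<lambda>w. B * \<bar>e n w - c\<bar>)" using ie by simp
      qed (use B in \<open>auto simp: abs_mult intro!: mult_right_mono\<close>)
      also have "\<dots> = B * (\<integral>w. \<bar>e n w - c\<bar> \<partial>M)" by simp
      finally show "norm ((\<integral>w. \<Psi> n w * g (nsum 0 n w) \<partial>M) - (\<integral>w. \<Psi> n w \<partial>M) * (\<integral>x. g (L x) \<partial>N))
        \<le> B * (\<integral>w. \<bar>e n w - c\<bar> \<partial>M)"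
        unfolding eq[unfolded c_def] real_norm_def c_def .
    qed
  qed
qed

lemma weak_conv_nsum:
  fixes g :: "real \<Rightarrow> real"
  assumes g: "continuous_on UNIV g" and b: "bounded (range g)"
  shows "(\<lambda>n. \<integral>w. g (nsum 0 n w) \<partial>M) \<longlonglongrightarrow> (\<integral>x. g (L x) \<partial>N)"
proof -
  have "(\<lambda>n. (\<integral>w. 1 * g (nsum 0 n w) \<partial>M) - (\<integral>w. 1 \<partial>M) * (\<integral>x. g (L x) \<partial>N)) \<longlonglongrightarrow> 0"
    by (rule cond_Psi[OF g b, where B = 1]) auto
  then show ?thesis by (simp add: prob_space LIM_zero_iff)
qed

text \<open>Second moments are lower semicontinuous under weak convergence, here through the
  truncations min(y^2, k). This yields an inequality, hence c is the standard deviation of L and not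
  1.\<close>

lemma L2_L: "L2 N L"
  and L_sq_le: "(\<integral>x. (L x)\<^sup>2 \<partial>N) \<le> 1"
proof -
  have le: "(\<integral>\<^sup>+x. ennreal (min ((L x)\<^sup>2) (real k)) \<partial>N) \<le> 1" for k
  proof -
    have c: "continuous_on UNIV (\<lambda>y::real. min (y\<^sup>2) (real k))" by (intro continuous_intros)
    have b: "bounded (range (\<lambda>y::real. min (y\<^sup>2) (real k)))"
      by (rule boundedI[of _ "real k"]) (auto simp: min_def)
    have "(\<integral>w. min ((nsum 0 n w)\<^sup>2) (real k) \<partial>M) \<le> 1" for n
    proof (rule order_trans[OF integral_mono nsum_sq_le[of 0 n]])
      show "integrable M (\<lambda>w. min ((nsum 0 n w)\<^sup>2) (real k))"
        by (intro integrable_const_bound[where B = "real k"]) (auto simp: min_def)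
      show "integrable M (\<lambda>w. (nsum 0 n w)\<^sup>2)" by (rule L2_sq[OF L2_nsum])
    qed simp
    then have "(\<integral>x. min ((L x)\<^sup>2) (real k) \<partial>N) \<le> 1"
      by (intro LIMSEQ_le_const2[OF weak_conv_nsum[OF c b]]) auto
    moreover have "integrable N (\<lambda>x. min ((L x)\<^sup>2) (real k))"
      by (intro N.integrable_const_bound[where B = "real k"]) (auto simp: min_def)
    ultimately show ?thesis
      by (subst nn_integral_eq_integral) (auto simp: min_def ennreal_le_1)
  qed
  have "(\<integral>\<^sup>+x. ennreal ((L x)\<^sup>2) \<partial>N) = (\<integral>\<^sup>+x. (SUP k. ennreal (min ((L x)\<^sup>2) (real k))) \<partial>N)"
  proof (intro nn_integral_cong)
    fix x
    obtain k :: nat where k: "(L x)\<^sup>2 \<le> real k" using real_arch_simple by blast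
    show "ennreal ((L x)\<^sup>2) = (SUP k. ennreal (min ((L x)\<^sup>2) (real k)))"
    proof (rule antisym)
      have "ennreal ((L x)\<^sup>2) = ennreal (min ((L x)\<^sup>2) (real k))" using k by simp
      also have "\<dots> \<le> (SUP k. ennreal (min ((L x)\<^sup>2) (real k)))" by (rule SUP_upper) simp
      finally show "ennreal ((L x)\<^sup>2) \<le> (SUP k. ennreal (min ((L x)\<^sup>2) (real k)))" .
    qed (auto intro!: SUP_least ennreal_leI)
  qed
  also have "\<dots> = (SUP k. \<integral>\<^sup>+x. ennreal (min ((L x)\<^sup>2) (real k)) \<partial>N)"
    by (intro nn_integral_monotone_convergence_SUP) (auto simp: incseq_def le_fun_def intro!: ennreal_leI)
  also have "\<dots> \<le> 1" by (intro SUP_least le)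
  finally have fin: "(\<integral>\<^sup>+x. ennreal ((L x)\<^sup>2) \<partial>N) \<le> 1" .
  then have i: "integrable N (\<lambda>x. (L x)\<^sup>2)"
    by (auto simp: integrable_iff_bounded intro: le_less_trans)
  then show "L2 N L" by (simp add: L2_def)
  have "ennreal (\<integral>x. (L x)\<^sup>2 \<partial>N) \<le> 1"
    using fin nn_integral_eq_integral[OF i] by simp
  then show "(\<integral>x. (L x)\<^sup>2 \<partial>N) \<le> 1" by simp
qed

lemma integral_f: "(\<integral>w. f (\<xi> k w) \<partial>M) = 0"
proof -
  have "(\<integral>w. f (\<xi> k w) \<partial>M) = (\<integral>x. f x \<partial>\<pi>)"
    unfolding distr_xi[of k, symmetric] by (rule integral_distr[symmetric]) measurable
  moreover have "(\<integral>x. f x \<partial>\<pi>) = 0" using f_L2_0 unfolding L2_0_def by (elim conjE)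
  ultimately show ?thesis by (rule trans)
qed

lemma integral_nsum: "(\<integral>w. nsum a n w \<partial>M) = 0"
proof -
  have "(\<integral>w. bsum a n (path w) \<partial>M) = (\<Sum>i=1..n. \<integral>w. f (\<xi> (a + int i) w) \<partial>M)"
    unfolding bsum_def by (intro Bochner_Integration.integral_sum L2_integrable L2_f_xi)
  then show ?thesis by (simp add: nsum_def integral_f)
qed

lemma clamp_diff_le:
  fixes y k :: real
  assumes "k > 0"
  shows "\<bar>y - max (- k) (min k y)\<bar> \<le> y\<^sup>2 / k"
proof (cases "\<bar>y\<bar> \<le> k")
  case True
  then show ?thesis using assms by auto
next
  case False
  have "\<bar>y - max (- k) (min k y)\<bar> \<le> \<bar>y\<bar>" using False assms by auto
  also have "\<dots> \<le> y\<^sup>2 / k"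
    using False assms mult_right_mono[of k "\<bar>y\<bar>" "\<bar>y\<bar>"] by (simp add: field_simps power2_eq_square)
  finally show ?thesis .
qed

text \<open>First moments do converge: clamping at k changes the mean of a variable with second
  moment at most 1 by at most 1 / k, both for the sums and for L, and the sums are centred.\<close>

lemma integral_L: "(\<integral>x. L x \<partial>N) = 0"
proof -
  have le: "\<bar>\<integral>x. L x \<partial>N\<bar> \<le> 2 / k" if k: "k > 0" for k :: real
  proof -
    let ?t = "\<lambda>y::real. max (- k) (min k y)"
    have c: "continuous_on UNIV ?t" by (intro continuous_intros)
    have b: "bounded (range ?t)" by (rule boundedI[of _ k]) (use k in auto)
    have gen: "\<bar>(\<integral>x. Y x \<partial>P) - (\<integral>x. ?t (Y x) \<partial>P)\<bar> \<le> 1 / k"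
      if P: "prob_space P" and Y: "L2 P Y" and Y1: "(\<integral>x. (Y x)\<^sup>2 \<partial>P) \<le> 1" for P :: "'z measure" and Y
    proof -
      interpret P: prob_space P by fact
      have [measurable]: "Y \<in> borel_measurable P" using Y by (rule L2_measurable)
      have i: "integrable P Y" "integrable P (\<lambda>x. ?t (Y x))"
        using P.L2_integrable[OF Y] k by (auto intro!: P.integrable_const_bound[where B = k])
      have eq: "(\<integral>x. Y x \<partial>P) - (\<integral>x. ?t (Y x) \<partial>P) = (\<integral>x. Y x - ?t (Y x) \<partial>P)" using i by simp
      have "\<bar>(\<integral>x. Y x \<partial>P) - (\<integral>x. ?t (Y x) \<partial>P)\<bar> \<le> (\<integral>x. \<bar>Y x - ?t (Y x)\<bar> \<partial>P)"
        unfolding eq by (rule integral_abs_bound)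
      also have "\<dots> \<le> (\<integral>x. (Y x)\<^sup>2 / k \<partial>P)"
      proof (rule integral_mono)
        show "integrable P (\<lambda>x. \<bar>Y x - ?t (Y x)\<bar>)" using i by (intro integrable_abs Bochner_Integration.integrable_diff)
        show "integrable P (\<lambda>x. (Y x)\<^sup>2 / k)" using L2_sq[OF Y] by simp
      qed (rule clamp_diff_le[OF k])
      also have "\<dots> = (\<integral>x. (Y x)\<^sup>2 \<partial>P) / k" by simp
      also have "\<dots> \<le> 1 / k" using Y1 k by (intro divide_right_mono) auto
      finally show ?thesis .
    qed
    have "\<bar>\<integral>w. ?t (nsum 0 n w) \<partial>M\<bar> \<le> 1 / k" for n
      using gen[OF prob_space_axioms L2_nsum nsum_sq_le, of 0 n] by (simp add: integral_nsum)
    then have "\<bar>\<integral>x. ?t (L x) \<partial>N\<bar> \<le> 1 / k"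
      by (intro LIMSEQ_le_const2[OF tendsto_rabs[OF weak_conv_nsum[OF c b]]]) auto
    then show ?thesis using gen[OF N L2_L L_sq_le] by simp
  qed
  show ?thesis
  proof (rule ccontr)
    assume "\<not> ?thesis"
    then have p: "\<bar>\<integral>x. L x \<partial>N\<bar> > 0" by simp
    \<comment> \<open>At this k the bound says that |E L| is at most half of itself.\<close>
    have "\<bar>\<integral>x. L x \<partial>N\<bar> \<le> 2 / (4 / \<bar>\<integral>x. L x \<partial>N\<bar>)" by (rule le) (use p in simp)
    then show False using p by simp
  qed
qed

text \<open>In the limit the first moment of L beyond b / 4 is at most of order 1 / b times its
  second moment beyond b / 8, and the latter tends to 0 as b grows. The factor b^2 is matched by the
  number of blocks in \<open>bad_small\<close>.\<close>

lemma max_tail: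
  assumes \<eta>: "\<eta> > 0"
  shows "\<exists>b0>0. \<forall>b\<ge>b0. \<forall>\<^sub>F n in sequentially.
    b\<^sup>2 * prob {w\<in>space M. \<exists>k\<le>n. \<bar>bsum 0 k (path w)\<bar> > 2 * b * sd n} < \<eta>"
proof -
  define T where "T a = (\<integral>x. (L x)\<^sup>2 * of_bool (\<bar>L x\<bar> > a) \<partial>N)" for a
  have iT: "integrable N (\<lambda>x. (L x)\<^sup>2 * of_bool (\<bar>L x\<bar> > a))" for a
    by (rule Bochner_Integration.integrable_bound[OF L2_sq[OF L2_L]]) auto
  have Tmono: "T b \<le> T a" if "a \<le> b" for a b
    unfolding T_def using that by (intro integral_mono iT) auto
  have "filterlim (\<lambda>n. real n / 8) at_top sequentially" by real_asymp
  then have "(\<lambda>n. T (real n / 8)) \<longlonglongrightarrow> 0"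
    unfolding T_def by (rule N.truncated_second_moment_LIMSEQ_0[OF L2_L])
  \<comment> \<open>The factor 16 / b below turns this into \<eta> / (32 b), which 8 b turns into
    \<eta> / 4.\<close>
  then have "eventually (\<lambda>n. T (real n / 8) < \<eta> / 512) sequentially"
    using \<eta> by (intro order_tendstoD(2)[of _ 0]) auto
  then obtain n0 where n0: "\<And>n. n \<ge> n0 \<Longrightarrow> T (real n / 8) < \<eta> / 512"
    by (auto simp: eventually_sequentially)
  define b0 where "b0 = real (Suc n0)"
  have "eventually (\<lambda>n. b\<^sup>2 * prob {w\<in>space M. \<exists>k\<le>n. \<bar>bsum 0 k (path w)\<bar> > 2 * b * sd n} < \<eta>) sequentially"
    if b: "b \<ge> b0" for b
  proof -
    have bpos: "b > 0" using b by (simp add: b0_def)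
    have Tb: "T (b / 8) < \<eta> / 512"
      using Tmono[of "real (Suc n0) / 8" "b / 8"] b n0[of "Suc n0"] by (simp add: b0_def)
    \<comment> \<open>Capping at k costs 1 / k in the mean, and 8 b / k = \<eta> / 4.\<close>
    define k where "k = 32 * b / \<eta>"
    have k: "k > 0" using bpos \<eta> by (simp add: k_def)
    \<comment> \<open>Continuous and bounded, zero for |y| \<le> b / 8 and at least |y| for |y| > b
      / 4 as long as the cap is inactive; where it is active, y^2 / k makes up for the loss.\<close>
    define g where "g y = min (2 * max 0 (\<bar>y\<bar> - b / 8)) k" for y :: real
    have g0: "0 \<le> g y" and gk: "g y \<le> k" for y using k by (auto simp: g_def)
    have gc: "continuous_on UNIV g" unfolding g_def[abs_def] by (intro continuous_intros)
    have [measurable]: "g \<in> borel_measurable borel" by (rule borel_measurable_continuous_onI[OF gc])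
    have gb: "bounded (range g)" by (rule boundedI[of _ k]) (use g0 gk in auto)
    have gi: "integrable M (\<lambda>w. g (nsum 0 n w))" for n
      using g0 gk by (intro integrable_const_bound[where B = k]) auto
    have pt: "\<bar>y\<bar> * of_bool (\<bar>y\<bar> > b / 4) \<le> g y + y\<^sup>2 / k" for y
    proof (cases "\<bar>y\<bar> > b / 4")
      case True
      have "\<bar>y\<bar> \<le> k + y\<^sup>2 / k"
      proof -
        have "0 \<le> (\<bar>y\<bar> - k)\<^sup>2 + \<bar>y\<bar> * k" using k by simp
        then have "\<bar>y\<bar> * k \<le> k * k + y\<^sup>2" by (simp add: power2_eq_square algebra_simps)
        then show ?thesis using k by (simp add: field_simps)
      qed
      moreover have "\<bar>y\<bar> \<le> 2 * max 0 (\<bar>y\<bar> - b / 8)" using True by simp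
      moreover have "0 \<le> y\<^sup>2 / k" using k by simp
      ultimately have "\<bar>y\<bar> \<le> g y + y\<^sup>2 / k" unfolding g_def by (auto simp: min_def)
      then show ?thesis using True by simp
    next
      case False
      then show ?thesis using g0[of y] k by simp
    qed
    have I1: "(\<integral>w. \<bar>nsum 0 n w\<bar> * of_bool (\<bar>nsum 0 n w\<bar> > b / 4) \<partial>M) \<le> (\<integral>w. g (nsum 0 n w) \<partial>M) + 1 / k" for n
    proof -
      have i2: "integrable M (\<lambda>w. (nsum 0 n w)\<^sup>2 / k)" using L2_sq[OF L2_nsum] by simp
      have "(\<integral>w. \<bar>nsum 0 n w\<bar> * of_bool (\<bar>nsum 0 n w\<bar> > b / 4) \<partial>M) \<le> (\<integral>w. g (nsum 0 n w) + (nsum 0 n w)\<^sup>2 / k \<partial>M)"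
      proof (rule integral_mono[OF _ _ pt])
        show "integrable M (\<lambda>w. \<bar>nsum 0 n w\<bar> * of_bool (\<bar>nsum 0 n w\<bar> > b / 4))"
          by (rule Bochner_Integration.integrable_bound[OF L2_integrable[OF L2_nsum]]) auto
        show "integrable M (\<lambda>w. g (nsum 0 n w) + (nsum 0 n w)\<^sup>2 / k)"
          by (intro Bochner_Integration.integrable_add gi i2)
      qed
      also have "\<dots> = (\<integral>w. g (nsum 0 n w) \<partial>M) + (\<integral>w. (nsum 0 n w)\<^sup>2 \<partial>M) / k"
        using Bochner_Integration.integral_add[OF gi i2] by simp
      also have "\<dots> \<le> (\<integral>w. g (nsum 0 n w) \<partial>M) + 1 / k"
        using nsum_sq_le[of 0 n] k by (intro add_left_mono divide_right_mono) auto
      finally show ?thesis .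
    qed
    have gL: "(\<integral>x. g (L x) \<partial>N) < \<eta> / (32 * b)"
    proof -
      have "g y \<le> (16 / b) * (y\<^sup>2 * of_bool (\<bar>y\<bar> > b / 8))" for y
      proof (cases "\<bar>y\<bar> > b / 8")
        case True
        have "g y \<le> 2 * \<bar>y\<bar>" unfolding g_def by (rule order_trans[OF min.cobounded1]) (use bpos in auto)
        also have "\<dots> \<le> (16 / b) * y\<^sup>2"
        proof -
          have "b / 8 * \<bar>y\<bar> \<le> \<bar>y\<bar> * \<bar>y\<bar>" using True by (intro mult_right_mono) auto
          then show ?thesis using bpos by (simp add: field_simps power2_eq_square)
        qed
        finally show ?thesis using True by simp
      next
        case False
        then show ?thesis using k by (simp add: g_def)
      qed
      then have "(\<integral>x. g (L x) \<partial>N) \<le> (\<integral>x. (16 / b) * ((L x)\<^sup>2 * of_bool (\<bar>L x\<bar> > b / 8)) \<partial>N)"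
        using g0 gk by (intro integral_mono integrable_mult_right iT N.integrable_const_bound[where B = k]) auto
      also have "\<dots> = 16 / b * T (b / 8)" by (simp add: T_def)
      also have "\<dots> < 16 / b * (\<eta> / 512)" using Tb bpos by (intro mult_strict_left_mono) auto
      also have "\<dots> = \<eta> / (32 * b)" by simp
      finally show ?thesis .
    qed
    obtain \<delta> where \<delta>: "\<delta> \<longlonglongrightarrow> 0" and ev: "eventually (\<lambda>n.
        b\<^sup>2 * prob {w\<in>space M. \<exists>k\<le>n. \<bar>bsum 0 k (path w)\<bar> > 2 * b * sqrt (var n)} \<le>
        8 * b * (\<integral>w. \<bar>bsum 0 n (path w) / sqrt (var n)\<bar> * of_bool (\<bar>bsum 0 n (path w) / sqrt (var n)\<bar> > b / 4) \<partial>M) + \<delta> n) sequentially"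
      using max_tail_asymptotic[OF _ inf bpos] ratio[of 2] by auto
    have "eventually (\<lambda>n. \<delta> n < \<eta> / 4) sequentially" using \<delta> \<eta> by (intro order_tendstoD(2)[of _ 0]) auto
    moreover have "eventually (\<lambda>n. (\<integral>w. g (nsum 0 n w) \<partial>M) < \<eta> / (32 * b)) sequentially"
      by (rule order_tendstoD(2)[OF weak_conv_nsum[OF gc gb] gL])
    ultimately show ?thesis
      using ev
    proof eventually_elim
      case (elim n)
      have "8 * b * (\<integral>w. \<bar>nsum 0 n w\<bar> * of_bool (\<bar>nsum 0 n w\<bar> > b / 4) \<partial>M) \<le> 8 * b * ((\<integral>w. g (nsum 0 n w) \<partial>M) + 1 / k)"
        using I1[of n] bpos by (intro mult_left_mono) auto
      also have "\<dots> \<le> 8 * b * (\<eta> / (32 * b) + 1 / k)"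
        using elim(2) bpos by (intro mult_left_mono add_right_mono) auto
      also have "\<dots> = \<eta> / 2" using bpos \<eta> by (simp add: k_def field_simps)
      finally have "8 * b * (\<integral>w. \<bar>nsum 0 n w\<bar> * of_bool (\<bar>nsum 0 n w\<bar> > b / 4) \<partial>M) \<le> \<eta> / 2" .
      then have "8 * b * (\<integral>w. \<bar>bsum 0 n (path w) / sqrt (var n)\<bar> * of_bool (\<bar>bsum 0 n (path w) / sqrt (var n)\<bar> > b / 4) \<partial>M) \<le> \<eta> / 2"
        by (simp only: nsum_def sd_def)
      then show ?case using elim(1,3) \<eta> unfolding sd_def by linarith
    qed
  qed
  then show ?thesis by (intro exI[of _ b0]) (auto simp: b0_def)
qed

text \<open>Shifting time by \<open>- i * n\<close> makes the blocks before the \<open>i\<close>-th one measurable with respect to the past of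
  time \<open>0\<close>, where the conditional convergence is available.\<close>

lemma fdd:
  fixes Z :: "nat \<Rightarrow> 'z \<Rightarrow> real"
  assumes P: "prob_space P" and ind: "prob_space.indep_vars P (\<lambda>_. borel) Z {..<m}"
    and Z: "\<And>j. Z j \<in> borel_measurable P"
    and law: "\<And>j. j < m \<Longrightarrow> distr P borel (Z j) = distr N borel L"
    and i: "i \<le> m" and H: "bdd_lip i H K B"
  shows "(\<lambda>n. \<integral>w. H (\<lambda>j. nsum (int (j * n)) n w) \<partial>M) \<longlonglongrightarrow> (\<integral>w. H (\<lambda>j. Z j w) \<partial>P)"
  using i H
proof (induction i arbitrary: H)
  case 0
  interpret P: prob_space P by fact
  define c where "c = H (\<lambda>_. 0)"
  have "H y = c" for y unfolding c_def by (rule bdd_lip_cong[OF 0(2)]) simp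
  then show ?case by (simp add: prob_space P.prob_space)
next
  case (Suc i)
  interpret P: prob_space P by fact
  note H = Suc.prems(2)
  let ?H' = "\<lambda>u. \<integral>x. H (u(i := L x)) \<partial>N"
  let ?U = "\<lambda>n j w. nsum (int (j * n)) n w"
  have H': "bdd_lip i ?H' K B" by (rule N.bdd_lip_integrate_last[OF H L])
  have "(\<lambda>n. (\<integral>w. H ((\<lambda>j. ?U n j w)(i := ?U n i w)) \<partial>M) - (\<integral>w. ?H' (\<lambda>j. ?U n j w) \<partial>M)) \<longlonglongrightarrow> 0"
  proof (rule replace_last_coordinate[OF prob_space_axioms N L H])
    fix G K' B' and g :: "real \<Rightarrow> real"
    assume G: "bdd_lip i G K' B'" and g: "continuous_on UNIV g" "bounded (range g)"
    have [measurable]: "g \<in> borel_measurable borel" by (rule borel_measurable_continuous_onI[OF g(1)])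
    \<comment> \<open>Coordinates from i on, which \<open>G\<close> does not see, are set to 0;
      after the shift the argument involves only blocks that end by time 0.\<close>
    define G' where "G' n x = G (\<lambda>j. if j < i then bsum (int (j * n)) n x / sd n else 0)" for n x
    define Gs where "Gs n x = G (\<lambda>j. if j < i then bsum (int (j * n) - int (i * n)) n x / sd n else 0)" for n x
    have G'm [measurable]: "G' n \<in> borel_measurable traj" for n
      unfolding G'_def[abs_def] by (rule bdd_lip_measurable_comp[OF G]) auto
    have G'U: "G (\<lambda>j. ?U n j w) = G' n (path w)" for n w
      unfolding G'_def by (rule bdd_lip_cong[OF G]) (simp add: nsum_def)
    have shift: "G' n (\<lambda>k. \<xi> (k + (- int (i * n))) w) = Gs n (path w)" for n w
      unfolding G'_def Gs_def bsum_shift_path diff_conv_add_uminus ..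
    have Gs_past: "(\<lambda>w. Gs n (path w)) \<in> borel_measurable (past 0)" for n
      unfolding Gs_def
    proof (rule bdd_lip_measurable_comp[OF G])
      fix j
      show "(\<lambda>w. if j < i then bsum (int (j * n) - int (i * n)) n (path w) / sd n else 0) \<in> borel_measurable (past 0)"
      proof (cases "j < i")
        case True
        then have "Suc j * n \<le> i * n" by (intro mult_le_mono1) simp
        then have "int (Suc j * n) \<le> int (i * n)" by (simp only: of_nat_le_iff)
        then have "int (j * n) - int (i * n) + int n \<le> 0" by (simp add: algebra_simps)
        then show ?thesis using True by (auto intro!: borel_measurable_divide bsum_past)
      qed simp
    qed
    have 1: "(\<integral>w. G (\<lambda>j. ?U n j w) * g (?U n i w) \<partial>M) = (\<integral>w. Gs n (path w) * g (nsum 0 n w) \<partial>M)" for n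
    proof -
      have "(\<integral>w. (\<lambda>x. G' n x * g (bsum (int (i * n)) n x / sd n)) (\<lambda>k. \<xi> (k + (- int (i * n))) w) \<partial>M)
          = (\<integral>w. (\<lambda>x. G' n x * g (bsum (int (i * n)) n x / sd n)) (path w) \<partial>M)"
        by (rule integral_shift) measurable
      then show ?thesis unfolding G'U shift bsum_shift_path by (simp add: nsum_def)
    qed
    have 2: "(\<integral>w. G (\<lambda>j. ?U n j w) \<partial>M) = (\<integral>w. Gs n (path w) \<partial>M)" for n
      unfolding G'U shift[symmetric] by (rule integral_shift[symmetric]) measurable
    show "(\<lambda>n. (\<integral>w. G (\<lambda>j. ?U n j w) * g (?U n i w) \<partial>M) - (\<integral>w. G (\<lambda>j. ?U n j w) \<partial>M) * (\<integral>x. g (L x) \<partial>N)) \<longlonglongrightarrow> 0"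
      unfolding 1 2 by (rule cond_Psi[OF g Gs_past, where B = B']) (simp add: Gs_def bdd_lip_bound[OF G])
  qed measurable
  moreover have "(\<lambda>n. \<integral>w. ?H' (\<lambda>j. ?U n j w) \<partial>M) \<longlonglongrightarrow> (\<integral>w. ?H' (\<lambda>j. Z j w) \<partial>P)"
    by (rule Suc.IH[OF _ H']) (use Suc.prems in simp)
  ultimately have "(\<lambda>n. \<integral>w. H ((\<lambda>j. ?U n j w)(i := ?U n i w)) \<partial>M) \<longlonglongrightarrow> (\<integral>w. ?H' (\<lambda>j. Z j w) \<partial>P)"
    using tendsto_add by fastforce
  moreover have "(\<lambda>j. ?U n j w)(i := ?U n i w) = (\<lambda>j. ?U n j w)" for n w by auto
  moreover have "(\<integral>w. H (\<lambda>j. Z j w) \<partial>P) = (\<integral>w. ?H' (\<lambda>j. Z j w) \<partial>P)"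
    by (rule P.indep_integrate_last[OF ind _ Z law L H]) (use Suc.prems in auto)
  ultimately show ?case by simp
qed

section \<open>Standard deviations along multiples and quotients\<close>

lemma L2norm_bsum: "L2norm M (\<lambda>w. bsum a n (path w)) = sd n"
  by (simp add: L2norm_def integral_bsum_sq sd_def)

lemma sd_add_le: "sd (a + b) \<le> sd a + sd b" and sd_le_add: "sd a \<le> sd (a + b) + sd b"
proof -
  have eq: "bsum 0 (a + b) (path w) = bsum 0 a (path w) + bsum (int a) b (path w)" for w
    using bsum_add[of 0 a b] by simp
  show "sd (a + b) \<le> sd a + sd b"
    using L2norm_triangle[OF L2_bsum L2_bsum, of 0 a "int a" b] by (simp add: L2norm_bsum eq[symmetric])
  have eq': "bsum 0 a (path w) = bsum 0 (a + b) (path w) - bsum (int a) b (path w)" for w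
    using eq by simp
  then show "sd a \<le> sd (a + b) + sd b"
    using L2norm_triangle_diff[OF L2_bsum L2_bsum, of 0 "a + b" "int a" b] by (simp add: L2norm_bsum eq'[symmetric])
qed

lemma sd_at_top: "filterlim sd at_top sequentially"
  unfolding sd_def by (rule filterlim_compose[OF sqrt_at_top inf])

lemma sd_ratio_mult: "m > 0 \<Longrightarrow> (\<lambda>n. sd (m * n) / sd n) \<longlonglongrightarrow> sqrt (real m)"
  using tendsto_real_sqrt[OF ratio[of m]] by (simp add: sd_def real_sqrt_divide)

text \<open>The remainder of n modulo m has fewer than m terms, so by the triangle inequality in L2
  passing from n to the nearest lower multiple of m changes \<open>sd\<close> by a bounded amount,
  negligible against \<open>sd (n div m)\<close>.\<close>

lemma sd_ratio:
  assumes m: "m > 0"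
  shows "(\<lambda>n. sd n / sd (n div m)) \<longlonglongrightarrow> sqrt (real m)"
proof -
  have div: "filterlim (\<lambda>n. n div m) sequentially sequentially"
    using m by (intro filterlim_at_top_div_const_nat)
  define C where "C = Max (sd ` {..<m})"
  have C: "sd (n mod m) \<le> C" for n unfolding C_def using m by (intro Max_ge) auto
  have 1: "(\<lambda>n. sd (m * (n div m)) / sd (n div m)) \<longlonglongrightarrow> sqrt (real m)"
    using filterlim_compose[OF sd_ratio_mult[OF m] div] .
  have "(\<lambda>n. C / sd (n div m)) \<longlonglongrightarrow> 0"
    by (rule tendsto_divide_0[OF tendsto_const])
       (rule filterlim_at_top_imp_at_infinity[OF filterlim_compose[OF sd_at_top div]])
  then have 2: "(\<lambda>n. sd n / sd (n div m) - sd (m * (n div m)) / sd (n div m)) \<longlonglongrightarrow> 0"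
  proof (rule Lim_null_comparison[rotated])
    show "eventually (\<lambda>n. norm (sd n / sd (n div m) - sd (m * (n div m)) / sd (n div m)) \<le> C / sd (n div m)) sequentially"
    proof (intro always_eventually allI)
      fix n
      have "\<bar>sd n - sd (m * (n div m))\<bar> \<le> sd (n mod m)"
        using sd_add_le[of "m * (n div m)" "n mod m"] sd_le_add[of "m * (n div m)" "n mod m"] by simp
      then have "\<bar>sd n - sd (m * (n div m))\<bar> \<le> C" using C[of n] by simp
      then show "norm (sd n / sd (n div m) - sd (m * (n div m)) / sd (n div m)) \<le> C / sd (n div m)"
        using sd_nonneg[of "n div m"] by (simp add: diff_divide_distrib[symmetric] divide_right_mono)
    qed
  qed
  from tendsto_add[OF 2 1] show ?thesis by simp
qed

end

section \<open>Normality of the limit\<close>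

lemma indep_vars_PiM_components:
  assumes M: "\<And>i. i \<in> I \<Longrightarrow> prob_space (M i)" and I: "I \<noteq> {}"
  shows "prob_space.indep_vars (PiM I M) M (\<lambda>i x. x i) I"
proof -
  interpret P: prob_space "PiM I M" by (rule prob_space_PiM[OF M])
  have "distr (PiM I M) (PiM I M) (\<lambda>x. restrict (\<lambda>i. x i) I) = PiM I M"
    by (subst distr_cong[OF refl refl, of _ _ "\<lambda>x. x"]) (auto simp: space_PiM PiE_def extensional_restrict distr_id)
  also have "\<dots> = PiM I (\<lambda>i. distr (PiM I M) (M i) (\<lambda>x. x i))"
    by (intro PiM_cong refl) (rule distr_PiM_component[OF M, symmetric])
  finally show ?thesis
    using I by (subst P.indep_vars_iff_distr_eq_PiM') auto
qed

text \<open>Splitting into cosine and sine turns a statement on characteristic functions into two on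
  bounded Lipschitz real functions, the class treated in \<open>L_stable\<close>.\<close>

lemma char_eq_trig:
  assumes M: "prob_space M" and X [measurable]: "X \<in> borel_measurable M"
  shows "char (distr M borel X) t = Complex (\<integral>x. cos (t * X x) \<partial>M) (\<integral>x. sin (t * X x) \<partial>M)"
proof -
  interpret prob_space M by fact
  have c: "integrable M (\<lambda>x. cos (t * X x))" and s: "integrable M (\<lambda>x. sin (t * X x))"
    by (auto intro!: integrable_const_bound[where B = 1])
  have iexp: "iexp y = of_real (cos y) + \<i> * of_real (sin y)" for y
    unfolding cis_conv_exp[symmetric] by (simp add: complex_eq_iff)
  have "char (distr M borel X) t = (\<integral>x. iexp (t * X x) \<partial>M)"
    unfolding char_def by (subst integral_distr) auto
  also have "\<dots> = (\<integral>x. of_real (cos (t * X x)) + \<i> * of_real (sin (t * X x)) \<partial>M)"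
    by (simp only: iexp)
  also have "\<dots> = of_real (\<integral>x. cos (t * X x) \<partial>M) + \<i> * of_real (\<integral>x. sin (t * X x) \<partial>M)"
    using c s by simp
  finally show ?thesis by (simp add: Complex_eq)
qed

context cond_clt
begin

lemma nsum_mult:
  assumes "sd n > 0" "sd (m * n) > 0"
  shows "nsum 0 (m * n) w = (\<Sum>j<m. nsum (int (j * n)) n w) * (sd n / sd (m * n))"
proof -
  have "bsum 0 (m * n) (path w) = (\<Sum>j<m. bsum (int (j * n)) n (path w))"
  proof (induction m)
    case (Suc m)
    then show ?case using bsum_add[of 0 "m * n" n "path w"] by (simp add: add.commute)
  qed (simp add: bsum_def)
  then show ?thesis using assms by (simp add: nsum_def sum_divide_distrib[symmetric])
qed

text \<open>Two limits of one sequence: the sum of m n terms normalised as a whole, and the same sum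
  as m blocks normalised separately. The two scalings are reconciled by
  \<open>sd n / sd (m * n)\<close> tending to 1 / sqrt m, and the error vanishes because normalised
  blocks are bounded in mean.\<close>

lemma L_stable:
  fixes Z :: "nat \<Rightarrow> 'z \<Rightarrow> real"
  assumes P: "prob_space P" and ind: "prob_space.indep_vars P (\<lambda>_. borel) Z {..<m}"
    and Z: "\<And>j. Z j \<in> borel_measurable P"
    and law: "\<And>j. j < m \<Longrightarrow> distr P borel (Z j) = distr N borel L"
    and m: "m > 0" and bd: "\<And>y. \<bar>h y\<bar> \<le> 1" and lip: "\<And>y z. \<bar>h y - h z\<bar> \<le> \<bar>y - z\<bar>"
  shows "(\<integral>x. h (t * L x) \<partial>N) = (\<integral>x. h (t * ((\<Sum>j<m. Z j x) / sqrt (real m))) \<partial>P)"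
proof -
  have hc: "continuous_on UNIV h"
  proof (rule lipschitz_on_continuous_on)
    show "1-lipschitz_on UNIV h" by (rule lipschitz_onI) (use lip in \<open>auto simp: dist_real_def\<close>)
  qed
  have [measurable]: "h \<in> borel_measurable borel" by (rule borel_measurable_continuous_onI[OF hc])
  define H where "H y = h (t * ((\<Sum>j<m. y j) / sqrt (real m)))" for y :: "nat \<Rightarrow> real"
  have Hl: "bdd_lip m H (\<bar>t\<bar> / sqrt (real m)) 1"
    unfolding bdd_lip_def
  proof (intro conjI allI)
    fix y z :: "nat \<Rightarrow> real"
    have eq: "t * ((\<Sum>j<m. y j) / sqrt (real m)) - t * ((\<Sum>j<m. z j) / sqrt (real m)) = t / sqrt (real m) * (\<Sum>j<m. y j - z j)"
      by (simp add: sum_subtractf diff_divide_distrib right_diff_distrib)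
    have "\<bar>H y - H z\<bar> \<le> \<bar>t / sqrt (real m) * (\<Sum>j<m. y j - z j)\<bar>"
      unfolding H_def eq[symmetric] by (rule lip)
    also have "\<dots> \<le> \<bar>t\<bar> / sqrt (real m) * (\<Sum>j<m. \<bar>y j - z j\<bar>)"
      by (simp add: abs_mult mult_left_mono sum_abs divide_right_mono)
    finally show "\<bar>H y - H z\<bar> \<le> \<bar>t\<bar> / sqrt (real m) * (\<Sum>j<m. \<bar>y j - z j\<bar>)" .
  qed (auto simp: H_def bd)
  have 1: "(\<lambda>n. \<integral>w. H (\<lambda>j. nsum (int (j * n)) n w) \<partial>M) \<longlonglongrightarrow> (\<integral>x. H (\<lambda>j. Z j x) \<partial>P)"
    by (rule fdd[OF P ind Z law order_refl Hl])
  have gc: "continuous_on UNIV (\<lambda>y. h (t * y))"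
    by (rule continuous_on_compose2[OF hc]) (auto intro!: continuous_intros)
  have gb: "bounded (range (\<lambda>y. h (t * y)))" by (rule boundedI[of _ 1]) (use bd in auto)
  have sub: "filterlim (\<lambda>n. m * n) sequentially sequentially"
    using m by (intro filterlim_subseq) (auto simp: strict_mono_def)
  have 2: "(\<lambda>n. \<integral>w. h (t * nsum 0 (m * n) w) \<partial>M) \<longlonglongrightarrow> (\<integral>x. h (t * L x) \<partial>N)"
    using filterlim_compose[OF weak_conv_nsum[OF gc gb] sub] .
  define r where "r n = sd n / sd (m * n) - 1 / sqrt (real m)" for n
  have "(\<lambda>n. inverse (sd (m * n) / sd n)) \<longlonglongrightarrow> inverse (sqrt (real m))"
    using m by (intro tendsto_inverse sd_ratio_mult) auto
  then have r0: "r \<longlonglongrightarrow> 0" unfolding r_def[abs_def] by (simp add: LIM_zero inverse_eq_divide)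
  have "(\<lambda>n. (\<integral>w. h (t * nsum 0 (m * n) w) \<partial>M) - (\<integral>w. H (\<lambda>j. nsum (int (j * n)) n w) \<partial>M)) \<longlonglongrightarrow> 0"
  proof (rule Lim_null_comparison)
    have "(\<lambda>n. \<bar>t\<bar> * real m * \<bar>r n\<bar>) \<longlonglongrightarrow> \<bar>t\<bar> * real m * \<bar>0\<bar>" by (intro tendsto_intros r0)
    then show "(\<lambda>n. \<bar>t\<bar> * real m * \<bar>r n\<bar>) \<longlonglongrightarrow> 0" by simp
    have "eventually (\<lambda>n. sd (m * n) > 0) sequentially"
      by (rule eventually_compose_filterlim[OF sd_pos sub])
    with sd_pos show "eventually (\<lambda>n. norm ((\<integral>w. h (t * nsum 0 (m * n) w) \<partial>M) - (\<integral>w. H (\<lambda>j. nsum (int (j * n)) n w) \<partial>M)) \<le> \<bar>t\<bar> * real m * \<bar>r n\<bar>) sequentially"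
    proof eventually_elim
      case (elim n)
      have i1: "integrable M (\<lambda>w. h (t * nsum 0 (m * n) w))"
        using bd by (intro integrable_const_bound[where B = 1]) auto
      have i2: "integrable M (\<lambda>w. H (\<lambda>j. nsum (int (j * n)) n w))"
        using bdd_lip_bound[OF Hl] by (intro integrable_const_bound[where B = 1] bdd_lip_measurable_comp[OF Hl]) auto
      have iS: "integrable M (\<lambda>w. \<bar>nsum (int (j * n)) n w\<bar>)" for j
        by (intro L2_integrable L2_abs L2_nsum)
      have pt: "\<bar>h (t * nsum 0 (m * n) w) - H (\<lambda>j. nsum (int (j * n)) n w)\<bar> \<le> \<bar>t\<bar> * \<bar>r n\<bar> * (\<Sum>j<m. \<bar>nsum (int (j * n)) n w\<bar>)" for w
      proof -
        let ?s = "\<Sum>j<m. nsum (int (j * n)) n w"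
        have eq: "t * nsum 0 (m * n) w - t * (?s / sqrt (real m)) = t * r n * ?s"
          unfolding nsum_mult[OF elim] r_def by (simp add: algebra_simps)
        have "\<bar>h (t * nsum 0 (m * n) w) - H (\<lambda>j. nsum (int (j * n)) n w)\<bar> \<le> \<bar>t * r n * ?s\<bar>"
          unfolding H_def eq[symmetric] by (rule lip)
        also have "\<dots> \<le> \<bar>t\<bar> * \<bar>r n\<bar> * (\<Sum>j<m. \<bar>nsum (int (j * n)) n w\<bar>)"
          by (simp add: abs_mult mult_left_mono sum_abs)
        finally show ?thesis .
      qed
      have eq: "(\<integral>w. h (t * nsum 0 (m * n) w) \<partial>M) - (\<integral>w. H (\<lambda>j. nsum (int (j * n)) n w) \<partial>M)
          = (\<integral>w. h (t * nsum 0 (m * n) w) - H (\<lambda>j. nsum (int (j * n)) n w) \<partial>M)"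
        using i1 i2 by simp
      have "norm ((\<integral>w. h (t * nsum 0 (m * n) w) \<partial>M) - (\<integral>w. H (\<lambda>j. nsum (int (j * n)) n w) \<partial>M))
          \<le> (\<integral>w. \<bar>h (t * nsum 0 (m * n) w) - H (\<lambda>j. nsum (int (j * n)) n w)\<bar> \<partial>M)"
        unfolding eq real_norm_def by (rule integral_abs_bound)
      also have "\<dots> \<le> (\<integral>w. \<bar>t\<bar> * \<bar>r n\<bar> * (\<Sum>j<m. \<bar>nsum (int (j * n)) n w\<bar>) \<partial>M)"
        by (intro integral_mono integrable_abs Bochner_Integration.integrable_diff i1 i2 integrable_mult_right
            Bochner_Integration.integrable_sum iS pt)
      also have "\<dots> = \<bar>t\<bar> * \<bar>r n\<bar> * (\<Sum>j<m. \<integral>w. \<bar>nsum (int (j * n)) n w\<bar> \<partial>M)"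
        using iS by simp
      also have "\<dots> \<le> \<bar>t\<bar> * \<bar>r n\<bar> * (\<Sum>j<m. 1)"
        by (intro mult_left_mono sum_mono nsum_L1_le) auto
      finally show ?case by (simp add: ac_simps)
    qed
  qed
  from tendsto_diff[OF 2 this] have "(\<lambda>n. \<integral>w. H (\<lambda>j. nsum (int (j * n)) n w) \<partial>M) \<longlonglongrightarrow> (\<integral>x. h (t * L x) \<partial>N)" by simp
  from LIMSEQ_unique[OF this 1] show ?thesis unfolding H_def .
qed

lemma variance_L: "N.variance L = (\<integral>x. (L x)\<^sup>2 \<partial>N)"
  by (simp add: integral_L)

lemma L_zero:
  assumes "N.variance L = 0"
  shows "AE x in N. L x = 0"
proof -
  have "AE x in N. (L x)\<^sup>2 = 0"
    using assms integral_nonneg_eq_0_iff_AE[OF L2_sq[OF L2_L]] by (simp add: variance_L)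
  then show ?thesis by simp
qed

text \<open>By \<open>L_stable\<close> the characteristic function of the normalised sum of n > 0
  independent copies of L does not depend on n, while the central limit theorem sends it to the
  standard normal one; uniqueness identifies the law of L / \<sigma>.\<close>

lemma L_normal:
  assumes pos: "N.variance L > 0"
  shows "distributed N lborel L (\<lambda>x. ennreal (normal_density 0 (sqrt (N.variance L)) x))"
proof -
  define \<sigma> where "\<sigma> = sqrt (N.variance L)"
  have \<sigma>: "\<sigma> > 0" "\<sigma>\<^sup>2 = (\<integral>x. (L x)\<^sup>2 \<partial>N)" using pos by (simp_all add: \<sigma>_def variance_L)
  define \<mu> where "\<mu> = distr N borel L"
  interpret \<mu>: prob_space \<mu> unfolding \<mu>_def by (rule N.prob_space_distr) simp
  have s\<mu> [measurable_cong]: "sets \<mu> = sets borel" by (simp add: \<mu>_def)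
  define P where "P = PiM (UNIV :: nat set) (\<lambda>_. \<mu>)"
  interpret P: prob_space P unfolding P_def by (rule prob_space_PiM) (rule \<mu>.prob_space_axioms)
  define Z where "Z = (\<lambda>i (x :: nat \<Rightarrow> real). x i)"
  have Zm [measurable]: "Z i \<in> borel_measurable P" for i
    unfolding Z_def P_def using measurable_component_singleton[of i UNIV "\<lambda>_. \<mu>"] by (simp add: s\<mu> cong: measurable_cong_sets)
  have "P.indep_vars (\<lambda>_. \<mu>) Z UNIV"
    unfolding Z_def P_def by (rule indep_vars_PiM_components) (auto intro: \<mu>.prob_space_axioms)
  then have ind: "P.indep_vars (\<lambda>_. borel) Z UNIV"
    by (rule P.indep_vars_compose2[of _ _ _ "\<lambda>_ x. x" "\<lambda>_. borel", simplified]) (simp add: s\<mu> cong: measurable_cong_sets)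
  have law: "distr P borel (Z i) = \<mu>" for i
  proof -
    have "distr P borel (Z i) = distr P \<mu> (\<lambda>x. x i)" by (intro distr_cong) (auto simp: s\<mu> Z_def)
    also have "\<dots> = \<mu>" unfolding P_def by (rule distr_PiM_component) (auto intro: \<mu>.prob_space_axioms)
    finally show ?thesis .
  qed
  have law_int: "(\<integral>x. g (Z i x) \<partial>P) = (\<integral>x. g (L x) \<partial>N)" if [measurable]: "g \<in> borel_measurable borel" for g :: "real \<Rightarrow> real" and i
  proof -
    have "(\<integral>x. g (Z i x) \<partial>P) = (\<integral>y. g y \<partial>distr P borel (Z i))" by (rule integral_distr[symmetric]) measurable
    also have "\<dots> = (\<integral>y. g y \<partial>distr N borel L)" by (simp only: law \<mu>_def)
    also have "\<dots> = (\<integral>x. g (L x) \<partial>N)" by (rule integral_distr) measurable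
    finally show ?thesis .
  qed
  have law_integrable: "integrable P (\<lambda>x. (Z i x)\<^sup>2)" for i
  proof -
    have "integrable \<mu> (\<lambda>y. y\<^sup>2)"
      unfolding \<mu>_def using L2_sq[OF L2_L] by (subst integrable_distr_eq) auto
    then show ?thesis
      unfolding law[of i, symmetric] by (subst (asm) integrable_distr_eq) auto
  qed
  have EZ: "(\<integral>x. Z i x \<partial>P) = 0" for i using law_int[of "\<lambda>x. x" i] by (simp add: integral_L)
  have VZ: "P.variance (Z i) = \<sigma>\<^sup>2" for i using law_int[of "\<lambda>x. x\<^sup>2" i] by (simp add: EZ \<sigma>)
  have clt: "weak_conv_m (\<lambda>n. distr P borel (\<lambda>x. (\<Sum>i<n. Z i x) / sqrt (real n * \<sigma>\<^sup>2))) std_normal_distribution"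
    by (rule P.central_limit_theorem_zero_mean[OF ind EZ \<sigma>(1) law_integrable VZ law])
  have "char (distr N borel (\<lambda>x. L x / \<sigma>)) t = char std_normal_distribution t" for t
  proof -
    have rd: "real_distribution (distr P borel (\<lambda>x. (\<Sum>i<n. Z i x) / sqrt (real n * \<sigma>\<^sup>2)))" for n
      by (rule P.real_distribution_distr) measurable
    have lim: "(\<lambda>n. char (distr P borel (\<lambda>x. (\<Sum>i<n. Z i x) / sqrt (real n * \<sigma>\<^sup>2))) t) \<longlonglongrightarrow> char std_normal_distribution t"
      by (rule levy_continuity1[OF rd _ clt]) (rule real_dist_normal_dist)
    have eq: "char (distr P borel (\<lambda>x. (\<Sum>i<n. Z i x) / sqrt (real n * \<sigma>\<^sup>2))) t = char (distr N borel (\<lambda>x. L x / \<sigma>)) t" if n: "n > 0" for n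
    proof -
      have indn: "P.indep_vars (\<lambda>_. borel) Z {..<n}" by (rule P.indep_vars_subset[OF ind]) simp
      have law': "distr P borel (Z j) = distr N borel L" for j using law[of j] by (simp add: \<mu>_def)
      have rew: "(\<Sum>i<n. Z i x) / sqrt (real n * \<sigma>\<^sup>2) = ((\<Sum>j<n. Z j x) / sqrt (real n)) / \<sigma>" for x
        using \<sigma>(1) by (simp add: real_sqrt_mult)
      have st: "(\<integral>x. h (t / \<sigma> * L x) \<partial>N) = (\<integral>x. h (t / \<sigma> * ((\<Sum>j<n. Z j x) / sqrt (real n))) \<partial>P)"
        if "\<And>y. \<bar>h y\<bar> \<le> 1" "\<And>y z. \<bar>h y - h z\<bar> \<le> \<bar>y - z\<bar>" for h
        by (rule L_stable[OF P.prob_space_axioms indn Zm law' n that])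
      have cl: "\<bar>cos y - cos z\<bar> \<le> \<bar>y - z\<bar>" and sl: "\<bar>sin y - sin z\<bar> \<le> \<bar>y - z\<bar>" for y z :: real
      proof -
        have *: "\<bar>g y - g z\<bar> \<le> \<bar>y - z\<bar>" if "\<And>x. (g has_real_derivative g' x) (at x)" "\<And>x. \<bar>g' x\<bar> \<le> 1" for g g' :: "real \<Rightarrow> real"
          using field_differentiable_bound[of UNIV g g' 1 y z] that by simp
        show "\<bar>cos y - cos z\<bar> \<le> \<bar>y - z\<bar>" by (rule *[of cos "\<lambda>x. - sin x"]) (auto intro!: derivative_eq_intros)
        show "\<bar>sin y - sin z\<bar> \<le> \<bar>y - z\<bar>" by (rule *[of sin cos]) (auto intro!: derivative_eq_intros)
      qed
      have "char (distr P borel (\<lambda>x. (\<Sum>i<n. Z i x) / sqrt (real n * \<sigma>\<^sup>2))) t =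
          Complex (\<integral>x. cos (t * (((\<Sum>j<n. Z j x) / sqrt (real n)) / \<sigma>)) \<partial>P) (\<integral>x. sin (t * (((\<Sum>j<n. Z j x) / sqrt (real n)) / \<sigma>)) \<partial>P)"
        unfolding rew by (rule char_eq_trig[OF P.prob_space_axioms]) measurable
      also have "\<dots> = Complex (\<integral>x. cos (t * (L x / \<sigma>)) \<partial>N) (\<integral>x. sin (t * (L x / \<sigma>)) \<partial>N)"
        using st[of cos] st[of sin] cl sl by (simp add: field_simps)
      also have "\<dots> = char (distr N borel (\<lambda>x. L x / \<sigma>)) t"
        by (rule char_eq_trig[OF N, symmetric]) measurable
      finally show ?thesis .
    qed
    have "(\<lambda>n. char (distr P borel (\<lambda>x. (\<Sum>i<n. Z i x) / sqrt (real n * \<sigma>\<^sup>2))) t) \<longlonglongrightarrow> char (distr N borel (\<lambda>x. L x / \<sigma>)) t"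
      by (rule tendsto_eventually) (use eventually_gt_at_top[of "0::nat"] in eventually_elim, simp add: eq)
    from LIMSEQ_unique[OF this lim] show ?thesis .
  qed
  then have "char (distr N borel (\<lambda>x. L x / \<sigma>)) = char std_normal_distribution" by auto
  then have law_std: "distr N borel (\<lambda>x. L x / \<sigma>) = std_normal_distribution"
    by (intro Levy_uniqueness N.real_distribution_distr real_dist_normal_dist) measurable
  have "distributed N lborel (\<lambda>x. (L x - 0) / \<sigma>) std_normal_density"
    unfolding distributed_def using law_std by (simp add: distr_cong[of N N lborel borel])
  then show ?thesis
    using N.normal_standard_normal_convert[OF \<sigma>(1), of L 0] by (simp add: \<sigma>_def)
qed

end

section \<open>Weak convergence in the Skorokhod space\<close>

text \<open>The limit has continuous paths, so continuity with respect to this finer, capped uniform distance is all that is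
  used of Skorokhod continuity; the cap makes the supremum meaningful for arbitrary functions.\<close>

definition unif_dist :: "(real \<Rightarrow> real) \<Rightarrow> (real \<Rightarrow> real) \<Rightarrow> real" where
  "unif_dist x y = (SUP t\<in>{0..1}. min 1 \<bar>x t - y t\<bar>)"

lemma unif_dist_bdd: "bdd_above ((\<lambda>t. min 1 \<bar>x t - y t\<bar>) ` {0..1::real})" for x y :: "real \<Rightarrow> real"
  by (rule bdd_aboveI[of _ 1]) auto

lemma unif_dist_upper: "t \<in> {0..1} \<Longrightarrow> min 1 \<bar>x t - y t\<bar> \<le> unif_dist x y"
  unfolding unif_dist_def by (rule cSUP_upper[OF _ unif_dist_bdd])

lemma unif_dist_least: "(\<And>t. t \<in> {0..1} \<Longrightarrow> min 1 \<bar>x t - y t\<bar> \<le> e) \<Longrightarrow> unif_dist x y \<le> e"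
  unfolding unif_dist_def by (rule cSUP_least) auto

lemma unif_dist_nonneg: "0 \<le> unif_dist x y"
  using unif_dist_upper[of 0 x y] by (simp add: min_def split: if_splits)

lemma unif_dist_le_1: "unif_dist x y \<le> 1"
  by (rule unif_dist_least) simp

lemma unif_dist_eq_0: "(\<And>t. t \<in> {0..1} \<Longrightarrow> x t = y t) \<Longrightarrow> unif_dist x y = 0"
  by (rule antisym[OF unif_dist_least unif_dist_nonneg]) simp

lemma unif_dist_commute: "unif_dist x y = unif_dist y x"
  unfolding unif_dist_def by (simp add: abs_minus_commute)

lemma unif_dist_triangle: "unif_dist x z \<le> unif_dist x y + unif_dist y z"
proof (rule unif_dist_least)
  fix t :: real assume t: "t \<in> {0..1}"
  have "\<bar>x t - z t\<bar> \<le> \<bar>x t - y t\<bar> + \<bar>y t - z t\<bar>" by linarith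
  then have "min 1 \<bar>x t - z t\<bar> \<le> min 1 \<bar>x t - y t\<bar> + min 1 \<bar>y t - z t\<bar>" by (auto simp: min_def)
  also have "\<dots> \<le> unif_dist x y + unif_dist y z" by (intro add_mono unif_dist_upper t)
  finally show "min 1 \<bar>x t - z t\<bar> \<le> unif_dist x y + unif_dist y z" .
qed

text \<open>The identity is an admissible time change.\<close>

lemma skorokhod_dist_le:
  assumes e: "e > 0" and "\<And>t. t \<in> {0..1} \<Longrightarrow> \<bar>x t - y t\<bar> \<le> e"
  shows "skorokhod_dist x y \<le> e"
  unfolding skorokhod_dist_def
proof (rule cInf_lower)
  have "(\<lambda>t. t) \<in> time_changes"
    by (auto simp: time_changes_def strict_mono_on_def)
  then show "e \<in> {\<epsilon>. \<epsilon> > 0 \<and> (\<exists>r\<in>time_changes. \<forall>t\<in>{0..1}. \<bar>r t - t\<bar> \<le> \<epsilon> \<and> \<bar>x t - y (r t)\<bar> \<le> \<epsilon>)}"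
    using assms by (auto intro!: bexI[of _ "\<lambda>t. t"])
qed (auto intro: bdd_belowI[of _ 0])

lemma bounded_cont_D_unif_dist:
  assumes F: "bounded_cont_D F" and x: "x \<in> D01" and e: "e > 0"
  shows "\<exists>d>0. \<forall>y\<in>D01. unif_dist x y < d \<longrightarrow> \<bar>F y - F x\<bar> < e"
proof -
  obtain d0 where d0: "d0 > 0" "\<And>y. y \<in> D01 \<Longrightarrow> skorokhod_dist x y < d0 \<Longrightarrow> \<bar>F y - F x\<bar> < e"
    using F x e unfolding bounded_cont_D_def by meson
  \<comment> \<open>Staying below 1 keeps the cap in \<open>unif_dist\<close> inactive.\<close>
  define d where "d = min (d0 / 2) (1 / 2)"
  have d: "0 < d" "d < d0" "d < 1" using d0(1) by (auto simp: d_def)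
  have "\<bar>F y - F x\<bar> < e" if y: "y \<in> D01" "unif_dist x y < d" for y
  proof (rule d0(2)[OF y(1)])
    have "skorokhod_dist x y \<le> d"
    proof (rule skorokhod_dist_le[OF d(1)])
      fix t :: real assume "t \<in> {0..1}"
      then have "min 1 \<bar>x t - y t\<bar> < d" using unif_dist_upper[of t x y] y(2) by simp
      then show "\<bar>x t - y t\<bar> \<le> d" using d(3) by (simp add: min_def split: if_splits)
    qed
    then show "skorokhod_dist x y < d0" using d(2) by simp
  qed
  then show ?thesis using d(1) by blast
qed

text \<open>Pasch-Hausdorff envelopes: Lipschitz functionals increasing to a given continuous one, which reduces weak
  convergence to Lipschitz functionals.\<close>

definition lip_reg :: "((real \<Rightarrow> real) \<Rightarrow> real) \<Rightarrow> nat \<Rightarrow> (real \<Rightarrow> real) \<Rightarrow> real" where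
  "lip_reg F k x = (INF y\<in>D01. F y + real k * unif_dist x y)"

lemma D01_nonempty: "D01 \<noteq> {}"
proof -
  have "(\<lambda>_. 0) \<in> D01" by (auto simp: D01_def)
  then show ?thesis by blast
qed

context
  fixes F :: "(real \<Rightarrow> real) \<Rightarrow> real" and B :: real
  assumes FB: "\<And>x. x \<in> D01 \<Longrightarrow> \<bar>F x\<bar> \<le> B"
begin

lemma lip_reg_bdd: "bdd_below ((\<lambda>y. F y + real k * unif_dist x y) ` D01)"
proof (rule bdd_belowI2)
  fix y assume "y \<in> D01"
  then have "- B \<le> F y" using FB[of y] by (simp add: abs_le_iff)
  moreover have "0 \<le> real k * unif_dist x y" by (simp add: unif_dist_nonneg)
  ultimately show "- B \<le> F y + real k * unif_dist x y" by simp
qed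

lemma lip_reg_lipschitz_aux: "lip_reg F k x \<le> lip_reg F k x' + real k * unif_dist x x'"
proof -
  have "lip_reg F k x - real k * unif_dist x x' \<le> lip_reg F k x'"
    unfolding lip_reg_def[of F k x']
  proof (rule cINF_greatest[OF D01_nonempty])
    fix y assume y: "y \<in> D01"
    have "lip_reg F k x \<le> F y + real k * unif_dist x y"
      unfolding lip_reg_def by (rule cINF_lower[OF lip_reg_bdd y])
    also have "real k * unif_dist x y \<le> real k * (unif_dist x x' + unif_dist x' y)"
      by (intro mult_left_mono unif_dist_triangle) simp
    finally show "lip_reg F k x - real k * unif_dist x x' \<le> F y + real k * unif_dist x' y"
      by (simp add: algebra_simps)
  qed
  then show ?thesis by simp
qed

lemma lip_reg_lipschitz: "\<bar>lip_reg F k x - lip_reg F k x'\<bar> \<le> real k * unif_dist x x'"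
  using lip_reg_lipschitz_aux[of k x x'] lip_reg_lipschitz_aux[of k x' x] unif_dist_commute[of x x'] by simp

lemma lip_reg_le:
  assumes "x \<in> D01"
  shows "lip_reg F k x \<le> F x"
proof -
  have "lip_reg F k x \<le> F x + real k * unif_dist x x"
    unfolding lip_reg_def by (rule cINF_lower[OF lip_reg_bdd assms])
  then show ?thesis by (simp add: unif_dist_eq_0)
qed

lemma lip_reg_ge: "- B \<le> lip_reg F k x"
  unfolding lip_reg_def
proof (rule cINF_greatest[OF D01_nonempty])
  fix y assume "y \<in> D01"
  then have "- B \<le> F y" using FB[of y] by (simp add: abs_le_iff)
  moreover have "0 \<le> real k * unif_dist x y" by (simp add: unif_dist_nonneg)
  ultimately show "- B \<le> F y + real k * unif_dist x y" by simp
qed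

text \<open>Envelopes are evaluated at arbitrary functions, where F itself is not bounded. One
  competitor in \<open>D01\<close> and the cap of \<open>unif_dist\<close> give a bound, at the
  price of its depending on k.\<close>

lemma lip_reg_bounded: "\<bar>lip_reg F k x\<bar> \<le> B + real k"
proof -
  have "lip_reg F k x \<le> B + real k"
  proof -
    obtain y where y: "y \<in> D01" using D01_nonempty by blast
    have "lip_reg F k x \<le> F y + real k * unif_dist x y"
      unfolding lip_reg_def by (rule cINF_lower[OF lip_reg_bdd y])
    also have "\<dots> \<le> B + real k * 1"
      using FB[OF y] by (intro add_mono mult_left_mono unif_dist_le_1) (auto simp: abs_le_iff)
    finally show ?thesis by simp
  qed
  then show ?thesis using lip_reg_ge[of k x] by simp
qed

text \<open>On \<open>D01\<close> the bound is independent of k, as dominated convergence in k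
  requires.\<close>

lemma lip_reg_bounded_D01: "x \<in> D01 \<Longrightarrow> \<bar>lip_reg F k x\<bar> \<le> B"
  using lip_reg_ge[of k x] lip_reg_le[of x k] FB[of x] by simp

text \<open>A competitor close to x has nearly the value F x by continuity; a distant one pays the
  penalty k d \<ge> 2 B, at least as much as F can vary.\<close>

lemma lip_reg_tendsto:
  assumes F: "bounded_cont_D F" and x: "x \<in> D01"
  shows "(\<lambda>k. lip_reg F k x) \<longlonglongrightarrow> F x"
proof (rule tendstoI)
  fix e :: real assume e: "e > 0"
  obtain d where d: "d > 0" "\<And>y. y \<in> D01 \<Longrightarrow> unif_dist x y < d \<Longrightarrow> \<bar>F y - F x\<bar> < e / 2"
    using bounded_cont_D_unif_dist[OF F x, of "e / 2"] e by auto
  obtain k0 :: nat where k0: "2 * B / d \<le> real k0" using real_arch_simple by blast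
  show "eventually (\<lambda>k. dist (lip_reg F k x) (F x) < e) sequentially"
    using eventually_ge_at_top[of k0]
  proof eventually_elim
    case (elim k)
    have k: "2 * B \<le> real k * d"
    proof -
      have "2 * B / d \<le> real k" using k0 elim by linarith
      then show ?thesis using d(1) by (simp add: field_simps)
    qed
    have "F x - e / 2 \<le> lip_reg F k x"
      unfolding lip_reg_def
    proof (rule cINF_greatest[OF D01_nonempty])
      fix y assume y: "y \<in> D01"
      show "F x - e / 2 \<le> F y + real k * unif_dist x y"
      proof (cases "unif_dist x y < d")
        case True
        have "\<bar>F y - F x\<bar> < e / 2" by (rule d(2)[OF y True])
        moreover have "0 \<le> real k * unif_dist x y" by (simp add: unif_dist_nonneg)
        ultimately show ?thesis by linarith
      next
        case False
        have "real k * d \<le> real k * unif_dist x y" using False by (intro mult_left_mono) auto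
        then show ?thesis using k FB[OF y] FB[OF x] e by linarith
      qed
    qed
    then show ?case using lip_reg_le[OF x, of k] e by (simp add: dist_real_def)
  qed
qed

end

section \<open>Step functions and time grids\<close>

lemma floor_step_D01:
  assumes x: "\<And>t. x t = g (nat \<lfloor>real n * t\<rfloor>)"
  shows "x \<in> D01"
proof (cases "n = 0")
  case True
  then have "x = (\<lambda>_. g 0)" using x by auto
  then show ?thesis by (auto simp: D01_def)
next
  case False
  then have n: "real n > 0" by simp
  have "(x \<longlongrightarrow> x t) (at_right t)" for t
  proof (rule tendsto_eventually)
    have "t < (of_int \<lfloor>real n * t\<rfloor> + 1) / real n"
      using n by (simp add: pos_less_divide_eq mult.commute[of t])
    then have "eventually (\<lambda>s. s \<in> {t<..<(of_int \<lfloor>real n * t\<rfloor> + 1) / real n}) (at_right t)"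
      by (rule eventually_at_right_real)
    then show "eventually (\<lambda>s. x s = x t) (at_right t)"
    proof eventually_elim
      case (elim s)
      have "real n * t \<le> real n * s" using elim n by (intro mult_left_mono) auto
      moreover have "real n * s < of_int \<lfloor>real n * t\<rfloor> + 1" using elim n by (simp add: pos_less_divide_eq mult.commute[of s])
      ultimately have "\<lfloor>real n * s\<rfloor> = \<lfloor>real n * t\<rfloor>" by (intro floor_unique) linarith+
      then show ?case by (simp add: x)
    qed
  qed
  \<comment> \<open>Just to the left of t the floor of n s is the ceiling of n t minus 1, whether or
    not n t is an integer.\<close>
  moreover have "(x \<longlongrightarrow> g (nat (\<lceil>real n * t\<rceil> - 1))) (at_left t)" for t
  proof (rule tendsto_eventually)
    have "(of_int \<lceil>real n * t\<rceil> - 1) / real n < t"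
      using n by (simp add: pos_divide_less_eq mult.commute[of t]) linarith
    then have "eventually (\<lambda>s. s \<in> {(of_int \<lceil>real n * t\<rceil> - 1) / real n<..<t}) (at_left t)"
      by (rule eventually_at_left_real)
    then show "eventually (\<lambda>s. x s = g (nat (\<lceil>real n * t\<rceil> - 1))) (at_left t)"
    proof eventually_elim
      case (elim s)
      have "real n * s < real n * t" using elim n by (intro mult_strict_left_mono) auto
      moreover have "of_int \<lceil>real n * t\<rceil> - 1 < real n * s" using elim n by (simp add: pos_divide_less_eq mult.commute[of s])
      ultimately have "\<lfloor>real n * s\<rfloor> = \<lceil>real n * t\<rceil> - 1" by (intro floor_unique) (simp, linarith)+
      then show ?case by (simp add: x)
    qed
  qed
  ultimately show ?thesis unfolding D01_def by blast
qed

lemma continuous_on_D01: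
  assumes "continuous_on {0..1} x"
  shows "x \<in> D01"
  unfolding D01_def
proof (intro CollectI conjI ballI)
  fix t :: real assume t: "t \<in> {0..<1}"
  then show "(x \<longlongrightarrow> x t) (at_right t)"
    by (intro continuous_on_Icc_at_rightD[of t 1] continuous_on_subset[OF assms]) auto
next
  fix t :: real assume t: "t \<in> {0<..1}"
  then have "(x \<longlongrightarrow> x t) (at_left t)"
    by (intro continuous_on_Icc_at_leftD[of 0 t] continuous_on_subset[OF assms]) auto
  then show "\<exists>l. (x \<longlongrightarrow> l) (at_left t)" ..
qed

text \<open>\<open>y\<close> lists increments rather than values, so that normalised block sums can
  be inserted directly. By the minimum only the first m coordinates matter, at any t.\<close>

definition step :: "nat \<Rightarrow> (nat \<Rightarrow> real) \<Rightarrow> real \<Rightarrow> real" where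
  "step m y t = (\<Sum>j<min m (nat \<lfloor>real m * t\<rfloor>). y j)"

lemma unif_dist_step_le: "unif_dist (step m y) (step m z) \<le> (\<Sum>j<m. \<bar>y j - z j\<bar>)"
proof (rule unif_dist_least)
  fix t :: real
  have "min 1 \<bar>step m y t - step m z t\<bar> \<le> \<bar>\<Sum>j<min m (nat \<lfloor>real m * t\<rfloor>). y j - z j\<bar>"
    by (simp add: step_def sum_subtractf)
  also have "\<dots> \<le> (\<Sum>j<min m (nat \<lfloor>real m * t\<rfloor>). \<bar>y j - z j\<bar>)" by (rule sum_abs)
  also have "\<dots> \<le> (\<Sum>j<m. \<bar>y j - z j\<bar>)" by (rule sum_mono2) auto
  finally show "min 1 \<bar>step m y t - step m z t\<bar> \<le> (\<Sum>j<m. \<bar>y j - z j\<bar>)" .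
qed

lemma bdd_lip_step:
  assumes G: "\<And>x x'. \<bar>G x - G x'\<bar> \<le> K * unif_dist x x'" "\<And>x. \<bar>G x\<bar> \<le> B" and K: "0 \<le> K" and a: "0 \<le> a"
  shows "bdd_lip m (\<lambda>y. G (step m (\<lambda>j. a * y j))) (K * a) B"
  unfolding bdd_lip_def
proof (intro conjI allI G(2))
  fix y z :: "nat \<Rightarrow> real"
  have "\<bar>G (step m (\<lambda>j. a * y j)) - G (step m (\<lambda>j. a * z j))\<bar> \<le> K * (\<Sum>j<m. \<bar>a * y j - a * z j\<bar>)"
    by (rule order_trans[OF G(1) mult_left_mono[OF unif_dist_step_le K]])
  also have "(\<Sum>j<m. \<bar>a * y j - a * z j\<bar>) = a * (\<Sum>j<m. \<bar>y j - z j\<bar>)"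
    unfolding sum_distrib_left using a
    by (intro sum.cong refl) (simp add: right_diff_distrib[symmetric] abs_mult)
  finally show "\<bar>G (step m (\<lambda>j. a * y j)) - G (step m (\<lambda>j. a * z j))\<bar> \<le> K * a * (\<Sum>j<m. \<bar>y j - z j\<bar>)"
    by (simp add: mult.assoc)
qed (use K a in simp)

lemma step_approx_continuous:
  assumes x: "continuous_on {0..1} x" "x 0 = 0"
  shows "(\<lambda>m. unif_dist (step m (\<lambda>j. x (real (Suc j) / real m) - x (real j / real m))) x) \<longlonglongrightarrow> 0"
proof (rule tendstoI)
  fix e :: real assume e: "e > 0"
  have "uniformly_continuous_on {0..1} x" by (rule compact_uniformly_continuous[OF x(1)]) simp
  then obtain d where d: "d > 0" "\<And>s t. s \<in> {0..1} \<Longrightarrow> t \<in> {0..1} \<Longrightarrow> dist t s < d \<Longrightarrow> dist (x t) (x s) < e / 2"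
    using e unfolding uniformly_continuous_on_def by (metis half_gt_zero)
  obtain m0 :: nat where m0: "1 / d < real m0" using reals_Archimedean2 by blast
  show "eventually (\<lambda>m. dist (unif_dist (step m (\<lambda>j. x (real (Suc j) / real m) - x (real j / real m))) x) 0 < e) sequentially"
    using eventually_ge_at_top[of "Suc m0"]
  proof eventually_elim
    case (elim m)
    then have m: "real m > 0" "1 / d < real m" using m0 by auto
    have "unif_dist (step m (\<lambda>j. x (real (Suc j) / real m) - x (real j / real m))) x \<le> e / 2"
    proof (rule unif_dist_least)
      fix t :: real assume t: "t \<in> {0..1}"
      define i where "i = nat \<lfloor>real m * t\<rfloor>"
      have mt: "0 \<le> real m * t" "real m * t \<le> real m" using t m by (auto simp: mult_left_le)
      have i: "real i \<le> real m * t" "real m * t < real i + 1"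
        using mt(1) by (simp_all add: i_def)
      have im: "i \<le> m" using i mt by linarith
      have "step m (\<lambda>j. x (real (Suc j) / real m) - x (real j / real m)) t = x (real i / real m) - x (real 0 / real m)"
        unfolding step_def i_def[symmetric] using im by (simp only: min_absorb2 sum_lessThan_telescope[of "\<lambda>j. x (real j / real m)"])
      then have eq: "step m (\<lambda>j. x (real (Suc j) / real m) - x (real j / real m)) t = x (real i / real m)"
        using x(2) by simp
      have "real i / real m \<in> {0..1}" using im m by simp
      moreover have "dist (real i / real m) t < d"
      proof -
        have "\<bar>real i / real m - t\<bar> * real m = \<bar>(real i / real m - t) * real m\<bar>" using m by (simp add: abs_mult)
        also have "(real i / real m - t) * real m = real i - real m * t" using m by (simp add: field_simps)
        also have "\<bar>real i - real m * t\<bar> \<le> 1" using i by simp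
        also have "1 < d * real m" using m d(1) by (simp add: field_simps)
        finally show ?thesis using m by (simp add: dist_real_def)
      qed
      ultimately have "\<bar>x (real i / real m) - x t\<bar> < e / 2" using d(2)[OF t] by (simp add: dist_real_def)
      then show "min 1 \<bar>step m (\<lambda>j. x (real (Suc j) / real m) - x (real j / real m)) t - x t\<bar> \<le> e / 2"
        unfolding eq by (intro order_trans[OF min.cobounded2]) simp
    qed
    then show ?case using e unif_dist_nonneg by simp
  qed
qed

text \<open>\<open>k\<close> falls short of n / m by less than 1, so after i blocks the grids have
  drifted apart by at most i \<le> m \<le> k steps. Of the two blocks allowed, one is for the
  position inside the current block and one for this drift.\<close>

lemma grid_index:
  fixes t :: real
  assumes t: "0 \<le> t" "t \<le> 1" and m: "m > 0" and k: "k = n div m" "m \<le> k"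
  defines "i \<equiv> nat \<lfloor>real m * t\<rfloor>" and "a \<equiv> nat \<lfloor>real n * t\<rfloor>"
  shows "i \<le> m" "i * k \<le> a" "a \<le> i * k + 2 * k" "a \<le> n"
proof -
  have mt: "0 \<le> real m * t" "real m * t \<le> real m" and nt: "0 \<le> real n * t" "real n * t \<le> real n"
    using t by (auto simp: mult_left_le)
  have i: "real i \<le> real m * t" "real m * t < real i + 1" using mt(1) by (simp_all add: i_def)
  have a: "real a \<le> real n * t" "real n * t < real a + 1" using nt(1) by (simp_all add: a_def)
  show im: "i \<le> m" using i mt by linarith
  show "a \<le> n" using a nt by linarith
  have kn: "k * m \<le> n" "n < (k + 1) * m"
    unfolding k(1) using m by (simp_all add: dividend_less_div_times)
  have "real (i * k) \<le> real (k * m) * t"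
    using mult_left_mono[OF i(1), of "real k"] by (simp add: ac_simps)
  also have "\<dots> \<le> real n * t" using kn(1) t by (intro mult_right_mono) (simp_all only: of_nat_le_iff)
  finally show "i * k \<le> a" using a by linarith
  have "real n * t \<le> real ((k + 1) * m) * t" using kn(2) t by (intro mult_right_mono) (simp_all only: of_nat_le_iff less_imp_le)
  also have "\<dots> = real (k + 1) * (real m * t)" by (simp only: of_nat_mult mult.assoc)
  also have "\<dots> \<le> real (k + 1) * (real i + 1)" using i(2) by (intro mult_left_mono) auto
  also have "\<dots> = real ((k + 1) * (i + 1))" by (simp only: of_nat_mult of_nat_add of_nat_1)
  finally have "real a < real ((k + 1) * (i + 1)) + 1" using a by linarith
  then have "a \<le> (k + 1) * (i + 1)" by linarith
  show "a \<le> i * k + 2 * k"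
  proof (cases "i = m")
    case True
    have "n \<le> i * k + m" unfolding True k(1) using m by (metis add.commute le_add_diff_inverse mod_less_divisor mult.commute mult_div_mod_eq nat_add_left_cancel_le less_imp_le)
    then show ?thesis using \<open>a \<le> n\<close> k(2) by linarith
  next
    case False
    have "real n * t < real ((k + 1) * (i + 1))"
    proof (cases "t = 0")
      case True
      have "0 < (k + 1) * (i + 1)" by simp
      then show ?thesis unfolding True mult_zero_right of_nat_0_less_iff .
    next
      case False
      have "real n * t < real ((k + 1) * m) * t" using kn(2) t False by (intro mult_strict_right_mono) (simp_all only: of_nat_less_iff)
      also have "\<dots> = real (k + 1) * (real m * t)" by (simp only: of_nat_mult mult.assoc)
      also have "\<dots> \<le> real (k + 1) * (real i + 1)" using i(2) by (intro mult_left_mono) auto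
      also have "\<dots> = real ((k + 1) * (i + 1))" by (simp only: of_nat_mult of_nat_add of_nat_1)
      finally show ?thesis .
    qed
    then have "a < (k + 1) * (i + 1)" using a by linarith
    then have "a \<le> i * k + k + i" by (simp add: algebra_simps)
    then show ?thesis using im k(2) by linarith
  qed
qed

section \<open>Approximation of the rescaled walk by block sums\<close>

context cond_clt
begin

definition walk :: "nat \<Rightarrow> 'w \<Rightarrow> real \<Rightarrow> real" where
  "walk n w t = bsum 0 (nat \<lfloor>real n * t\<rfloor>) (path w) / sd n"

lemma walk_D01: "walk n w \<in> D01"
  by (rule floor_step_D01[of _ "\<lambda>i. bsum 0 i (path w) / sd n" n]) (simp add: walk_def)

text \<open>The walk is itself a step function of n increments, so measurability of its Lipschitz
  functionals comes from \<open>bdd_lip_step\<close>, whose scale is set to 1.\<close>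

lemma walk_step: "unif_dist (walk n w) (step n (\<lambda>j. 1 * (f (\<xi> (int j + 1) w) / sd n))) = 0"
proof (rule unif_dist_eq_0)
  fix t :: real assume t: "t \<in> {0..1}"
  have "real n * t \<le> real n" using t by (simp add: mult_left_le)
  then have "nat \<lfloor>real n * t\<rfloor> \<le> n" by linarith
  moreover have "bsum 0 i (path w) / sd n = (\<Sum>j<i. f (\<xi> (int j + 1) w) / sd n)" for i
    by (induction i) (simp_all add: bsum_def add_divide_distrib add.commute)
  ultimately show "walk n w t = step n (\<lambda>j. 1 * (f (\<xi> (int j + 1) w) / sd n)) t"
    by (simp add: walk_def step_def)
qed

lemma measurable_walk:
  assumes G: "\<And>x x'. \<bar>G x - G x'\<bar> \<le> K * unif_dist x x'" "\<And>x. \<bar>G x\<bar> \<le> B" and K: "0 \<le> K"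
  shows "(\<lambda>w. G (walk n w)) \<in> borel_measurable M"
proof -
  have "G (walk n w) = G (step n (\<lambda>j. 1 * (f (\<xi> (int j + 1) w) / sd n)))" for w
    using G(1)[of "walk n w" "step n (\<lambda>j. 1 * (f (\<xi> (int j + 1) w) / sd n))"] unfolding walk_step by simp
  moreover have "(\<lambda>w. G (step n (\<lambda>j. 1 * (f (\<xi> (int j + 1) w) / sd n)))) \<in> borel_measurable M"
    by (rule bdd_lip_measurable_comp[OF bdd_lip_step[OF G K]])
       (auto intro!: borel_measurable_divide L2_measurable[OF L2_f_xi])
  ultimately show ?thesis by simp
qed

text \<open>Up to the last grid time the two paths differ only in normalisation, with the factors
  \<open>sd k / sd n\<close> and 1 / sqrt m; beyond it the walk adds at most 2 k summands, which
  \<open>good\<close> controls.\<close>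

lemma unif_dist_walk_step:
  assumes m: "m > 0" and k: "k = n div m" "m \<le> k" and e: "e > 0" and s: "sd n > 0" "sd k > 0"
    and good: "\<forall>i\<le>m. \<forall>l\<le>2 * k. \<bar>bsum (int (i * k)) l (path w)\<bar> \<le> e * sd n"
  shows "unif_dist (walk n w) (step m (\<lambda>j. (1 / sqrt (real m)) * nsum (int (j * k)) k w))
    \<le> e + \<bar>sd k / sd n - 1 / sqrt (real m)\<bar> * (\<Sum>j<m. \<bar>nsum (int (j * k)) k w\<bar>)"
proof (rule unif_dist_least)
  fix t :: real assume t: "t \<in> {0..1}"
  define i where "i = nat \<lfloor>real m * t\<rfloor>"
  define a where "a = nat \<lfloor>real n * t\<rfloor>"
  have g: "i \<le> m" "i * k \<le> a" "a \<le> i * k + 2 * k"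
    using grid_index[of t m k n] t m k by (auto simp: i_def a_def)
  define r where "r = sd k / sd n - 1 / sqrt (real m)"
  have blocks: "bsum 0 (i * k) (path w) = (\<Sum>j<i. bsum (int (j * k)) k (path w))" for i
  proof (induction i)
    case (Suc i)
    then show ?case using bsum_add[of 0 "i * k" k "path w"] by (simp add: add.commute)
  qed (simp add: bsum_def)
  have st: "step m (\<lambda>j. (1 / sqrt (real m)) * nsum (int (j * k)) k w) t = (1 / sqrt (real m)) * (\<Sum>j<i. nsum (int (j * k)) k w)"
    using g(1) by (simp add: step_def i_def[symmetric] min_absorb2 sum_distrib_left)
  have W: "walk n w t = bsum (int (i * k)) (a - i * k) (path w) / sd n + (sd k / sd n) * (\<Sum>j<i. nsum (int (j * k)) k w)"
  proof -
    have "walk n w t = (bsum 0 (i * k) (path w) + bsum (int (i * k)) (a - i * k) (path w)) / sd n"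
      using bsum_add[of 0 "i * k" "a - i * k" "path w"] g(2) by (simp add: walk_def a_def[symmetric])
    moreover have "(sd k / sd n) * (\<Sum>j<i. nsum (int (j * k)) k w) = bsum 0 (i * k) (path w) / sd n"
      using s by (simp add: blocks nsum_def sum_divide_distrib[symmetric])
    ultimately show ?thesis by (simp only: add_divide_distrib add.commute)
  qed
  have eq: "walk n w t - step m (\<lambda>j. (1 / sqrt (real m)) * nsum (int (j * k)) k w) t
      = bsum (int (i * k)) (a - i * k) (path w) / sd n + r * (\<Sum>j<i. nsum (int (j * k)) k w)"
    unfolding W st r_def by (simp add: left_diff_distrib)
  have 1: "\<bar>bsum (int (i * k)) (a - i * k) (path w) / sd n\<bar> \<le> e"
    using good g s by (simp add: abs_divide divide_le_eq)
  have "\<bar>\<Sum>j<i. nsum (int (j * k)) k w\<bar> \<le> (\<Sum>j<i. \<bar>nsum (int (j * k)) k w\<bar>)" by (rule sum_abs)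
  moreover have "(\<Sum>j<i. \<bar>nsum (int (j * k)) k w\<bar>) \<le> (\<Sum>j<m. \<bar>nsum (int (j * k)) k w\<bar>)"
    using g(1) by (intro sum_mono2) auto
  ultimately have "\<bar>\<Sum>j<i. nsum (int (j * k)) k w\<bar> \<le> (\<Sum>j<m. \<bar>nsum (int (j * k)) k w\<bar>)"
    by (rule order_trans)
  then have 2: "\<bar>r * (\<Sum>j<i. nsum (int (j * k)) k w)\<bar> \<le> \<bar>r\<bar> * (\<Sum>j<m. \<bar>nsum (int (j * k)) k w\<bar>)"
    unfolding abs_mult by (intro mult_left_mono) auto
  have "\<bar>walk n w t - step m (\<lambda>j. (1 / sqrt (real m)) * nsum (int (j * k)) k w) t\<bar> \<le> e + \<bar>r\<bar> * (\<Sum>j<m. \<bar>nsum (int (j * k)) k w\<bar>)"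
    unfolding eq by (rule order_trans[OF abs_triangle_ineq add_mono[OF 1 2]])
  then show "min 1 \<bar>walk n w t - step m (\<lambda>j. (1 / sqrt (real m)) * nsum (int (j * k)) k w) t\<bar>
      \<le> e + \<bar>sd k / sd n - 1 / sqrt (real m)\<bar> * (\<Sum>j<m. \<bar>nsum (int (j * k)) k w\<bar>)"
    unfolding r_def[symmetric] by (rule order_trans[OF min.cobounded2])
qed

lemma filterlim_div: "m > 0 \<Longrightarrow> filterlim (\<lambda>n. n div m) sequentially sequentially"
  by (intro filterlim_at_top_div_const_nat)

text \<open>The blocks have length \<open>n div m\<close> rather than \<open>n / m\<close>; by \<open>grid_index\<close> the two grids stay within two
  blocks of each other, whence the range of \<open>l\<close>.\<close>

definition bad :: "nat \<Rightarrow> nat \<Rightarrow> real \<Rightarrow> 'w \<Rightarrow> bool" where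
  "bad m n e w \<longleftrightarrow> (\<exists>i\<le>m. \<exists>l\<le>2 * (n div m). \<bar>bsum (int (i * (n div m))) l (path w)\<bar> > e * sd n)"

lemma measurable_bad [measurable]: "Measurable.pred M (bad m n e)"
  unfolding bad_def[abs_def] by measurable

text \<open>Measured by the standard deviation of a block of length 2 k, the level e \<sigma>_n is
  of order e sqrt m. \<open>max_tail\<close> wins against the union over m + 1 blocks because it
  improves on 1 / b^2 by an arbitrarily small factor.\<close>

lemma bad_small:
  assumes e: "e > 0"
  shows "\<exists>m0. \<forall>m\<ge>m0. eventually (\<lambda>n. prob {w\<in>space M. bad m n e w} \<le> e) sequentially"
proof -
  \<comment> \<open>Chosen so that 2 m \<eta> / b^2 = e for b = e sqrt m / 4.\<close>
  define \<eta> where "\<eta> = e ^ 3 / 32"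
  have \<eta>: "\<eta> > 0" using e by (simp add: \<eta>_def)
  obtain b0 where b0: "b0 > 0" "\<And>b. b \<ge> b0 \<Longrightarrow> eventually (\<lambda>n.
    b\<^sup>2 * prob {w\<in>space M. \<exists>k\<le>n. \<bar>bsum 0 k (path w)\<bar> > 2 * b * sd n} < \<eta>) sequentially"
    using max_tail[OF \<eta>] by blast
  obtain m1 :: nat where m1: "(4 * b0 / e)\<^sup>2 < real m1" using reals_Archimedean2 by blast
  have "eventually (\<lambda>n. prob {w\<in>space M. bad m n e w} \<le> e) sequentially" if m: "m \<ge> Suc m1" for m
  proof -
    have mpos: "m > 0" "real m \<ge> 1" using m by auto
    define b where "b = e * sqrt (real m) / 4"
    have "4 * b0 / e \<le> sqrt (real m)"
      by (rule real_le_rsqrt) (use m m1 in linarith)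
    then have bb0: "b \<ge> b0" using e by (simp add: b_def field_simps)
    have bpos: "b > 0" using bb0 b0(1) by simp
    have div: "filterlim (\<lambda>n. 2 * (n div m)) sequentially sequentially"
      by (rule filterlim_compose[OF _ filterlim_div[OF mpos(1)]]) (intro filterlim_subseq, auto simp: strict_mono_def)
    have ev1: "eventually (\<lambda>n. b\<^sup>2 * prob {w\<in>space M. \<exists>l\<le>2 * (n div m). \<bar>bsum 0 l (path w)\<bar> > 2 * b * sd (2 * (n div m))} < \<eta>) sequentially"
      by (rule eventually_compose_filterlim[OF b0(2)[OF bb0] div])
    have "(\<lambda>n. (sd (2 * (n div m)) / sd (n div m)) / (sd n / sd (n div m))) \<longlonglongrightarrow> sqrt (real 2) / sqrt (real m)"
      using mpos by (intro tendsto_divide sd_ratio filterlim_compose[OF sd_ratio_mult[of 2] filterlim_div]) auto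
    \<comment> \<open>The gap between sqrt 2 and 2 leaves room for the limit: eventually
      \<open>sd (2 * k)\<close> is below 2 \<open>sd n\<close> / sqrt m, so that 2 b
      \<open>sd (2 * k)\<close> is at most e \<open>sd n\<close>.\<close>
    moreover have "sqrt (real 2) / sqrt (real m) < 2 / sqrt (real m)"
      using mpos by (intro divide_strict_right_mono) (auto intro!: real_less_lsqrt)
    ultimately have ev2: "eventually (\<lambda>n. (sd (2 * (n div m)) / sd (n div m)) / (sd n / sd (n div m)) < 2 / sqrt (real m)) sequentially"
      by (rule order_tendstoD(2))
    have ev3: "eventually (\<lambda>n. sd (n div m) > 0) sequentially"
      by (rule eventually_compose_filterlim[OF sd_pos filterlim_div[OF mpos(1)]])
    show ?thesis
      using ev1 ev2 ev3 sd_pos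
    proof eventually_elim
      case (elim n)
      define k where "k = n div m"
      have "sd (2 * k) / sd n < 2 / sqrt (real m)" using elim(2,3,4) unfolding k_def by simp
      then have sdk: "sd (2 * k) * sqrt (real m) < 2 * sd n"
        using elim(4) mpos by (simp add: field_simps)
      have le: "2 * b * sd (2 * k) \<le> e * sd n"
      proof -
        have "2 * b * sd (2 * k) = e / 2 * (sd (2 * k) * sqrt (real m))" by (simp add: b_def)
        also have "\<dots> \<le> e / 2 * (2 * sd n)" using sdk e by (intro mult_left_mono) auto
        finally show ?thesis by simp
      qed
      have one: "prob {w\<in>space M. \<exists>l\<le>2 * k. \<bar>bsum (int (i * k)) l (path w)\<bar> > e * sd n} \<le> \<eta> / b\<^sup>2" for i
      proof -
        have "prob {w\<in>space M. \<exists>l\<le>2 * k. \<bar>bsum 0 l (\<lambda>j. \<xi> (j + int (i * k)) w)\<bar> > e * sd n}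
            = prob {w\<in>space M. \<exists>l\<le>2 * k. \<bar>bsum 0 l (path w)\<bar> > e * sd n}"
          by (rule prob_shift[of "\<lambda>x. \<exists>l\<le>2 * k. \<bar>bsum 0 l x\<bar> > e * sd n"]) measurable
        then have "prob {w\<in>space M. \<exists>l\<le>2 * k. \<bar>bsum (int (i * k)) l (path w)\<bar> > e * sd n}
            = prob {w\<in>space M. \<exists>l\<le>2 * k. \<bar>bsum 0 l (path w)\<bar> > e * sd n}"
          unfolding bsum_shift_path by simp
        also have "\<dots> \<le> prob {w\<in>space M. \<exists>l\<le>2 * k. \<bar>bsum 0 l (path w)\<bar> > 2 * b * sd (2 * k)}"
          by (rule finite_measure_mono) (use le in \<open>auto intro: order_le_less_trans\<close>)
        also have "\<dots> \<le> \<eta> / b\<^sup>2"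
          using elim(1) bpos unfolding k_def by (simp add: pos_le_divide_eq mult.commute less_imp_le)
        finally show ?thesis .
      qed
      have "{w\<in>space M. bad m n e w} = (\<Union>i\<le>m. {w\<in>space M. \<exists>l\<le>2 * k. \<bar>bsum (int (i * k)) l (path w)\<bar> > e * sd n})"
        by (auto simp: bad_def k_def)
      then have "prob {w\<in>space M. bad m n e w} \<le> (\<Sum>i\<le>m. prob {w\<in>space M. \<exists>l\<le>2 * k. \<bar>bsum (int (i * k)) l (path w)\<bar> > e * sd n})"
        by (simp only:) (rule finite_measure_subadditive_finite, auto)
      also have "\<dots> \<le> (\<Sum>i\<le>m. \<eta> / b\<^sup>2)" by (intro sum_mono one)
      also have "\<dots> = (real m + 1) * (\<eta> / b\<^sup>2)" by simp
      also have "\<dots> \<le> (2 * real m) * (\<eta> / b\<^sup>2)" using mpos \<eta> by (intro mult_right_mono) auto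
      also have "\<dots> = e"
      proof -
        have "b\<^sup>2 = e\<^sup>2 * real m / 16" by (simp add: b_def power_mult_distrib power_divide)
        then have "\<eta> / b\<^sup>2 = (e ^ 3 / 32) / (e\<^sup>2 * real m / 16)" by (simp only: \<eta>_def)
        also have "\<dots> = e / (2 * real m)" using e mpos by (simp add: power3_eq_cube power2_eq_square)
        finally show ?thesis using mpos by simp
      qed
      finally show ?case .
    qed
  qed
  then show ?thesis by blast
qed

text \<open>One e for the distance on the good event, one for the probability of the bad event,
  where \<open>unif_dist\<close> is at most 1, and one for the mean of the normalisation
  error.\<close>

lemma walk_step_expectation:
  assumes G: "\<And>x x'. \<bar>G x - G x'\<bar> \<le> K * unif_dist x x'" "\<And>x. \<bar>G x\<bar> \<le> B" and K: "0 \<le> K" and e: "e > 0"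
  shows "\<exists>m0>0. \<forall>m\<ge>m0. eventually (\<lambda>n. \<bar>(\<integral>w. G (walk n w) \<partial>M)
    - (\<integral>w. G (step m (\<lambda>j. (1 / sqrt (real m)) * nsum (int (j * (n div m))) (n div m) w)) \<partial>M)\<bar> \<le> K * (3 * e)) sequentially"
proof -
  obtain m0 where m0: "\<And>m. m \<ge> m0 \<Longrightarrow> eventually (\<lambda>n. prob {w\<in>space M. bad m n e w} \<le> e) sequentially"
    using bad_small[OF e] by blast
  have "eventually (\<lambda>n. \<bar>(\<integral>w. G (walk n w) \<partial>M)
    - (\<integral>w. G (step m (\<lambda>j. (1 / sqrt (real m)) * nsum (int (j * (n div m))) (n div m) w)) \<partial>M)\<bar> \<le> K * (3 * e)) sequentially"
    if m: "m \<ge> Suc m0" for m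
  proof -
    have mpos: "m > 0" using m by simp
    define r where "r n = sd (n div m) / sd n - 1 / sqrt (real m)" for n
    have "(\<lambda>n. inverse (sd n / sd (n div m))) \<longlonglongrightarrow> inverse (sqrt (real m))"
      using mpos by (intro tendsto_inverse sd_ratio) auto
    then have r0: "r \<longlonglongrightarrow> 0" unfolding r_def[abs_def] by (simp add: LIM_zero inverse_eq_divide)
    have "(\<lambda>n. \<bar>r n\<bar> * real m) \<longlonglongrightarrow> \<bar>0\<bar> * real m" by (intro tendsto_intros r0)
    then have evr: "eventually (\<lambda>n. \<bar>r n\<bar> * real m < e) sequentially"
      using e by (intro order_tendstoD(2)[of _ 0]) auto
    have evk: "eventually (\<lambda>n. m \<le> n div m) sequentially"
      by (rule eventually_compose_filterlim[OF eventually_ge_at_top filterlim_div[OF mpos]])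
    have evs: "eventually (\<lambda>n. sd (n div m) > 0) sequentially"
      by (rule eventually_compose_filterlim[OF sd_pos filterlim_div[OF mpos]])
    have "m \<ge> m0" using m by simp
    from m0[OF this] evr evk evs sd_pos show ?thesis
    proof eventually_elim
      case (elim n)
      define k where "k = n div m"
      define Y where "Y w = (\<Sum>j<m. \<bar>nsum (int (j * k)) k w\<bar>)" for w
      let ?st = "\<lambda>w. step m (\<lambda>j. (1 / sqrt (real m)) * nsum (int (j * k)) k w)"
      have i1: "integrable M (\<lambda>w. G (walk n w))"
        by (intro integrable_const_bound[where B = B] measurable_walk[OF G K]) (simp add: G(2))
      have i2: "integrable M (\<lambda>w. G (?st w))"
        by (intro integrable_const_bound[where B = B] bdd_lip_measurable_comp[OF bdd_lip_step[OF G K]] measurable_nsum) (simp_all add: G(2))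
      have iY: "integrable M Y" unfolding Y_def[abs_def] by (intro Bochner_Integration.integrable_sum L2_integrable L2_abs L2_nsum)
      have ib: "integrable M (\<lambda>w. of_bool (bad m n e w) :: real)"
        by (intro integrable_const_bound[where B = 1]) auto
      have pt: "\<bar>G (walk n w) - G (?st w)\<bar> \<le> K * (e + of_bool (bad m n e w) + \<bar>r n\<bar> * Y w)" for w
      proof (rule order_trans[OF G(1) mult_left_mono[OF _ K]])
        have Y0: "0 \<le> \<bar>r n\<bar> * Y w" by (simp add: Y_def sum_nonneg)
        show "unif_dist (walk n w) (?st w) \<le> e + of_bool (bad m n e w) + \<bar>r n\<bar> * Y w"
        proof (cases "bad m n e w")
          case True
          then show ?thesis using unif_dist_le_1[of "walk n w" "?st w"] e Y0 by simp
        next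
          case False
          then have "\<forall>i\<le>m. \<forall>l\<le>2 * k. \<bar>bsum (int (i * k)) l (path w)\<bar> \<le> e * sd n"
            by (auto simp: bad_def k_def not_less)
          from unif_dist_walk_step[OF mpos k_def _ e _ _ this] elim(3,4,5) False show ?thesis
            by (simp add: k_def r_def Y_def)
        qed
      qed
      have eq: "(\<integral>w. G (walk n w) \<partial>M) - (\<integral>w. G (?st w) \<partial>M) = (\<integral>w. G (walk n w) - G (?st w) \<partial>M)"
        using i1 i2 by simp
      have "\<bar>(\<integral>w. G (walk n w) \<partial>M) - (\<integral>w. G (?st w) \<partial>M)\<bar> \<le> (\<integral>w. \<bar>G (walk n w) - G (?st w)\<bar> \<partial>M)"
        unfolding eq by (rule integral_abs_bound)
      also have "\<dots> \<le> (\<integral>w. K * (e + of_bool (bad m n e w) + \<bar>r n\<bar> * Y w) \<partial>M)"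
        by (intro integral_mono pt integrable_abs Bochner_Integration.integrable_diff i1 i2 integrable_mult_right
            Bochner_Integration.integrable_add ib iY integrable_const)
      also have "\<dots> = K * (e + (\<integral>w. of_bool (bad m n e w) \<partial>M) + \<bar>r n\<bar> * (\<integral>w. Y w \<partial>M))"
        using ib iY by (simp add: prob_space)
      also have "\<dots> \<le> K * (e + e + e)"
      proof (intro mult_left_mono add_mono K order_refl)
        show "(\<integral>w. of_bool (bad m n e w) \<partial>M) \<le> e"
          using elim(1) unfolding prob_eq_integral_of_bool .
        have "(\<integral>w. Y w \<partial>M) = (\<Sum>j<m. \<integral>w. \<bar>nsum (int (j * k)) k w\<bar> \<partial>M)"
          unfolding Y_def by (intro Bochner_Integration.integral_sum L2_integrable L2_abs L2_nsum)
        also have "\<dots> \<le> (\<Sum>j<m. 1)" by (intro sum_mono nsum_L1_le)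
        finally have "\<bar>r n\<bar> * (\<integral>w. Y w \<partial>M) \<le> \<bar>r n\<bar> * real m" by (intro mult_left_mono) auto
        then show "\<bar>r n\<bar> * (\<integral>w. Y w \<partial>M) \<le> e" using elim(2) by simp
      qed
      finally show ?case by (simp add: k_def)
    qed
  qed
  then show ?thesis by (intro exI[of _ "Suc m0"]) auto
qed

end

lemma bounded_cont_D_uminus: "bounded_cont_D F \<Longrightarrow> bounded_cont_D (\<lambda>x. - F x)"
  unfolding bounded_cont_D_def by (simp add: abs_minus_commute)

section \<open>Convergence to the scaled Brownian path\<close>

context cond_clt
begin

context
  fixes NB :: "'b measure" and B :: "real \<Rightarrow> 'b \<Rightarrow> real" and c :: real
  assumes BM: "std_brownian_motion NB B" and c_def: "c = sqrt (N.variance L)"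
begin

interpretation NB: prob_space NB
  using BM by (simp add: std_brownian_motion_def)

lemma BM_measurable: "B t \<in> borel_measurable NB"
  using BM by (simp add: std_brownian_motion_def)

definition inc :: "nat \<Rightarrow> nat \<Rightarrow> 'b \<Rightarrow> real" where
  "inc m j w = c * B (real (Suc j) / real m) w - c * B (real j / real m) w"

definition scaled_inc :: "nat \<Rightarrow> nat \<Rightarrow> 'b \<Rightarrow> real" where
  "scaled_inc m j w = (if j < m then sqrt (real m) * inc m j w else 0)"

lemma measurable_inc: "inc m j \<in> borel_measurable NB"
  unfolding inc_def[abs_def] by (intro borel_measurable_diff borel_measurable_times BM_measurable borel_measurable_const)

lemma measurable_scaled_inc: "scaled_inc m j \<in> borel_measurable NB"
  unfolding scaled_inc_def[abs_def] using measurable_inc[of m j] by (cases "j < m") auto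

text \<open>For c > 0 both laws are normal with standard deviation c, the factor sqrt m undoing the
  length 1 / m of the time step. For c = 0 there is no density, and both are the point mass at
  0.\<close>

lemma law_scaled_inc:
  assumes j: "j < m"
  shows "distr NB borel (scaled_inc m j) = distr N borel L"
proof (cases "c = 0")
  case True
  have "distr NB borel (scaled_inc m j) = distr NB borel (\<lambda>_. 0)"
  proof -
    have "scaled_inc m j = (\<lambda>_. 0)" unfolding scaled_inc_def[abs_def] inc_def using True by auto
    then show ?thesis by (rule arg_cong)
  qed
  also have "\<dots> = distr N borel (\<lambda>_. 0)" by (simp add: NB.distr_const N.distr_const)
  also have "\<dots> = distr N borel L"
    using L_zero True by (intro distr_cong_AE) (auto simp: c_def)
  finally show ?thesis .
next
  case False
  have "0 \<le> c" by (simp add: c_def variance_L)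
  with False have c: "c > 0" by simp
  then have var_pos: "N.variance L > 0" by (simp add: c_def)
  have m: "real m > 0" using j by simp
  have lt: "real j / real m < real (Suc j) / real m" "0 \<le> real j / real m" "real (Suc j) / real m \<le> 1"
    using j by (auto simp: divide_simps)
  have incdist: "distributed NB lborel (\<lambda>w. B (real (Suc j) / real m) w - B (real j / real m) w)
      (\<lambda>x. ennreal (normal_density 0 (sqrt (real (Suc j) / real m - real j / real m)) x))"
    using BM lt unfolding std_brownian_motion_def by blast
  have sq: "sqrt (real (Suc j) / real m - real j / real m) = 1 / sqrt (real m)"
    by (simp add: diff_divide_distrib[symmetric] real_sqrt_divide)
  have "distributed NB lborel (\<lambda>w. 0 + (sqrt (real m) * c) * (B (real (Suc j) / real m) w - B (real j / real m) w))
      (\<lambda>x. ennreal (normal_density (0 + (sqrt (real m) * c) * 0) (\<bar>sqrt (real m) * c\<bar> * (1 / sqrt (real m))) x))"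
    by (rule NB.normal_density_affine[OF incdist[unfolded sq]]) (use m c in auto)
  moreover have "\<bar>sqrt (real m) * c\<bar> * (1 / sqrt (real m)) = c" using m c by (simp add: abs_mult)
  moreover have "(\<lambda>w. 0 + (sqrt (real m) * c) * (B (real (Suc j) / real m) w - B (real j / real m) w)) = scaled_inc m j"
    using j by (auto simp: scaled_inc_def inc_def algebra_simps)
  ultimately have d: "distributed NB lborel (scaled_inc m j) (\<lambda>x. ennreal (normal_density 0 c x))" by simp
  have "distr NB lborel (scaled_inc m j) = distr N lborel L"
    using d L_normal[OF var_pos] by (simp add: distributed_def c_def)
  then show ?thesis by (simp add: distr_cong[of NB NB borel lborel] distr_cong[of N N borel lborel])
qed

lemma indep_scaled_inc: "NB.indep_vars (\<lambda>_. borel) (scaled_inc m) {..<m}"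
proof (cases "m = 0")
  case True
  then show ?thesis by (simp add: NB.indep_vars_def NB.indep_sets_def)
next
  case False
  define ts where "ts i = real i / real m" for i
  have "0 \<le> ts 0 \<and> ts m \<le> 1 \<and> (\<forall>i<m. ts i \<le> ts (Suc i))"
    using False by (auto simp: ts_def divide_right_mono)
  then have "NB.indep_vars (\<lambda>_. borel) (\<lambda>i w. B (ts (Suc i)) w - B (ts i) w) {..<m}"
    using BM unfolding std_brownian_motion_def by blast
  then have "NB.indep_vars (\<lambda>_. borel) (\<lambda>i w. sqrt (real m) * c * (B (ts (Suc i)) w - B (ts i) w)) {..<m}"
    by (rule NB.indep_vars_compose2) measurable
  moreover have "NB.indep_vars (\<lambda>_. borel) (\<lambda>i w. sqrt (real m) * c * (B (ts (Suc i)) w - B (ts i) w)) {..<m}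
      \<longleftrightarrow> NB.indep_vars (\<lambda>_. borel) (scaled_inc m) {..<m}"
    by (intro NB.indep_vars_cong refl) (auto simp: scaled_inc_def inc_def ts_def algebra_simps)
  ultimately show ?thesis by simp
qed

lemma cB_continuous:
  assumes "w \<in> space NB"
  shows "continuous_on {0..1} (\<lambda>t. c * B t w)" "c * B 0 w = 0"
proof -
  have "B 0 w = 0 \<and> continuous_on {0..1} (\<lambda>t. B t w)"
    using BM assms unfolding std_brownian_motion_def by blast
  then show "continuous_on {0..1} (\<lambda>t. c * B t w)" "c * B 0 w = 0"
    by (auto intro!: continuous_intros)
qed

lemma cB_D01: "w \<in> space NB \<Longrightarrow> (\<lambda>t. c * B t w) \<in> D01"
  by (rule continuous_on_D01[OF cB_continuous(1)])

context
  fixes G :: "(real \<Rightarrow> real) \<Rightarrow> real" and K b :: real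
  assumes G: "\<And>x x'. \<bar>G x - G x'\<bar> \<le> K * unif_dist x x'" and Gb: "\<And>x. \<bar>G x\<bar> \<le> b" and K: "0 \<le> K"
begin

lemma measurable_G_step_inc: "(\<lambda>w. G (step m (\<lambda>j. inc m j w))) \<in> borel_measurable NB"
  using bdd_lip_measurable_comp[OF bdd_lip_step[OF G Gb K, of 1 m], of "inc m" NB] measurable_inc by simp

lemma G_step_inc_tendsto: "w \<in> space NB \<Longrightarrow> (\<lambda>m. G (step m (\<lambda>j. inc m j w))) \<longlonglongrightarrow> G (\<lambda>t. c * B t w)"
proof -
  assume w: "w \<in> space NB"
  have "(\<lambda>m. unif_dist (step m (\<lambda>j. inc m j w)) (\<lambda>t. c * B t w)) \<longlonglongrightarrow> 0"
    unfolding inc_def using step_approx_continuous[OF cB_continuous[OF w]] .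
  then have "(\<lambda>m. K * unif_dist (step m (\<lambda>j. inc m j w)) (\<lambda>t. c * B t w)) \<longlonglongrightarrow> 0"
    by (rule tendsto_mult_right_zero)
  then have "(\<lambda>m. G (step m (\<lambda>j. inc m j w)) - G (\<lambda>t. c * B t w)) \<longlonglongrightarrow> 0"
    by (rule Lim_null_comparison[rotated]) (simp add: G)
  then show ?thesis by (simp add: LIM_zero_iff)
qed

text \<open>No sigma-algebra is placed on the path space: measurability comes from a limit of
  functionals of finitely many increments.\<close>

lemma measurable_G_cB: "(\<lambda>w. G (\<lambda>t. c * B t w)) \<in> borel_measurable NB"
  by (rule borel_measurable_LIMSEQ_real[OF G_step_inc_tendsto measurable_G_step_inc])

lemma integral_G_step_inc_tendsto:
  "(\<lambda>m. \<integral>w. G (step m (\<lambda>j. inc m j w)) \<partial>NB) \<longlonglongrightarrow> (\<integral>w. G (\<lambda>t. c * B t w) \<partial>NB)"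
proof (rule integral_dominated_convergence[where w = "\<lambda>_. b"])
  show "AE w in NB. (\<lambda>m. G (step m (\<lambda>j. inc m j w))) \<longlonglongrightarrow> G (\<lambda>t. c * B t w)"
    by (intro AE_I2 G_step_inc_tendsto)
qed (use measurable_G_cB measurable_G_step_inc Gb in auto)

lemma fdd_blocks:
  assumes m: "m > 0"
  shows "(\<lambda>n. \<integral>w. G (step m (\<lambda>j. (1 / sqrt (real m)) * nsum (int (j * (n div m))) (n div m) w)) \<partial>M)
    \<longlonglongrightarrow> (\<integral>w. G (step m (\<lambda>j. inc m j w)) \<partial>NB)"
proof -
  let ?H = "\<lambda>y. G (step m (\<lambda>j. (1 / sqrt (real m)) * y j))"
  have H: "bdd_lip m ?H (K * (1 / sqrt (real m))) b" by (rule bdd_lip_step[OF G Gb K]) simp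
  have "(\<lambda>n. \<integral>w. ?H (\<lambda>j. nsum (int (j * n)) n w) \<partial>M) \<longlonglongrightarrow> (\<integral>w. ?H (\<lambda>j. scaled_inc m j w) \<partial>NB)"
    by (rule fdd[OF NB.prob_space_axioms indep_scaled_inc measurable_scaled_inc law_scaled_inc order_refl H])
  then have "(\<lambda>n. \<integral>w. ?H (\<lambda>j. nsum (int (j * (n div m))) (n div m) w) \<partial>M) \<longlonglongrightarrow> (\<integral>w. ?H (\<lambda>j. scaled_inc m j w) \<partial>NB)"
    by (rule filterlim_compose[OF _ filterlim_div[OF m]])
  moreover have "step m (\<lambda>j. (1 / sqrt (real m)) * scaled_inc m j w) = step m (\<lambda>j. inc m j w)" for w
    unfolding step_def using m by (intro ext sum.cong refl) (auto simp: scaled_inc_def)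
  ultimately show ?thesis by simp
qed

text \<open>Order of limits: m is fixed large enough that the walk is close to its block sums for
  all large n and that the Brownian path is close to its own step function; for this m, n tends to
  infinity.\<close>

lemma lipschitz_functional_tendsto:
  "(\<lambda>n. \<integral>w. G (walk n w) \<partial>M) \<longlonglongrightarrow> (\<integral>w. G (\<lambda>t. c * B t w) \<partial>NB)"
proof (rule tendstoI)
  fix r :: real assume r: "r > 0"
  \<comment> \<open>This makes 3 K e smaller than r / 4; K + 1 in place of K avoids a division by
    0.\<close>
  define e where "e = r / (12 * (K + 1))"
  have e: "e > 0" using r K by (simp add: e_def)
  have Ke: "K * (3 * e) < r / 3"
  proof -
    have "K * (3 * e) < (K + 1) * (3 * e)" using e by (intro mult_strict_right_mono) auto
    also have "\<dots> = r / 4" using K by (simp add: e_def field_simps)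
    also have "\<dots> < r / 3" using r by simp
    finally show ?thesis .
  qed
  obtain m0 where m0: "m0 > 0" "\<And>m. m \<ge> m0 \<Longrightarrow> eventually (\<lambda>n. \<bar>(\<integral>w. G (walk n w) \<partial>M)
    - (\<integral>w. G (step m (\<lambda>j. (1 / sqrt (real m)) * nsum (int (j * (n div m))) (n div m) w)) \<partial>M)\<bar> \<le> K * (3 * e)) sequentially"
    using walk_step_expectation[OF G Gb K e] by blast
  have "eventually (\<lambda>m. dist (\<integral>w. G (step m (\<lambda>j. inc m j w)) \<partial>NB) (\<integral>w. G (\<lambda>t. c * B t w) \<partial>NB) < r / 3) sequentially"
    using r by (intro tendstoD[OF integral_G_step_inc_tendsto]) simp
  then obtain m1 where m1: "\<And>m. m \<ge> m1 \<Longrightarrow> dist (\<integral>w. G (step m (\<lambda>j. inc m j w)) \<partial>NB) (\<integral>w. G (\<lambda>t. c * B t w) \<partial>NB) < r / 3"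
    by (auto simp: eventually_sequentially)
  define m where "m = max m0 m1"
  have m: "m > 0" "m \<ge> m0" "m \<ge> m1" using m0(1) by (auto simp: m_def)
  have "eventually (\<lambda>n. dist (\<integral>w. G (step m (\<lambda>j. (1 / sqrt (real m)) * nsum (int (j * (n div m))) (n div m) w)) \<partial>M)
      (\<integral>w. G (step m (\<lambda>j. inc m j w)) \<partial>NB) < r / 3) sequentially"
    using r by (intro tendstoD[OF fdd_blocks[OF m(1)]]) simp
  with m0(2)[OF m(2)] show "eventually (\<lambda>n. dist (\<integral>w. G (walk n w) \<partial>M) (\<integral>w. G (\<lambda>t. c * B t w) \<partial>NB) < r) sequentially"
  proof eventually_elim
    case (elim n)
    have tri: "\<bar>x - y\<bar> \<le> a1 \<Longrightarrow> a1 < r / 3 \<Longrightarrow> \<bar>y - z\<bar> < r / 3 \<Longrightarrow> \<bar>z - w\<bar> < r / 3 \<Longrightarrow> \<bar>x - w\<bar> < r" for x y z w a1 :: real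
      by linarith
    show ?case
      unfolding dist_real_def
      by (rule tri[OF elim(1) Ke elim(2)[unfolded dist_real_def] m1[OF m(3), unfolded dist_real_def]])
  qed
qed

end

text \<open>Along paths in \<open>D01\<close> a bounded Skorokhod-continuous functional is the
  pointwise limit of its Lipschitz envelopes, whose measurability is known.\<close>

lemma functional_measurable:
  assumes F: "bounded_cont_D F" and FB: "\<And>x. x \<in> D01 \<Longrightarrow> \<bar>F x\<bar> \<le> b"
  shows "(\<lambda>w. F (walk n w)) \<in> borel_measurable M" and "(\<lambda>w. F (\<lambda>t. c * B t w)) \<in> borel_measurable NB"
proof -
  show "(\<lambda>w. F (walk n w)) \<in> borel_measurable M"
    by (rule borel_measurable_LIMSEQ_real[OF lip_reg_tendsto[OF FB F walk_D01]
      measurable_walk[OF lip_reg_lipschitz[OF FB] lip_reg_bounded[OF FB]]]) simp_all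
  show "(\<lambda>w. F (\<lambda>t. c * B t w)) \<in> borel_measurable NB"
    by (rule borel_measurable_LIMSEQ_real[OF lip_reg_tendsto[OF FB F cB_D01]
      measurable_G_cB[OF lip_reg_lipschitz[OF FB] lip_reg_bounded[OF FB]]]) simp_all
qed

text \<open>The envelopes approach F from below, which yields the lower half of the convergence; the
  upper half is this statement for -F.\<close>

lemma functional_lower:
  assumes F: "bounded_cont_D F" and e: "e > 0"
  shows "eventually (\<lambda>n. (\<integral>w. F (\<lambda>t. c * B t w) \<partial>NB) - e < (\<integral>w. F (walk n w) \<partial>M)) sequentially"
proof -
  obtain b where "\<forall>x\<in>D01. \<bar>F x\<bar> \<le> b" using F unfolding bounded_cont_D_def by blast
  then have FB: "\<And>x. x \<in> D01 \<Longrightarrow> \<bar>F x\<bar> \<le> b" by simp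
  note lip = lip_reg_lipschitz[OF FB] lip_reg_bounded[OF FB]
  have m1: "(\<lambda>w. lip_reg F k (walk n w)) \<in> borel_measurable M" for k n
    by (rule measurable_walk[OF lip]) simp_all
  have m2: "(\<lambda>w. lip_reg F k (\<lambda>t. c * B t w)) \<in> borel_measurable NB" for k
    by (rule measurable_G_cB[OF lip]) simp_all
  have "(\<lambda>k. \<integral>w. lip_reg F k (\<lambda>t. c * B t w) \<partial>NB) \<longlonglongrightarrow> (\<integral>w. F (\<lambda>t. c * B t w) \<partial>NB)"
  proof (rule integral_dominated_convergence[where w = "\<lambda>_. b"])
    show "AE w in NB. (\<lambda>k. lip_reg F k (\<lambda>t. c * B t w)) \<longlonglongrightarrow> F (\<lambda>t. c * B t w)"
      by (intro AE_I2 lip_reg_tendsto[OF FB F cB_D01])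
    show "AE w in NB. norm (lip_reg F k (\<lambda>t. c * B t w)) \<le> b" for k
      unfolding real_norm_def by (intro AE_I2 lip_reg_bounded_D01[OF FB cB_D01])
  qed (use m2 functional_measurable(2)[OF F FB] in auto)
  then have "eventually (\<lambda>k. (\<integral>w. F (\<lambda>t. c * B t w) \<partial>NB) - e < (\<integral>w. lip_reg F k (\<lambda>t. c * B t w) \<partial>NB)) sequentially"
    by (rule order_tendstoD(1)) (use e in simp)
  then obtain k where k: "(\<integral>w. F (\<lambda>t. c * B t w) \<partial>NB) - e < (\<integral>w. lip_reg F k (\<lambda>t. c * B t w) \<partial>NB)"
    by (auto simp: eventually_sequentially)
  have "(\<lambda>n. \<integral>w. lip_reg F k (walk n w) \<partial>M) \<longlonglongrightarrow> (\<integral>w. lip_reg F k (\<lambda>t. c * B t w) \<partial>NB)"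
    by (rule lipschitz_functional_tendsto[OF lip]) simp_all
  from order_tendstoD(1)[OF this k] show ?thesis
  proof eventually_elim
    case (elim n)
    have "(\<integral>w. lip_reg F k (walk n w) \<partial>M) \<le> (\<integral>w. F (walk n w) \<partial>M)"
    proof (rule integral_mono)
      show "integrable M (\<lambda>w. lip_reg F k (walk n w))"
        by (rule integrable_const_bound[where B = b, OF _ m1]) (auto intro!: AE_I2 lip_reg_bounded_D01[OF FB walk_D01])
      show "integrable M (\<lambda>w. F (walk n w))"
        by (rule integrable_const_bound[where B = b, OF _ functional_measurable(1)[OF F FB]]) (auto intro!: AE_I2 FB walk_D01)
    qed (rule lip_reg_le[OF FB walk_D01])
    then show ?case using elim by simp
  qed
qed

lemma weak_convergence: "weak_conv_D M walk NB (\<lambda>w t. c * B t w)"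
  unfolding weak_conv_D_def
proof (intro allI impI)
  fix F assume F: "bounded_cont_D F"
  show "(\<lambda>n. \<integral>w. F (walk n w) \<partial>M) \<longlonglongrightarrow> (\<integral>w. F (\<lambda>t. c * B t w) \<partial>NB)"
  proof (rule tendstoI)
    fix e :: real assume e: "e > 0"
    show "eventually (\<lambda>n. dist (\<integral>w. F (walk n w) \<partial>M) (\<integral>w. F (\<lambda>t. c * B t w) \<partial>NB) < e) sequentially"
      using functional_lower[OF F e] functional_lower[OF bounded_cont_D_uminus[OF F] e]
      by eventually_elim (simp add: dist_real_def abs_less_iff)
  qed
qed

end

end

theorem theorem1:
  fixes M :: "'w measure" and S :: "'s measure" and \<xi> :: "int \<Rightarrow> 'w \<Rightarrow> 's"
    and \<pi> :: "'s measure" and Q :: "'s \<Rightarrow> 's measure"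
    and f :: "'s \<Rightarrow> real" and h :: "real \<Rightarrow> real"
    and N :: "'l measure" and L :: "'l \<Rightarrow> real"
    and Sn :: "nat \<Rightarrow> 'w \<Rightarrow> real" and \<sigma> :: "nat \<Rightarrow> real"
    and W :: "nat \<Rightarrow> 'w \<Rightarrow> real \<Rightarrow> real"
  assumes chain: "stationary_markov_chain M S \<xi> \<pi> Q"
    and rev: "reversible_chain M S \<xi>"
    and f: "L2_0 \<pi> f"
    and Sn_def: "\<And>n \<omega>. Sn n \<omega> = (\<Sum>i=1..n. f (\<xi> (int i) \<omega>))"
    and \<sigma>_def: "\<And>n. \<sigma> n = sqrt (\<integral>\<omega>. (Sn n \<omega>)\<^sup>2 \<partial>M)"
    and \<sigma>_inf: "filterlim \<sigma> at_top sequentially"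
    and h: "slowly_varying h"
    and \<sigma>_h: "\<And>n. (\<sigma> n)\<^sup>2 = real n * h (real n)"
    and L: "prob_space N" "L \<in> borel_measurable N"
    and cond_conv: "\<And>g :: real \<Rightarrow> real. continuous_on UNIV g \<Longrightarrow> bounded (range g) \<Longrightarrow>
        \<forall>\<epsilon>>0. (\<lambda>n. measure M {\<omega>\<in>space M.
            \<bar>real_cond_exp M (past_sigma M S \<xi> 0) (\<lambda>\<omega>. g (Sn n \<omega> / \<sigma> n)) \<omega>
              - (\<integral>x. g (L x) \<partial>N)\<bar> > \<epsilon>}) \<longlonglongrightarrow> 0"
    and W_def: "\<And>n \<omega> t. W n \<omega> t = Sn (nat \<lfloor>real n * t\<rfloor>) \<omega> / \<sigma> n"
  shows "integrable N (\<lambda>x. (L x)\<^sup>2) \<and>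
    (let c = sqrt (prob_space.variance N L) in
       (c = 0 \<longrightarrow> (AE x in N. L x = 0)) \<and>
       (c > 0 \<longrightarrow> distributed N lborel L (\<lambda>x. ennreal (normal_density 0 c x))) \<and>
       (\<forall>(NB :: 'b measure) B. std_brownian_motion NB B \<longrightarrow>
          weak_conv_D M W NB (\<lambda>\<omega> t. c * B t \<omega>)))"
proof -
  interpret R: reversible_markov_functional M S \<xi> \<pi> Q f
    by standard (rule chain rev f)+
  have Sn: "Sn n \<omega> = R.bsum 0 n (\<lambda>i. \<xi> i \<omega>)" for n \<omega>
    by (simp add: Sn_def R.bsum_def)
  have \<sigma>: "\<sigma> n = sqrt (R.var n)" for n
    by (simp add: \<sigma>_def R.var_def Sn)
  have var: "R.var n = real n * h (real n)" for n
    using \<sigma>_h[of n] R.var_nonneg[of n] by (simp add: \<sigma>)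
  interpret C: cond_clt M S \<xi> \<pi> Q f N L
  proof (intro cond_clt.intro cond_clt_axioms.intro)
    show "reversible_markov_functional M S \<xi> \<pi> Q f" by (rule R.reversible_markov_functional_axioms)
    show "prob_space N" "L \<in> borel_measurable N" by (rule L)+
    show "filterlim R.var at_top sequentially"
    proof -
      have "filterlim (\<lambda>n. (\<sigma> n)\<^sup>2) at_top sequentially"
        by (rule filterlim_pow_at_top[OF _ \<sigma>_inf]) simp
      then show ?thesis by (simp add: \<sigma> R.var_nonneg)
    qed
    show "(\<lambda>n. R.var (m * n) / R.var n) \<longlonglongrightarrow> real m" if m: "m > 0" for m
    proof -
      \<comment> \<open>Slow variation at the fixed dilation m, read along the integers; the factor
        n cancels in the ratio once n > 0.\<close>
      have "((\<lambda>x. h (x * real m) / h x) \<longlongrightarrow> 1) at_top"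
        using h m by (simp add: slowly_varying_def)
      then have "(\<lambda>n. h (real n * real m) / h (real n)) \<longlonglongrightarrow> 1"
        by (rule filterlim_compose[OF _ filterlim_real_sequentially])
      then have "(\<lambda>n. real m * (h (real n * real m) / h (real n))) \<longlonglongrightarrow> real m * 1"
        by (rule tendsto_mult_left)
      moreover have "eventually (\<lambda>n. real m * (h (real n * real m) / h (real n)) = R.var (m * n) / R.var n) sequentially"
        using eventually_gt_at_top[of 0] by eventually_elim (simp add: var mult.commute)
      ultimately show ?thesis by (simp add: tendsto_cong)
    qed
    show "(\<lambda>n. measure M {\<omega>\<in>space M. \<bar>real_cond_exp M (past_sigma M S \<xi> 0) (\<lambda>\<omega>. g (R.bsum 0 n (\<lambda>i. \<xi> i \<omega>) / sqrt (R.var n))) \<omega>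
          - (\<integral>x. g (L x) \<partial>N)\<bar> > \<epsilon>}) \<longlonglongrightarrow> 0"
      if "continuous_on UNIV g" "bounded (range g)" "\<epsilon> > 0" for g :: "real \<Rightarrow> real" and \<epsilon>
      using cond_conv[OF that(1,2)] that(3) by (simp only: Sn \<sigma>)
  qed
  have W: "W = C.walk"
    by (intro ext) (simp add: W_def C.walk_def Sn \<sigma> C.sd_def)
  show ?thesis
    unfolding Let_def W
  proof (intro conjI impI allI)
    show "integrable N (\<lambda>x. (L x)\<^sup>2)" by (rule L2_sq[OF C.L2_L])
    show "AE x in N. L x = 0" if "sqrt (prob_space.variance N L) = 0"
      using that by (intro C.L_zero) simp
    show "distributed N lborel L (\<lambda>x. ennreal (normal_density 0 (sqrt (prob_space.variance N L)) x))" if "sqrt (prob_space.variance N L) > 0"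
      using that by (intro C.L_normal) simp
    show "weak_conv_D M C.walk NB (\<lambda>\<omega> t. sqrt (prob_space.variance N L) * B t \<omega>)" if "std_brownian_motion NB B" for NB :: "'b measure" and B
      by (rule C.weak_convergence[OF that refl])
  qed
qed

end
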